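(* Let $\lambda/\mu$ be a skew partition, with conjugates $\lambda',\mu'$, and let $\mathbf{v}=(v_{ij})\in T(\lambda/\mu,\mathbb{C})$ be a tableau whose entries are variables. Assume that the real parts of the variables $v_{1j}$ with $\min\{\lambda_2,\sum_{i\ge2}(\lambda_i-\mu_i)\}+\mu_1\le j\le\lambda_1-1$ and of the variables $v_{i1}$ with $\min\{\lambda'_2,\sum_{j\ge2}(\lambda'_j-\mu'_j)\}+\mu'_1\le i\le\lambda'_1-1$ are greater than or equal to $1$, and that the real parts of all other variables are greater than $1$. Let $\mathcal{G}(\lambda/\mu)$ be the set of all partitions $\nu$ with $c_{\mu\nu}^\lambda>0$. Then for every choice of a family $(\mathbf{u}_\nu(\mathbf{v})\in U_\nu(\mathbf{v}))_{\nu\in\mathcal{G}(\lambda/\mu)}$, $$\sum_{\mathrm{Sym}(B(\mathbf{v}))}\zeta_{\lambda/\mu}(\mathbf{v})=\sum_{\mathrm{Sym}(B(\mathbf{v}))}\ \sum_{\nu\in\mathcal{G}(\lambda/\mu)}c_{\mu\nu}^{\lambda}\,\zeta_\nu(\mathbf{u}_\nu(\mathbf{v})),$$ where $\sum_{\mathrm{Sym}(B(\mathbf{v}))}$ denotes the summation over the permutations of all variables in the body $B(\mathbf{v})$.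
   Context: **Partitions, diagrams, tableaux.** A partition $\lambda=(\lambda_1\ge\lambda_2\ge\cdots)$ has Young diagram $D(\lambda)=\{(i,j): 1\le j\le\lambda_i\}$ (row $i$, column $j$; rows numbered downwards; $\lambda_i=0$ beyond the last part). $\lambda'$ is the conjugate: $\lambda'_j=\#\{i:\lambda_i\ge j\}$. A skew partition $\delta=\lambda/\mu$ ($\mu_i\le\lambda_i$ for all $i$; $\mu=\emptyset$ allowed) has diagram $D(\lambda/\mu)=D(\lambda)\setminus D(\mu)$; a "normal" shape is one with $\mu=\emptyset$. $T(\delta,X)$ is the set of fillings of $D(\delta)$ by elements of $X$. $\mathrm{SSYT}(\delta)$ is the set of semi-standard Young tableaux of shape $\delta$: fillings by positive integers, rows weakly increasing left to right, columns strictly increasing top to bottom. Semi-standard tableaux over any other totally ordered set are defined in the same way. **Schur multiple zeta function.** For $\mathbf{s}=(s_{ij})\in T(\delta,\mathbb{C})$, $\zeta_\delta(\mathbf{s})=\sum_{M\in\mathrm{SSYT}(\delta)}\prod_{(i,j)\in D(\delta)}m_{ij}^{-s_{ij}}$, where $M=(m_{ij})$. It converges absolutely if $\Re(s_{ij})\ge1$ for all boxes and $\Re(s_{ij})>1$ at all corners (boxes $(i,j)\in D(\delta)$ with $(i+1,j),(i,j+1)\notin D(\delta)$). **Littlewood–Richardson coefficients.** $c_{\mu\nu}^\lambda$ is defined by $s_\mu s_\nu=\sum_\lambda c_{\mu\nu}^\lambda s_\lambda$ for Schur functions. **Arms and body.** With $m=\min\{\lambda_2,\sum_{i\ge2}(\lambda_i-\mu_i)\}$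 and $n=\min\{\lambda'_2,\sum_{j\ge2}(\lambda'_j-\mu'_j)\}$, the right-arm $A_r(\lambda/\mu)$ consists of the boxes $(1,j)\in D(\lambda/\mu)$ with $m+\mu_1\le j\le\lambda_1$, the left-arm $A_l(\lambda/\mu)$ consists of the boxes $(i,1)\in D(\lambda/\mu)$ with $n+\mu'_1\le i\le\lambda'_1$ (either may be empty), and the body $B(\lambda/\mu)$ is what remains of $D(\lambda/\mu)$ after removing both arms. For a filling $\mathbf{v}$ of $\lambda/\mu$, $B(\mathbf{v})$ is the restriction of $\mathbf{v}$ to $B(\lambda/\mu)$. **Rectification.** The row-word $w_{row}(L)$ of a tableau $L$ is obtained by reading rows from bottom to top, each from left to right. Knuth equivalence of words over a totally ordered set is the equivalence relation generated by $u\,bca\,v\sim u\,bac\,v$ for $a<b\le c$ and $u\,acb\,v\sim u\,cab\,v$ for $a\le b<c$. For a (skew) semi-standard tableau $L$, $\mathrm{Rect}(L)$ is the unique semi-standard tableau of normal shape whose row-word is Knuth equivalent to $w_{row}(L)$ (equivalently, the result of jeu de taquin on $L$). **Labeling.** $\tilde{\mathbb{N}}=\{k_l: k,l\ge1\}$ is totally ordered by $1_1<1_2<\cdots<2_1<2_2<\cdots<3_1<\cdots$. For $L\in \mathrm{SSYT}(\delta)$, $\phi_T(L)$ is the semi-standard tableau over $\tilde{\mathbb{N}}$ obtained by giving, for each $k$, the entries equal to $k$ the subscripts $1,2,\dots$ in the order in which they occur reading rows from bottom to top and each row from left to right. Entries of $\phi_T(L)$ are pairwise distinct. **$\mathbf{v}_L$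 and $U_\nu(\mathbf{v})$.** Let $L\in \mathrm{SSYT}(\lambda/\mu)$ and let $\nu$ be the shape of $\mathrm{Rect}(L)$ (which equals the shape of $\mathrm{Rect}(\phi_T(L))$). Let $\rho_L:D(\lambda/\mu)\to D(\nu)$ be the bijection sending a box to the box of $\mathrm{Rect}(\phi_T(L))$ containing the same element of $\tilde{\mathbb{N}}$ that the original box contains in $\phi_T(L)$. Then $\mathbf{v}_L\in T(\nu,\mathbb{C})$ is the tableau whose entry in box $\rho_L(i,j)$ is $v_{ij}$. Put $U_\nu(\mathbf{v})=\{\mathbf{v}_L : L\in \mathrm{SSYT}(\lambda/\mu),\ \mathrm{Rect}(L)\text{ has shape }\nu\}$; it is non-empty for $\nu\in\mathcal{G}(\lambda/\mu)$. **Symmetrization.** $\sum_{\mathrm{Sym}(B(\mathbf{v}))}F$ means the sum, over all permutations $\sigma$ of the set of variables in $B(\mathbf{v})$, of the expression obtained from $F$ by substituting $\sigma(x)$ for each such variable $x$ (all other variables being fixed). In particular $\mathbf{u}_\nu(\mathbf{v})=\mathbf{v}_{L_\nu}$ is a fixed arrangement of the variables (with $L_\nu$ fixed) and $\sigma$ acts on the variables in it. *)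

theory Defs
  imports "HOL-Analysis.Analysis"
begin

section \<open>Partitions and diagrams\<close>

text \<open>A partition is a function giving the row lengths, with rows numbered from 1. The junk
  value \<open>l 0 = 0\<close> is fixed so that distinct functions are distinct partitions.\<close>

definition is_partition :: "(nat \<Rightarrow> nat) \<Rightarrow> bool" where
  "is_partition l \<longleftrightarrow>
     l 0 = 0 \<and> (\<forall>i\<ge>1. \<forall>j\<ge>i. l j \<le> l i) \<and> finite {i. l i \<noteq> 0}"

definition conj_partition :: "(nat \<Rightarrow> nat) \<Rightarrow> nat \<Rightarrow> nat" where
  "conj_partition l j = (if j = 0 then 0 else card {i. l i \<ge> j})"

definition diagram :: "(nat \<Rightarrow> nat) \<Rightarrow> (nat \<times> nat) set" where
  "diagram l = {(i, j). 1 \<le> i \<and> 1 \<le> j \<and> j \<le> l i}"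

definition is_skew :: "(nat \<Rightarrow> nat) \<Rightarrow> (nat \<Rightarrow> nat) \<Rightarrow> bool" where
  "is_skew lam mu \<longleftrightarrow> is_partition lam \<and> is_partition mu \<and> (\<forall>i. mu i \<le> lam i)"

definition skew_diagram :: "(nat \<Rightarrow> nat) \<Rightarrow> (nat \<Rightarrow> nat) \<Rightarrow> (nat \<times> nat) set" where
  "skew_diagram lam mu = diagram lam - diagram mu"

text \<open>Fillings are functions on boxes that are \<open>undefined\<close> outside the diagram, so that a
  set of tableaux contains each tableau once.\<close>

definition fillings :: "(nat \<times> nat) set \<Rightarrow> 'a set \<Rightarrow> (nat \<times> nat \<Rightarrow> 'a) set" where
  "fillings D X = D \<rightarrow>\<^sub>E X"

definition ssyt :: "(nat \<times> nat) set \<Rightarrow> 'a::linorder set \<Rightarrow> (nat \<times> nat \<Rightarrow> 'a) set" where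
  "ssyt D X = {M \<in> fillings D X.
     (\<forall>i j j'. (i, j) \<in> D \<and> (i, j') \<in> D \<and> j < j' \<longrightarrow> M (i, j) \<le> M (i, j')) \<and>
     (\<forall>i i' j. (i, j) \<in> D \<and> (i', j) \<in> D \<and> i < i' \<longrightarrow> M (i, j) < M (i', j))}"

abbreviation SSYT :: "(nat \<times> nat) set \<Rightarrow> (nat \<times> nat \<Rightarrow> nat) set" where
  "SSYT D \<equiv> ssyt D {1..}"


section \<open>Schur multiple zeta functions\<close>

text \<open>\<open>infsum\<close> is unconditional (for complex series: absolute) summation.\<close>

definition schur_zeta :: "(nat \<times> nat) set \<Rightarrow> (nat \<times> nat \<Rightarrow> complex) \<Rightarrow> complex" where
  "schur_zeta D s = (\<Sum>\<^sub>\<infinity>M\<in>SSYT D. \<Prod>b\<in>D. of_nat (M b) powr (- s b))"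


section \<open>Schur functions and Littlewood--Richardson coefficients\<close>

text \<open>A formal power series with integer coefficients in \<open>x\<^sub>1, x\<^sub>2, \<dots>\<close> is represented by its
  coefficient function; the multiset \<open>{#k\<^sub>1, \<dots>, k\<^sub>r#}\<close> stands for the monomial
  \<open>x\<^bsub>k\<^sub>1\<^esub> \<cdots> x\<^bsub>k\<^sub>r\<^esub>\<close>.\<close>

definition schur :: "(nat \<Rightarrow> nat) \<Rightarrow> nat multiset \<Rightarrow> int" where
  "schur l A =
     int (card {M \<in> SSYT (diagram l). image_mset M (mset_set (diagram l)) = A})"

definition series_mult ::
    "(nat multiset \<Rightarrow> int) \<Rightarrow> (nat multiset \<Rightarrow> int) \<Rightarrow> nat multiset \<Rightarrow> int" where
  "series_mult f g A = (\<Sum>B | B \<subseteq># A. f B * g (A - B))"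

text \<open>The value \<open>lr_coeff mu nu lam\<close> is the coefficient of \<open>schur lam\<close> in the expansion of
  the product of \<open>schur mu\<close> and \<open>schur nu\<close> as a finite linear combination of Schur functions.\<close>

definition lr_coeff :: "(nat \<Rightarrow> nat) \<Rightarrow> (nat \<Rightarrow> nat) \<Rightarrow> (nat \<Rightarrow> nat) \<Rightarrow> int" where
  "lr_coeff mu nu = (THE c.
     finite {lam. c lam \<noteq> 0} \<and> {lam. c lam \<noteq> 0} \<subseteq> {lam. is_partition lam} \<and>
     (\<forall>A. series_mult (schur mu) (schur nu) A = (\<Sum>lam | c lam \<noteq> 0. c lam * schur lam A)))"

definition G_set :: "(nat \<Rightarrow> nat) \<Rightarrow> (nat \<Rightarrow> nat) \<Rightarrow> (nat \<Rightarrow> nat) set" where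
  "G_set lam mu = {nu. is_partition nu \<and> lr_coeff mu nu lam > 0}"


section \<open>Arms and body\<close>

text \<open>The range \<open>{i. 2 \<le> i \<and> lam i \<noteq> 0}\<close> is finite, and all terms omitted from
  \<open>\<Sum>\<^bsub>i\<ge>2\<^esub> (lam i - mu i)\<close> are zero.\<close>

definition arm_start :: "(nat \<Rightarrow> nat) \<Rightarrow> (nat \<Rightarrow> nat) \<Rightarrow> nat" where
  "arm_start lam mu = min (lam 2) (\<Sum>i | 2 \<le> i \<and> lam i \<noteq> 0. lam i - mu i) + mu 1"

definition right_arm :: "(nat \<Rightarrow> nat) \<Rightarrow> (nat \<Rightarrow> nat) \<Rightarrow> (nat \<times> nat) set" where
  "right_arm lam mu =
     {(1, j) | j. (1, j) \<in> skew_diagram lam mu \<and> arm_start lam mu \<le> j \<and> j \<le> lam 1}"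

definition left_arm :: "(nat \<Rightarrow> nat) \<Rightarrow> (nat \<Rightarrow> nat) \<Rightarrow> (nat \<times> nat) set" where
  "left_arm lam mu =
     {(i, 1) | i. (i, 1) \<in> skew_diagram lam mu \<and>
        arm_start (conj_partition lam) (conj_partition mu) \<le> i \<and> i \<le> conj_partition lam 1}"

definition body :: "(nat \<Rightarrow> nat) \<Rightarrow> (nat \<Rightarrow> nat) \<Rightarrow> (nat \<times> nat) set" where
  "body lam mu = skew_diagram lam mu - right_arm lam mu - left_arm lam mu"


section \<open>Rectification\<close>

definition row_word :: "(nat \<times> nat) set \<Rightarrow> (nat \<times> nat \<Rightarrow> 'a) \<Rightarrow> 'a list" where
  "row_word D L = concat (map
     (\<lambda>i. map (\<lambda>j. L (i, j)) (sorted_list_of_set {j. (i, j) \<in> D}))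
     (rev (sorted_list_of_set (fst ` D))))"

inductive knuth_step :: "'a::linorder list \<Rightarrow> 'a list \<Rightarrow> bool" where
  "a < b \<Longrightarrow> b \<le> c \<Longrightarrow> knuth_step (u @ [b, c, a] @ v) (u @ [b, a, c] @ v)"
| "a \<le> b \<Longrightarrow> b < c \<Longrightarrow> knuth_step (u @ [a, c, b] @ v) (u @ [c, a, b] @ v)"

definition knuth_equiv :: "'a::linorder list \<Rightarrow> 'a list \<Rightarrow> bool" where
  "knuth_equiv = equivclp knuth_step"

text \<open>A tableau does not determine the partition it is drawn on as a function on boxes, so the
  rectification is returned together with its shape.\<close>

definition rect ::
    "(nat \<times> nat) set \<Rightarrow> (nat \<times> nat \<Rightarrow> 'a::linorder) \<Rightarrow> (nat \<Rightarrow> nat) \<times> (nat \<times> nat \<Rightarrow> 'a)" where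
  "rect D L = (THE P. is_partition (fst P) \<and> snd P \<in> ssyt (diagram (fst P)) UNIV \<and>
     knuth_equiv (row_word (diagram (fst P)) (snd P)) (row_word D L))"

definition rect_shape :: "(nat \<times> nat) set \<Rightarrow> (nat \<times> nat \<Rightarrow> 'a::linorder) \<Rightarrow> nat \<Rightarrow> nat" where
  "rect_shape D L = fst (rect D L)"

definition rect_tableau ::
    "(nat \<times> nat) set \<Rightarrow> (nat \<times> nat \<Rightarrow> 'a::linorder) \<Rightarrow> nat \<times> nat \<Rightarrow> 'a" where
  "rect_tableau D L = snd (rect D L)"


section \<open>Labelled entries\<close>

text \<open>\<open>Lab k l\<close> is \<open>k\<^sub>l\<close>, ordered lexicographically.\<close>

datatype lab = Lab (lab_val: nat) (lab_idx: nat)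

instantiation lab :: linorder
begin

definition less_eq_lab :: "lab \<Rightarrow> lab \<Rightarrow> bool" where
  "x \<le> y \<longleftrightarrow> lab_val x < lab_val y \<or> (lab_val x = lab_val y \<and> lab_idx x \<le> lab_idx y)"

definition less_lab :: "lab \<Rightarrow> lab \<Rightarrow> bool" where
  "x < y \<longleftrightarrow> lab_val x < lab_val y \<or> (lab_val x = lab_val y \<and> lab_idx x < lab_idx y)"

instance
  by standard (auto simp: less_eq_lab_def less_lab_def lab.expand)

end

text \<open>\<open>read_le b' b\<close>: when rows are read from bottom to top, each from left to right,
  \<open>b'\<close> is \<open>b\<close> or comes before \<open>b\<close>.\<close>

definition read_le :: "nat \<times> nat \<Rightarrow> nat \<times> nat \<Rightarrow> bool" where
  "read_le b' b \<longleftrightarrow> fst b < fst b' \<or> (fst b = fst b' \<and> snd b' \<le> snd b)"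

definition phi_T :: "(nat \<times> nat) set \<Rightarrow> (nat \<times> nat \<Rightarrow> nat) \<Rightarrow> nat \<times> nat \<Rightarrow> lab" where
  "phi_T D L = (\<lambda>b\<in>D. Lab (L b) (card {b'\<in>D. L b' = L b \<and> read_le b' b}))"

definition rho :: "(nat \<times> nat) set \<Rightarrow> (nat \<times> nat \<Rightarrow> nat) \<Rightarrow> nat \<times> nat \<Rightarrow> nat \<times> nat" where
  "rho D L b = (THE b'. b' \<in> diagram (rect_shape D L) \<and>
     rect_tableau D (phi_T D L) b' = phi_T D L b)"

definition rearranged ::
    "(nat \<times> nat) set \<Rightarrow> (nat \<times> nat \<Rightarrow> 'x) \<Rightarrow> (nat \<times> nat \<Rightarrow> nat) \<Rightarrow> nat \<times> nat \<Rightarrow> 'x" where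
  "rearranged D v L = (\<lambda>b'\<in>diagram (rect_shape D L). v (inv_into D (rho D L) b'))"

definition U_set ::
    "(nat \<times> nat) set \<Rightarrow> (nat \<Rightarrow> nat) \<Rightarrow> (nat \<times> nat \<Rightarrow> 'x) \<Rightarrow> (nat \<times> nat \<Rightarrow> 'x) set" where
  "U_set D nu v = {rearranged D v L | L. L \<in> SSYT D \<and> rect_shape D L = nu}"

end

theory Submission
  imports Defs
begin

text \<open>Grouping the tableaux \<open>L\<close> of shape \<open>lam/mu\<close> by their rectification turns \<open>\<zeta>\<^bsub>lam/mu\<^esub>\<close> into a
  sum over tableaux \<open>T\<close> of normal shape \<open>nu\<close>, each occurring once for every \<open>L\<close> that rectifies to
  \<open>T\<close>. By the Robinson--Schensted--Knuth correspondence, the number of such \<open>L\<close> and the number of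
  factorisations \<open>V = U \<cdot> T\<close> of a tableau \<open>V\<close> of shape \<open>lam\<close> into tableaux of shapes \<open>mu\<close> and \<open>nu\<close>
  are both equal to a number of standard tableaux that depends on the shapes only, so each \<open>T\<close>
  occurs \<open>lr_coeff mu nu lam\<close> times.

  The variables sit in \<open>v\<^sub>L\<close>, which depends on \<open>L\<close> and not only on \<open>nu\<close>. The variables of the arms,
  however, do not: once the rows below the first one have been inserted, the first row is so
  short that the entries of the right arm are appended to it at the end, and the left arm is the
  right arm of the transposed tableau. Hence two arrangements \<open>v\<^sub>L\<close> of the same shape differ by a
  permutation of the body, which disappears under symmetrisation.

  Uniqueness of rectification and the symmetry of the RSK shapes both come from Greene's
  invariants: the maximal number of letters covered by \<open>k\<close> weakly increasing subwords is
  invariant under Knuth moves and under exchanging positions and values.\<close>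

section \<open>Knuth equivalence\<close>

text \<open>The standard tableaux behind the two counts form the set
  \<open>recording lam M N\<close>: shape \<open>lam\<close>, small entries forming a fixed tableau
  \<open>M\<close> of shape \<open>mu\<close>, large entries rectifying to a fixed \<open>N\<close>
  of shape \<open>nu\<close>. As recording tableaux of concatenated words they count the
  factorisations of \<open>V\<close>; as fillings they are \<open>M\<close> extended by a skew
  tableau that rectifies to \<open>N\<close>. The factorisations do not see the entries of
  \<open>M\<close> and \<open>N\<close>, and \<open>recording\<close> does not see the entries of
  \<open>V\<close>, so the equality of the counts shows that both depend on shapes only. All this
  concerns pairwise distinct entries, whereas the tableaux in the zeta series have repetitions.
  Labelling bridges the gap because Knuth moves pass through it in both directions. Hence the sum
  over permutations has to be formed inside the sum over \<open>L\<close>. Convergence survives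
  because variables of the body have real part greater than 1, while a variable of smaller real part
  lies in an arm, whose end is never moved and carries an entry at least as large.\<close>

lemma knuth_equiv_refl [simp]: "knuth_equiv w w"
  by (simp add: knuth_equiv_def equivclp_refl)

lemma knuth_equiv_sym: "knuth_equiv w w' \<Longrightarrow> knuth_equiv w' w"
  unfolding knuth_equiv_def by (rule equivclp_sym)

lemma knuth_equiv_trans [trans]:
  "knuth_equiv w w' \<Longrightarrow> knuth_equiv w' w'' \<Longrightarrow> knuth_equiv w w''"
  unfolding knuth_equiv_def by (rule equivclp_trans)

lemma knuth_equiv_step: "knuth_step w w' \<Longrightarrow> knuth_equiv w w'"
  unfolding knuth_equiv_def by (rule r_into_equivclp)

lemma knuth_equiv_induct [consumes 1, case_names refl step]:
  assumes "knuth_equiv w w'" "P w"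
    "\<And>x y. knuth_equiv w x \<Longrightarrow> knuth_step x y \<or> knuth_step y x \<Longrightarrow> P x \<Longrightarrow> P y"
  shows "P w'"
  using assms(1) unfolding knuth_equiv_def
proof (induction rule: equivclp_induct)
  case base show ?case by fact
next
  case (step y z) then show ?case using assms(3) unfolding knuth_equiv_def by blast
qed

lemma knuth_equiv_invariant:
  assumes "knuth_equiv w w'" "\<And>x y. knuth_step x y \<Longrightarrow> f x = f y"
  shows "f w = f w'"
  using assms(1) by (induction rule: knuth_equiv_induct) (auto dest: assms(2))

lemma knuth_equiv_hom:
  assumes "knuth_equiv w w'" "\<And>x y. knuth_step x y \<Longrightarrow> knuth_equiv (f x) (f y)"
  shows "knuth_equiv (f w) (f w')"
  using assms(1)
proof (induction rule: knuth_equiv_induct)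
  case (step x y)
  then show ?case
    by (metis assms(2) knuth_equiv_sym knuth_equiv_trans)
qed simp

lemma knuth_equiv_mset: "knuth_equiv w w' \<Longrightarrow> mset w = mset w'"
  by (erule knuth_equiv_invariant) (auto elim!: knuth_step.cases)

lemma knuth_equiv_set: "knuth_equiv w w' \<Longrightarrow> set w = set w'"
  by (metis knuth_equiv_mset mset_eq_setD)

lemma knuth_equiv_length: "knuth_equiv w w' \<Longrightarrow> length w = length w'"
  by (metis knuth_equiv_mset mset_eq_length)

lemma knuth_equiv_distinct: "knuth_equiv w w' \<Longrightarrow> distinct w = distinct w'"
  by (metis knuth_equiv_mset mset_eq_imp_distinct_iff)

lemma knuth_step_cong: "knuth_step w w' \<Longrightarrow> knuth_step (u @ w @ v) (u @ w' @ v)"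
proof (induction rule: knuth_step.induct)
  case (1 a b c u' v')
  then show ?case using knuth_step.intros(1)[of a b c "u @ u'" "v' @ v"] by simp
next
  case (2 a b c u' v')
  then show ?case using knuth_step.intros(2)[of a b c "u @ u'" "v' @ v"] by simp
qed

lemma knuth_equiv_cong:
  assumes "knuth_equiv w w'" shows "knuth_equiv (u @ w @ v) (u @ w' @ v)"
  by (rule knuth_equiv_hom[OF assms, of "\<lambda>w. u @ w @ v"])
     (blast intro: knuth_equiv_step knuth_step_cong)

lemma knuth_equiv_append:
  assumes "knuth_equiv w w'" "knuth_equiv v v'" shows "knuth_equiv (w @ v) (w' @ v')"
  using knuth_equiv_cong[OF assms(1), of "[]" v] knuth_equiv_cong[OF assms(2), of w' "[]"]
  by (simp add: knuth_equiv_trans)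

lemma knuth_equiv_Cons: "knuth_equiv w w' \<Longrightarrow> knuth_equiv (x # w) (x # w')"
  using knuth_equiv_cong[of w w' "[x]" "[]"] by simp

lemma knuth_equiv_bca: "a < b \<Longrightarrow> b \<le> c \<Longrightarrow> knuth_equiv [b, c, a] [b, a, c]"
  using knuth_step.intros(1)[of a b c "[]" "[]"] by (simp add: knuth_equiv_step)

lemma knuth_equiv_acb: "a \<le> b \<Longrightarrow> b < c \<Longrightarrow> knuth_equiv [a, c, b] [c, a, b]"
  using knuth_step.intros(2)[of a b c "[]" "[]"] by (simp add: knuth_equiv_step)

text \<open>A Knuth move only exchanges its extreme letters \<open>a\<close> and \<open>c\<close>.
  If one of them is deleted, the two words become equal; if both survive, convexity of
  \<open>P\<close> keeps the witness \<open>b\<close>, and the move survives too.\<close>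

lemma knuth_equiv_filter:
  assumes "knuth_equiv w w'" "\<And>a b c. P a \<Longrightarrow> P c \<Longrightarrow> a \<le> b \<Longrightarrow> b \<le> c \<Longrightarrow> P b"
  shows "knuth_equiv (filter P w) (filter P w')"
proof (rule knuth_equiv_hom[OF assms(1)])
  fix x y :: "'a list" assume "knuth_step x y"
  then show "knuth_equiv (filter P x) (filter P y)"
  proof cases
    case (1 a b c u v)
    show ?thesis
    proof (cases "P a \<and> P c")
      case True
      then have "P b" using assms(2)[of a c b] 1 by simp
      then show ?thesis using True 1 knuth_equiv_step knuth_step.intros(1)[of a b c "filter P u" "filter P v"] by simp
    next
      case False then show ?thesis using 1 by auto
    qed
  next
    case (2 a b c u v)
    show ?thesis
    proof (cases "P a \<and> P c")
      case True
      then have "P b" using assms(2)[of a c b] 2 by simp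
      then show ?thesis using True 2 knuth_equiv_step knuth_step.intros(2)[of a b c "filter P u" "filter P v"] by simp
    next
      case False then show ?thesis using 2 by auto
    qed
  qed
qed

text \<open>Reversal exchanges the two Knuth relations except for the place of the strict
  inequality; for distinct letters both inequalities are strict.\<close>

lemma knuth_equiv_rev_distinct:
  assumes "knuth_equiv w w'" "distinct w"
  shows "knuth_equiv (rev w) (rev w')"
  using assms
proof (induction rule: knuth_equiv_induct)
  case (step x y)
  have d: "distinct x" "distinct y" using step by (blast dest: knuth_equiv_distinct knuth_equiv_step)+
  have *: "knuth_equiv (rev x) (rev y)" if "knuth_step x y" "distinct x" for x y :: "'a list"
    using that(1)
  proof cases
    case (1 a b c u v)
    then have "b < c" using that(2) by auto
    then show ?thesis using 1 knuth_step.intros(2)[of a b c "rev v" "rev u"] by (simp add: knuth_equiv_step)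
  next
    case (2 a b c u v)
    then have "a < b" using that(2) by auto
    then show ?thesis using 2 knuth_step.intros(1)[of a b c "rev v" "rev u"] by (simp add: knuth_equiv_step)
  qed
  show ?case using step * d by (meson knuth_equiv_sym knuth_equiv_trans)
qed simp

text \<open>\<open>x\<close> passes the letters of \<open>r\<close> from right to left; the left
  neighbour of the letter being passed is the witness of each move.\<close>

lemma knuth_equiv_row_small:
  assumes "sorted (y # r)" "x < y"
  shows "knuth_equiv (y # r @ [x]) (y # x # r)"
  using assms
proof (induction r rule: rev_induct)
  case (snoc z r)
  let ?s = "last (y # r)"
  have "x < ?s \<and> ?s \<le> z" using snoc.prems
    by (cases r rule: rev_cases) (auto simp: sorted_append)
  then have "knuth_equiv [?s, z, x] [?s, x, z]" by (intro knuth_equiv_bca) auto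
  from knuth_equiv_cong[OF this, of "butlast (y # r)" "[]"]
  have "knuth_equiv (y # r @ [z, x]) ((y # r @ [x]) @ [z])"
    by (metis (no_types, lifting) append.right_neutral append_Cons append_Nil append_assoc append_butlast_last_id list.distinct(1))
  moreover have "knuth_equiv ((y # r @ [x]) @ [z]) ((y # x # r) @ [z])"
    using snoc by (intro knuth_equiv_append) (auto simp: sorted_append)
  ultimately show ?case by (simp add: knuth_equiv_trans)
qed simp

lemma knuth_equiv_row_large:
  assumes "sorted r" "\<forall>z\<in>set r. z \<le> x" "x < y"
  shows "knuth_equiv (r @ [y, x]) (y # r @ [x])"
  using assms
proof (induction r arbitrary: x rule: rev_induct)
  case (snoc z r)
  have "knuth_equiv [z, y, x] [y, z, x]" using snoc.prems by (intro knuth_equiv_acb) auto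
  from knuth_equiv_cong[OF this, of r "[]"]
  have "knuth_equiv (r @ [z, y, x]) ((r @ [y, z]) @ [x])" by simp
  moreover have "knuth_equiv ((r @ [y, z]) @ [x]) ((y # r @ [z]) @ [x])"
    using snoc by (intro knuth_equiv_append) (auto simp: sorted_append intro: le_less_trans)
  ultimately show ?case by (simp add: knuth_equiv_trans)
qed simp

text \<open>Row insertion by Knuth moves: \<open>x\<close> travels left until it stands just behind
  the letter \<open>y\<close> that it bumps, then \<open>y\<close> travels left out of the
  row.\<close>

lemma knuth_equiv_bump:
  assumes "sorted (a @ y # b)" "\<forall>z\<in>set a. z \<le> x" "x < y"
  shows "knuth_equiv ((a @ y # b) @ [x]) (y # a @ x # b)"
proof -
  have "knuth_equiv (a @ (y # b @ [x]) @ []) (a @ (y # x # b) @ [])"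
    using assms by (intro knuth_equiv_cong knuth_equiv_row_small) (auto simp: sorted_append)
  moreover have "knuth_equiv ((a @ [y, x]) @ b) ((y # a @ [x]) @ b)"
    using assms by (intro knuth_equiv_append knuth_equiv_row_large) (auto simp: sorted_append)
  ultimately show ?thesis by (simp add: knuth_equiv_trans)
qed

section \<open>Greene's theorem\<close>

text \<open>\<open>k\<close> disjoint weakly increasing subwords are encoded as a colouring of the letters; the colours
  \<open>\<ge> k\<close> mark the letters that are not covered.\<close>

definition kcol :: "nat \<Rightarrow> ('a::linorder \<times> nat) list \<Rightarrow> bool" where
  "kcol k zs \<longleftrightarrow> sorted_wrt (\<lambda>x y. snd x = snd y \<and> snd x < k \<longrightarrow> fst x \<le> fst y) zs"

abbreviation covered :: "nat \<Rightarrow> ('a \<times> nat) list \<Rightarrow> nat" where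
  "covered k zs \<equiv> length (filter (\<lambda>x. snd x < k) zs)"

definition greene :: "nat \<Rightarrow> 'a::linorder list \<Rightarrow> nat" where
  "greene k w = Max {covered k zs | zs. kcol k zs \<and> map fst zs = w}"

lemma greene_witness_finite:
  "finite {covered k zs | zs. kcol k zs \<and> map fst zs = w}"
proof (rule finite_subset)
  show "{covered k zs | zs. kcol k zs \<and> map fst zs = w} \<subseteq> {..length w}"
    by (auto intro: order.trans[OF length_filter_le])
qed simp

lemma greene_ge:
  assumes "kcol k zs" "map fst zs = w"
  shows "covered k zs \<le> greene k w"
  unfolding greene_def using assms by (intro Max_ge greene_witness_finite) auto

lemma greene_attained:
  obtains zs where "kcol k zs" "map fst zs = w" "greene k w = covered k zs"
proof -
  let ?S = "{covered k zs | zs. kcol k zs \<and> map fst zs = w}"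
  \<comment> \<open>Colour \<open>k\<close> leaves every letter uncovered, so the colouring
    condition is vacuous.\<close>
  let ?zs = "map (\<lambda>x. (x, k)) w"
  have "kcol k ?zs" "map fst ?zs = w" by (auto simp: kcol_def sorted_wrt_map o_def intro: sorted_wrt_mono_rel[OF _ sorted_wrt_true])
  then have "?S \<noteq> {}" by blast
  then have "greene k w \<in> ?S" unfolding greene_def by (intro Max_in greene_witness_finite)
  then show ?thesis using that by auto
qed

lemma greene_leI:
  assumes "\<And>zs. kcol k zs \<Longrightarrow> map fst zs = w \<Longrightarrow> \<exists>zs'. kcol k zs' \<and> map fst zs' = w' \<and>
     covered k zs \<le> covered k zs'"
  shows "greene k w \<le> greene k w'"
proof -
  obtain zs where "kcol k zs" "map fst zs = w" "greene k w = covered k zs"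
    by (rule greene_attained)
  then show ?thesis using assms[of zs] greene_ge by fastforce
qed

lemma kcol_append: "kcol k (xs @ ys) \<longleftrightarrow> kcol k xs \<and> kcol k ys \<and>
    (\<forall>x\<in>set xs. \<forall>y\<in>set ys. snd x = snd y \<and> snd x < k \<longrightarrow> fst x \<le> fst y)"
  by (simp add: kcol_def sorted_wrt_append)

lemma kcol_Cons: "kcol k (x # ys) \<longleftrightarrow> kcol k ys \<and>
    (\<forall>y\<in>set ys. snd x = snd y \<and> snd x < k \<longrightarrow> fst x \<le> fst y)"
  by (auto simp: kcol_def)

lemma kcol_Nil: "kcol k []"
  by (simp add: kcol_def)

lemma map_fst_append_conv:
  assumes "map fst zs = u @ [x, y, z] @ v"
  obtains U V i j l where "zs = U @ [(x, i), (y, j), (z, l)] @ V" "map fst U = u" "map fst V = v"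
  using assms by (auto simp: map_eq_append_conv map_eq_Cons_conv)

definition swap_col :: "nat \<Rightarrow> nat \<Rightarrow> 'a \<times> nat \<Rightarrow> 'a \<times> nat" where
  "swap_col s t x = (fst x, if snd x = s then t else if snd x = t then s else snd x)"

lemma swap_col_simps [simp]: "fst (swap_col s t x) = fst x"
  "snd (swap_col s t x) = (if snd x = s then t else if snd x = t then s else snd x)"
  by (auto simp: swap_col_def)

lemma kcol_swap_col: "s < k \<Longrightarrow> t < k \<Longrightarrow> kcol k V \<Longrightarrow> kcol k (map (swap_col s t) V)"
  unfolding kcol_def sorted_wrt_map by (erule sorted_wrt_mono_rel[rotated]) auto

lemma length_filter_swap_col:
  "s < k \<Longrightarrow> t < k \<Longrightarrow> length (filter (\<lambda>x. snd x < k) (map (swap_col s t) V)) = covered k V"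
  by (induction V) auto

text \<open>Adjacent letters \<open>c\<close>, \<open>a\<close> in descending order never share a
  covered colour, so exchanging them together with their colours breaks no subword.\<close>

lemma greene_swap_le:
  assumes "a < c" shows "greene k (u @ c # a # v) \<le> greene k (u @ a # c # v)"
proof (rule greene_leI)
  fix zs assume zs: "kcol k zs" "map fst zs = u @ c # a # v"
  then obtain U V i j where d: "zs = U @ (c, i) # (a, j) # V" "map fst U = u" "map fst V = v"
    by (auto simp: map_eq_append_conv map_eq_Cons_conv)
  have "kcol k (U @ (a, j) # (c, i) # V)"
    using zs(1) assms unfolding d(1) by (fastforce simp: kcol_append kcol_Cons)
  then show "\<exists>zs'. kcol k zs' \<and> map fst zs' = u @ a # c # v \<and>
     covered k zs \<le> covered k zs'"
    using d by (intro exI[of _ "U @ (a, j) # (c, i) # V"]) auto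
qed

text \<open>Only the adjacent letters \<open>a\<close> and \<open>c\<close> can obstruct the transfer of a colouring: if they have the
  same colour, the tail of their subword is exchanged with the tail of the subword through \<open>b\<close>, or
  \<open>b\<close> replaces one of them when it is not covered.\<close>

lemma greene_step:
  assumes "knuth_step w w'" shows "greene k w = greene k w'"
  using assms
proof cases
  case (1 a b c u v)
  show ?thesis
  proof (rule antisym)
    show "greene k w \<le> greene k w'" using 1 greene_swap_le[of a c k "u @ [b]" v] by auto
  next
    show "greene k w' \<le> greene k w"
    proof (rule greene_leI)
      fix zs assume zs: "kcol k zs" "map fst zs = w'"
      then obtain U V t j l where d: "zs = U @ [(b, t), (a, j), (c, l)] @ V" "map fst U = u" "map fst V = v"
        using map_fst_append_conv 1 by metis
      define zs' where "zs' =
        (if j = l \<and> j < k then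
          (if t < k then U @ [(b, t), (c, t), (a, j)] @ map (swap_col j t) V
           else U @ [(b, j), (c, j), (a, k)] @ V)
         else U @ [(b, t), (c, l), (a, j)] @ V)"
      have "kcol k zs'"
      proof (cases "j = l \<and> j < k")
        case True
        then have "t \<noteq> j" using zs(1) 1 unfolding d(1) by (auto simp: kcol_append kcol_Cons)
        show ?thesis
        proof (cases "t < k")
          case t: True
          then have "kcol k (map (swap_col j t) V)" using True zs(1) d(1) by (intro kcol_swap_col) (auto simp: kcol_append kcol_Cons)
          then show ?thesis using zs(1) 1 True t \<open>t \<noteq> j\<close> unfolding d(1) zs'_def
            by (fastforce simp: kcol_append kcol_Cons kcol_Nil split: if_splits)
        next
          case False
          then show ?thesis using zs(1) 1 True \<open>t \<noteq> j\<close> unfolding d(1) zs'_def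
            by (fastforce simp: kcol_append kcol_Cons kcol_Nil)
        qed
      next
        case False
        then show ?thesis using zs(1) 1 unfolding d(1) zs'_def
          by (fastforce simp: kcol_append kcol_Cons kcol_Nil)
      qed
      moreover have "map fst zs' = w" using d 1 by (auto simp: zs'_def o_def)
      moreover have "covered k zs \<le> covered k zs'"
        using d(1) length_filter_swap_col[of j k t V] by (auto simp: zs'_def)
      ultimately show "\<exists>zs'. kcol k zs' \<and> map fst zs' = w \<and>
         covered k zs \<le> covered k zs'" by blast
    qed
  qed
next
  case (2 a b c u v)
  show ?thesis
  proof (rule antisym)
    show "greene k w' \<le> greene k w" using 2 greene_swap_le[of a c k u "b # v"] by auto
  next
    show "greene k w \<le> greene k w'"
    proof (rule greene_leI)
      fix zs assume zs: "kcol k zs" "map fst zs = w"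
      then obtain U V t j l where d: "zs = U @ [(a, j), (c, l), (b, t)] @ V" "map fst U = u" "map fst V = v"
        using map_fst_append_conv 2 by metis
      define zs' where "zs' =
        (if j = l \<and> j < k then
          (if t < k then U @ [(c, t), (a, j), (b, j)] @ map (swap_col j t) V
           else U @ [(c, k), (a, j), (b, j)] @ V)
         else U @ [(c, l), (a, j), (b, t)] @ V)"
      have "kcol k zs'"
      proof (cases "j = l \<and> j < k")
        case True
        then have "t \<noteq> j" using zs(1) 2 unfolding d(1) by (auto simp: kcol_append kcol_Cons)
        show ?thesis
        proof (cases "t < k")
          case t: True
          then have "kcol k (map (swap_col j t) V)" using True zs(1) d(1) by (intro kcol_swap_col) (auto simp: kcol_append kcol_Cons)
          then show ?thesis using zs(1) 2 True t \<open>t \<noteq> j\<close> unfolding d(1) zs'_def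
            by (fastforce simp: kcol_append kcol_Cons kcol_Nil split: if_splits)
        next
          case False
          then show ?thesis using zs(1) 2 True \<open>t \<noteq> j\<close> unfolding d(1) zs'_def
            by (fastforce simp: kcol_append kcol_Cons kcol_Nil)
        qed
      next
        case False
        then show ?thesis using zs(1) 2 unfolding d(1) zs'_def
          by (fastforce simp: kcol_append kcol_Cons kcol_Nil)
      qed
      moreover have "map fst zs' = w'" using d 2 by (auto simp: zs'_def o_def)
      moreover have "covered k zs \<le> covered k zs'"
        using d(1) length_filter_swap_col[of j k t V] by (auto simp: zs'_def)
      ultimately show "\<exists>zs'. kcol k zs' \<and> map fst zs' = w' \<and>
         covered k zs \<le> covered k zs'" by blast
    qed
  qed
qed

lemma knuth_equiv_greene: "knuth_equiv w w' \<Longrightarrow> greene k w = greene k w'"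
  by (erule knuth_equiv_invariant) (rule greene_step)

section \<open>Row words\<close>

definition read_lt :: "nat \<times> nat \<Rightarrow> nat \<times> nat \<Rightarrow> bool" where
  "read_lt x y \<longleftrightarrow> fst y < fst x \<or> (fst x = fst y \<and> snd x < snd y)"

lemma read_lt_asym: "read_lt x y \<Longrightarrow> \<not> read_lt y x"
  by (auto simp: read_lt_def)

lemma read_lt_total: "x \<noteq> y \<Longrightarrow> read_lt x y \<or> read_lt y x"
  by (cases x; cases y) (auto simp: read_lt_def)

lemma sorted_wrt_unique:
  assumes "sorted_wrt R xs" "sorted_wrt R ys" "set xs = set ys" "\<And>x y. R x y \<Longrightarrow> \<not> R y x"
  shows "xs = ys"
  using assms(1-3)
proof (induction xs arbitrary: ys)
  case (Cons x xs)
  then obtain y ys' where ys: "ys = y # ys'" by (cases ys) auto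
  have "x = y"
  proof (rule ccontr)
    assume "x \<noteq> y"
    moreover have "x \<in> set (y # ys')" "y \<in> set (x # xs)" using Cons.prems(3) unfolding ys by (metis list.set_intros(1))+
    ultimately have "R x y" "R y x" using Cons.prems unfolding ys by auto
    then show False using assms(4) by blast
  qed
  moreover have "x \<notin> set xs" "y \<notin> set ys'" using Cons.prems assms(4) unfolding ys by fastforce+
  ultimately have "set xs = set ys'" using Cons.prems(3) unfolding ys by auto
  then show ?case using Cons \<open>x = y\<close> unfolding ys by auto
qed simp

text \<open>In a list sorted by an asymmetric relation, the order of positions is \<open>R\<close>
  itself. This turns conditions on row words into conditions on boxes.\<close>

lemma sorted_wrt_iff_ball:
  assumes "sorted_wrt R xs" "\<And>x y. R x y \<Longrightarrow> \<not> R y x"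
  shows "sorted_wrt Q xs \<longleftrightarrow> (\<forall>x\<in>set xs. \<forall>y\<in>set xs. R x y \<longrightarrow> Q x y)"
  using assms(1)
proof (induction xs)
  case (Cons x xs)
  then have "\<not> R x x" "\<And>y. y \<in> set xs \<Longrightarrow> R x y \<and> \<not> R y x" using assms(2) by auto
  then show ?case using Cons by auto
qed simp

definition boxes :: "(nat \<times> nat) set \<Rightarrow> (nat \<times> nat) list" where
  "boxes D = concat (map (\<lambda>i. map (\<lambda>j. (i, j)) (sorted_list_of_set {j. (i, j) \<in> D}))
     (rev (sorted_list_of_set (fst ` D))))"

lemma row_word_boxes: "row_word D L = map L (boxes D)"
  by (simp add: row_word_def boxes_def map_concat o_def)

lemma finite_row: "finite D \<Longrightarrow> finite {j. (i, j) \<in> D}"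
  by (rule finite_subset[of _ "snd ` D"]) force+

lemma set_boxes [simp]: "finite D \<Longrightarrow> set (boxes D) = D"
  by (force simp: boxes_def finite_row)

lemma sorted_wrt_rows:
  "sorted_wrt (>) is \<Longrightarrow>
    sorted_wrt read_lt (concat (map (\<lambda>i. map (Pair i) (sorted_list_of_set {j. (i, j) \<in> D})) is))"
proof (induction "is")
  case (Cons i "is")
  have "sorted_wrt read_lt (map (Pair i) (sorted_list_of_set {j. (i, j) \<in> D}))"
    by (auto simp: sorted_wrt_map read_lt_def)
  then show ?case using Cons by (fastforce simp: sorted_wrt_append read_lt_def[of "(_, _)"])
qed simp

lemma sorted_boxes: "sorted_wrt read_lt (boxes D)"
  unfolding boxes_def by (rule sorted_wrt_rows) (simp add: sorted_wrt_rev)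

lemma distinct_boxes:
  assumes "finite D" shows "distinct (boxes D)"
proof -
  have "distinct xs" if "sorted_wrt read_lt xs" for xs
    using that by (induction xs) (auto simp: read_lt_def)
  then show ?thesis using sorted_boxes by blast
qed

lemma boxes_eqI: "finite D \<Longrightarrow> sorted_wrt read_lt xs \<Longrightarrow> set xs = D \<Longrightarrow> boxes D = xs"
  by (rule sorted_wrt_unique[OF sorted_boxes]) (auto dest: read_lt_asym)

lemma length_boxes: "finite D \<Longrightarrow> length (boxes D) = card D"
  by (metis distinct_boxes distinct_card set_boxes)

lemma filter_boxes: "finite D \<Longrightarrow> filter P (boxes D) = boxes {b\<in>D. P b}"
  by (rule boxes_eqI[symmetric]) (auto intro: sorted_wrt_filter sorted_boxes)

lemma filter_row_word: "finite D \<Longrightarrow> filter P (row_word D L) = row_word {b\<in>D. P (L b)} L"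
  by (simp add: row_word_boxes filter_map o_def filter_boxes)

lemma set_row_word: "finite D \<Longrightarrow> set (row_word D L) = L ` D"
  by (simp add: row_word_boxes)

lemma mset_row_word: "finite D \<Longrightarrow> mset (row_word D L) = image_mset L (mset_set D)"
  by (metis distinct_boxes mset_map mset_set_set row_word_boxes set_boxes)

lemma length_row_word: "finite D \<Longrightarrow> length (row_word D L) = card D"
  by (simp add: row_word_boxes length_boxes)

lemma distinct_row_word: "finite D \<Longrightarrow> distinct (row_word D L) \<longleftrightarrow> inj_on L D"
  by (simp add: row_word_boxes distinct_map distinct_boxes)

lemma row_word_cong: "finite D \<Longrightarrow> (\<And>b. b \<in> D \<Longrightarrow> L b = L' b) \<Longrightarrow> row_word D L = row_word D L'"
  by (simp add: row_word_boxes)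

lemma row_word_empty [simp]: "row_word {} L = []"
  by (simp add: row_word_def)

section \<open>Partitions and their diagrams\<close>

lemma mem_diagram: "(i, j) \<in> diagram l \<longleftrightarrow> 1 \<le> i \<and> 1 \<le> j \<and> j \<le> l i"
  by (simp add: diagram_def)

lemma partition_antimono: "is_partition l \<Longrightarrow> 1 \<le> i \<Longrightarrow> i \<le> j \<Longrightarrow> l j \<le> l i"
  by (simp add: is_partition_def)

lemma partition_0: "is_partition l \<Longrightarrow> l 0 = 0"
  by (simp add: is_partition_def)

lemma diagram_Sigma: "diagram l = Sigma {i. 1 \<le> i \<and> l i \<noteq> 0} (\<lambda>i. {1..l i})"
  by (auto simp: diagram_def)

lemma finite_diagram [simp]: "is_partition l \<Longrightarrow> finite (diagram l)"
  unfolding diagram_Sigma is_partition_def by (rule finite_SigmaI) auto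

lemma finite_skew_diagram [simp]: "is_skew lam mu \<Longrightarrow> finite (skew_diagram lam mu)"
  by (simp add: is_skew_def skew_diagram_def)

lemma diagram_downclosed:
  assumes "is_partition l" "(i, j) \<in> diagram l" "1 \<le> i'" "i' \<le> i" "1 \<le> j'" "j' \<le> j"
  shows "(i', j') \<in> diagram l"
  using assms partition_antimono[of l i' i] by (auto simp: mem_diagram)

lemma diagram_row_card: "1 \<le> i \<Longrightarrow> card {j. (i, j) \<in> diagram l} = l i"
proof -
  assume "1 \<le> i"
  then have "{j. (i, j) \<in> diagram l} = {1..l i}" by (auto simp: mem_diagram)
  then show ?thesis by simp
qed

lemma diagram_inj:
  assumes "is_partition l" "is_partition l'" "diagram l = diagram l'"
  shows "l = l'"
proof
  fix i show "l i = l' i"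
    using diagram_row_card[of i l] diagram_row_card[of i l'] assms by (cases "i = 0") (auto simp: partition_0)
qed

lemma nat_downclosed_eq_atLeastAtMost:
  assumes "finite S" "\<And>i. i \<in> S \<Longrightarrow> 1 \<le> i" "\<And>i i'. i \<in> S \<Longrightarrow> 1 \<le> i' \<Longrightarrow> i' \<le> i \<Longrightarrow> i' \<in> S"
  shows "S = {1..card S}"
proof (cases "S = {}")
  case False
  then have "Max S \<in> S" using assms(1) by simp
  have "S = {1..Max S}"
  proof (intro equalityI subsetI)
    show "x \<in> {1..Max S}" if "x \<in> S" for x using that assms(1,2) by auto
    show "x \<in> S" if "x \<in> {1..Max S}" for x using that assms(3)[OF \<open>Max S \<in> S\<close>] by auto
  qed
  then show ?thesis by (metis card_atLeastAtMost diff_Suc_1)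
qed simp

definition shape_of :: "(nat \<times> nat) set \<Rightarrow> nat \<Rightarrow> nat" where
  "shape_of D i = card {j. (i, j) \<in> D}"

lemma
  assumes fin: "finite D" and pos: "\<And>i j. (i, j) \<in> D \<Longrightarrow> 1 \<le> i \<and> 1 \<le> j"
    and down: "\<And>i j i' j'. (i, j) \<in> D \<Longrightarrow> 1 \<le> i' \<Longrightarrow> i' \<le> i \<Longrightarrow> 1 \<le> j' \<Longrightarrow> j' \<le> j \<Longrightarrow> (i', j') \<in> D"
  shows partition_shape_of: "is_partition (shape_of D)"
    and diagram_shape_of: "diagram (shape_of D) = D"
proof -
  have row: "{j. (i, j) \<in> D} = {1..shape_of D i}" for i
    unfolding shape_of_def
  proof (rule nat_downclosed_eq_atLeastAtMost)
    show "finite {j. (i, j) \<in> D}" using fin by (rule finite_row)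
    show "1 \<le> j" if "j \<in> {j. (i, j) \<in> D}" for j using that pos by simp
    show "j' \<in> {j. (i, j) \<in> D}" if "j \<in> {j. (i, j) \<in> D}" "1 \<le> j'" "j' \<le> j" for j j'
      using that pos[of i j] down[of i j i j'] by simp
  qed
  then show d: "diagram (shape_of D) = D"
  proof -
    have "j \<in> {j. (i, j) \<in> D} \<longleftrightarrow> j \<in> {1..shape_of D i}" for i j by (simp only: row)
    then show ?thesis using pos by (auto simp: diagram_def)
  qed
  show "is_partition (shape_of D)"
    unfolding is_partition_def
  proof (intro conjI allI impI)
    have "{j. (0, j) \<in> D} = {}" using pos[of 0] by auto
    then show "shape_of D 0 = 0" unfolding shape_of_def by simp
    fix i j :: nat assume "1 \<le> i" "i \<le> j"
    then have "{j'. (j, j') \<in> D} \<subseteq> {j'. (i, j') \<in> D}" using down pos by blast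
    then show "shape_of D j \<le> shape_of D i" unfolding shape_of_def by (intro card_mono finite_row fin)
  next
    have "{i. shape_of D i \<noteq> 0} \<subseteq> fst ` D"
    proof
      fix i assume "i \<in> {i. shape_of D i \<noteq> 0}"
      then have "card {j. (i, j) \<in> D} \<noteq> 0" by (simp add: shape_of_def)
      then obtain j where "(i, j) \<in> D" by (metis card.empty empty_Collect_eq)
      then show "i \<in> fst ` D" by (rule image_eqI[rotated]) simp
    qed
    then show "finite {i. shape_of D i \<noteq> 0}" using fin by (auto intro: finite_subset)
  qed
qed

lemma mem_diagram_conj:
  assumes "is_partition l"
  shows "(i, j) \<in> diagram (conj_partition l) \<longleftrightarrow> (j, i) \<in> diagram l"
proof (cases "1 \<le> i \<and> 1 \<le> j")
  case True
  have fin: "finite {k. i \<le> l k}"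
    by (rule finite_subset[of _ "{i. l i \<noteq> 0}"]) (use assms True in \<open>auto simp: is_partition_def\<close>)
  have "{k. i \<le> l k} = {1..card {k. i \<le> l k}}"
  proof (rule nat_downclosed_eq_atLeastAtMost[OF fin])
    show "1 \<le> k" if "k \<in> {k. i \<le> l k}" for k
      using that True partition_0[OF assms] by (cases k) auto
  qed (use partition_antimono[OF assms] in \<open>auto intro: order.trans\<close>)
  then have "i \<le> l j \<longleftrightarrow> j \<le> card {k. i \<le> l k}" using True by auto
  then show ?thesis using True by (simp add: mem_diagram conj_partition_def)
qed (auto simp: mem_diagram)

lemma partition_conj:
  assumes "is_partition l" shows "is_partition (conj_partition l)"
proof -
  let ?D = "prod.swap ` diagram l"
  have mem: "(i, j) \<in> ?D \<longleftrightarrow> (j, i) \<in> diagram l" for i j by force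
  have d: "diagram (conj_partition l) = ?D"
    using mem_diagram_conj[OF assms] mem by auto
  have "finite ?D" using assms by simp
  moreover have "\<And>i j. (i, j) \<in> ?D \<Longrightarrow> 1 \<le> i \<and> 1 \<le> j" by (simp add: mem mem_diagram)
  moreover have "\<And>i j i' j'. (i, j) \<in> ?D \<Longrightarrow> 1 \<le> i' \<Longrightarrow> i' \<le> i \<Longrightarrow> 1 \<le> j' \<Longrightarrow> j' \<le> j \<Longrightarrow> (i', j') \<in> ?D"
    unfolding mem using diagram_downclosed[OF assms] by blast
  ultimately have D: "is_partition (shape_of ?D) \<and> diagram (shape_of ?D) = ?D"
    using partition_shape_of[of ?D] diagram_shape_of[of ?D] by blast
  have "conj_partition l = shape_of ?D"
  proof
    fix i show "conj_partition l i = shape_of ?D i"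
      using diagram_row_card[of i "conj_partition l"] diagram_row_card[of i "shape_of ?D"] d D
        partition_0[of "shape_of ?D"]
      by (cases "i = 0") (auto simp: conj_partition_def)
  qed
  then show ?thesis using D by simp
qed

section \<open>Uniqueness of rectification\<close>

type_synonym 'a tab = "(nat \<Rightarrow> nat) \<times> (nat \<times> nat \<Rightarrow> 'a)"

definition tableau :: "('a::linorder) tab \<Rightarrow> bool" where
  "tableau P \<longleftrightarrow> is_partition (fst P) \<and> snd P \<in> ssyt (diagram (fst P)) UNIV"

abbreviation tword :: "('a::linorder) tab \<Rightarrow> 'a list" where
  "tword P \<equiv> row_word (diagram (fst P)) (snd P)"

lemma map_fst_eq_map_conv:
  "distinct xs \<Longrightarrow> map fst zs = map f xs \<Longrightarrow> \<exists>c. zs = map (\<lambda>x. (f x, c x)) xs"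
proof (induction xs arbitrary: zs)
  case (Cons x xs)
  then obtain z zs' where z: "zs = z # zs'" "fst z = f x" "map fst zs' = map f xs" by (auto simp: map_eq_Cons_conv)
  then obtain c where "zs' = map (\<lambda>x. (f x, c x)) xs" using Cons by auto
  then have "zs = map (\<lambda>y. (f y, (c(x := snd z)) y)) (x # xs)" using z Cons.prems(1) by (cases z) auto
  then show ?case by blast
qed simp

lemma kcol_boxes:
  assumes "finite D"
  shows "kcol k (map (\<lambda>b. (M b, c b)) (boxes D)) \<longleftrightarrow>
     (\<forall>b\<in>D. \<forall>b'\<in>D. read_lt b b' \<and> c b = c b' \<and> c b < k \<longrightarrow> M b \<le> M b')"
  unfolding kcol_def sorted_wrt_map
  by (subst sorted_wrt_iff_ball[OF sorted_boxes read_lt_asym]) (use assms in auto)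

lemma length_filter_boxes:
  assumes "finite D"
  shows "length (filter (\<lambda>x. snd x < k) (map (\<lambda>b. (M b, c b)) (boxes D))) = card {b\<in>D. c b < k}"
  using assms by (simp add: filter_map o_def filter_boxes length_boxes)

text \<open>Column by column: injectivity of \<open>c\<close> allows at most \<open>k\<close>
  covered boxes, and \<open>E\<close> contains the whole column or at least \<open>k\<close> of its
  boxes.\<close>

lemma card_columns_le:
  assumes fin: "finite D" and c: "\<And>j. inj_on c {b\<in>D. snd b = j \<and> c b < k}"
    and E: "E \<subseteq> D" "\<And>j. card {b\<in>D. snd b = j} \<le> k \<Longrightarrow> {b\<in>D. snd b = j} \<subseteq> E"
      "\<And>j. card {b\<in>D. snd b = j} > k \<Longrightarrow> card {b\<in>E. snd b = j} \<ge> k"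
  shows "card {b\<in>D. c b < k} \<le> card E"
proof -
  have split: "card S = (\<Sum>j\<in>snd ` D. card {b\<in>S. snd b = j})" if "S \<subseteq> D" for S
  proof -
    have f: "finite S" using that fin finite_subset by blast
    have "S = (\<Union>j\<in>snd ` D. {b\<in>S. snd b = j})" using that by auto
    then have "card S = card (\<Union>j\<in>snd ` D. {b\<in>S. snd b = j})" by simp
    also have "\<dots> = (\<Sum>j\<in>snd ` D. card {b\<in>S. snd b = j})"
      by (rule card_UN_disjoint) (use fin f in auto)
    finally show ?thesis .
  qed
  have "card {b\<in>{b\<in>D. c b < k}. snd b = j} \<le> card {b\<in>E. snd b = j}" for j
  proof (cases "card {b\<in>D. snd b = j} \<le> k")
    case True
    then show ?thesis using E(1) E(2)[of j] fin finite_subset[OF E(1) fin] by (intro card_mono) auto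
  next
    case False
    have "card {b\<in>D. snd b = j \<and> c b < k} \<le> card {..<k}"
      by (rule card_inj_on_le[OF c[of j]]) auto
    then have "card {b\<in>{b\<in>D. c b < k}. snd b = j} \<le> k" by (simp add: conj_ac)
    then show ?thesis using E(3)[of j] False by linarith
  qed
  then show ?thesis using split[of "{b\<in>D. c b < k}"] split[OF E(1)] by (simp add: sum_mono)
qed

text \<open>The row word meets each column from bottom to top, hence in strictly decreasing order,
  so a weakly increasing subword uses at most one box per column. \<open>E\<close> is left open: it
  will be the first \<open>k\<close> rows of a normal shape, or one box from each column of a skew
  shape.\<close>

lemma greene_row_word_le:
  assumes "finite D" "M \<in> ssyt D UNIV" "E \<subseteq> D"
    "\<And>j. card {b\<in>D. snd b = j} \<le> k \<Longrightarrow> {b\<in>D. snd b = j} \<subseteq> E"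
    "\<And>j. card {b\<in>D. snd b = j} > k \<Longrightarrow> card {b\<in>E. snd b = j} \<ge> k"
  shows "greene k (row_word D M) \<le> card E"
proof -
  obtain zs where zs: "kcol k zs" "map fst zs = row_word D M"
    "greene k (row_word D M) = covered k zs"
    by (rule greene_attained)
  obtain c where c: "zs = map (\<lambda>b. (M b, c b)) (boxes D)"
    using map_fst_eq_map_conv[OF distinct_boxes[OF assms(1)], of zs M] zs(2) by (auto simp: row_word_boxes)
  have "inj_on c {b\<in>D. snd b = j \<and> c b < k}" for j
  proof (rule inj_onI, rule ccontr)
    fix x y assume xy: "x \<in> {b\<in>D. snd b = j \<and> c b < k}" "y \<in> {b\<in>D. snd b = j \<and> c b < k}" "c x = c y" "x \<noteq> y"
    have "read_lt x y \<Longrightarrow> M y < M x" "read_lt y x \<Longrightarrow> M x < M y"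
      using xy assms(2) by (cases x; cases y; force simp: ssyt_def read_lt_def)+
    then show False using zs(1) xy read_lt_total[of x y] unfolding c kcol_boxes[OF assms(1)]
      by (metis (no_types, lifting) leD mem_Collect_eq)
  qed
  then have "card {b\<in>D. c b < k} \<le> card E" by (rule card_columns_le[OF assms(1) _ assms(3-5)])
  then show ?thesis using zs(3) unfolding c length_filter_boxes[OF assms(1)] by simp
qed

text \<open>The first \<open>k\<close> rows are \<open>k\<close> weakly increasing subwords, and
  they contain the \<open>k\<close> topmost boxes of every longer column, so the column bound is
  attained.\<close>

lemma greene_tword:
  assumes "tableau P"
  shows "greene k (tword P) = card {b\<in>diagram (fst P). fst b \<le> k}"
proof (rule antisym)
  let ?D = "diagram (fst P)"
  have par: "is_partition (fst P)" and M: "snd P \<in> ssyt ?D UNIV" and fin: "finite ?D"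
    using assms by (auto simp: tableau_def)
  have col: "{b \<in> ?D. snd b = j} = (if j = 0 then {} else {1..conj_partition (fst P) j} \<times> {j})" for j
  proof -
    have "(i, j) \<in> ?D \<longleftrightarrow> 1 \<le> j \<and> 1 \<le> i \<and> i \<le> conj_partition (fst P) j" for i
      using mem_diagram_conj[OF par, of j i] unfolding mem_diagram by blast
    then show ?thesis by (cases "j = 0") (auto simp: mem_diagram simp del: One_nat_def, auto)
  qed
  show "greene k (tword P) \<le> card {b\<in>?D. fst b \<le> k}"
  proof (rule greene_row_word_le[OF fin M])
    fix j assume *: "card {b \<in> ?D. snd b = j} \<le> k"
    show "{b \<in> ?D. snd b = j} \<subseteq> {b\<in>?D. fst b \<le> k}"
    proof
      fix b assume b: "b \<in> {b \<in> ?D. snd b = j}"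
      then have "fst b \<le> conj_partition (fst P) j" using col[of j] by (auto split: if_splits)
      moreover have "b \<in> ?D" "j \<noteq> 0" using b by (cases b; auto simp: mem_diagram)+
      ultimately show "b \<in> {b\<in>?D. fst b \<le> k}" using * by (simp add: col card_cartesian_product)
    qed
  next
    fix j assume "card {b \<in> ?D. snd b = j} > k"
    then have *: "k < conj_partition (fst P) j" and "j \<noteq> 0" by (auto simp: col card_cartesian_product split: if_splits)
    have "{b \<in> {b\<in>?D. fst b \<le> k}. snd b = j} = {b \<in> {b \<in> ?D. snd b = j}. fst b \<le> k}" by auto
    also have "\<dots> = {1..k} \<times> {j}" using * \<open>j \<noteq> 0\<close> unfolding col by auto
    finally show "k \<le> card {b \<in> {b\<in>?D. fst b \<le> k}. snd b = j}" by (simp add: card_cartesian_product)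
  qed auto
  show "card {b\<in>?D. fst b \<le> k} \<le> greene k (tword P)"
  proof -
    \<comment> \<open>Rows are the colours, shifted by one so that the first \<open>k\<close> rows
      get the covered colours.\<close>
    let ?c = "\<lambda>b. fst b - 1 :: nat"
    let ?zs = "map (\<lambda>b. (snd P b, ?c b)) (boxes ?D)"
    have "snd P b \<le> snd P b'" if "b \<in> ?D" "b' \<in> ?D" "read_lt b b'" "?c b = ?c b'" for b b'
    proof -
      obtain i j i' j' where [simp]: "b = (i, j)" "b' = (i', j')" by fastforce
      have "i = i'" "j < j'" using that by (auto simp: read_lt_def mem_diagram)
      then show ?thesis using M that by (auto simp: ssyt_def)
    qed
    then have "kcol k ?zs" by (auto simp: kcol_boxes[OF fin])
    then have "covered k ?zs \<le> greene k (tword P)"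
      by (rule greene_ge) (simp add: row_word_boxes)
    moreover have "{b\<in>?D. ?c b < k} = {b\<in>?D. fst b \<le> k}" by (auto simp: mem_diagram)
    ultimately show ?thesis by (simp only: length_filter_boxes[OF fin])
  qed
qed

lemma card_diagram_rows:
  "card {b\<in>diagram l. fst b \<le> k} = (\<Sum>i=1..k. l i)"
proof -
  have "{b\<in>diagram l. fst b \<le> k} = Sigma {1..k} (\<lambda>i. {1..l i})" by (auto simp: diagram_def)
  then show ?thesis by simp
qed

lemma partition_eqI:
  assumes "is_partition l" "is_partition l'" "\<And>k. (\<Sum>i=1..k. l i) = (\<Sum>i=1..k. l' i)"
  shows "l = l'"
proof
  fix i show "l i = l' i"
  proof (cases i)
    case 0 then show ?thesis using assms by (simp add: partition_0)
  next
    case (Suc k) then show ?thesis using assms(3)[of k] assms(3)[of "Suc k"] by simp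
  qed
qed

lemma shape_eqI_greene:
  assumes "tableau P" "tableau Q" "\<And>k. greene k (tword P) = greene k (tword Q)"
  shows "fst P = fst Q"
  using assms by (intro partition_eqI) (auto simp: tableau_def greene_tword card_diagram_rows)

lemma tableau_mono:
  assumes "tableau P" "(i, j) \<in> diagram (fst P)" "1 \<le> i'" "i' \<le> i" "1 \<le> j'" "j' \<le> j"
  shows "snd P (i', j') \<le> snd P (i, j)"
proof -
  have M: "snd P \<in> ssyt (diagram (fst P)) UNIV" "is_partition (fst P)" using assms(1) by (auto simp: tableau_def)
  have d: "(i', j') \<in> diagram (fst P)" "(i', j) \<in> diagram (fst P)"
    using diagram_downclosed[OF M(2) assms(2)] assms by auto
  have "snd P (i', j') \<le> snd P (i', j)" using M(1) d assms by (cases "j' = j") (auto simp: ssyt_def)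
  also have "\<dots> \<le> snd P (i, j)" using M(1) d assms by (cases "i' = i") (auto simp: ssyt_def less_imp_le)
  finally show ?thesis .
qed

definition tab_filter :: "('a \<Rightarrow> bool) \<Rightarrow> ('a::linorder) tab \<Rightarrow> 'a tab" where
  "tab_filter R P = (let E = {b\<in>diagram (fst P). R (snd P b)} in (shape_of E, restrict (snd P) E))"

lemma ssyt_restrict: "M \<in> ssyt D X \<Longrightarrow> E \<subseteq> D \<Longrightarrow> restrict M E \<in> ssyt E X"
  unfolding ssyt_def fillings_def by (auto simp: subset_iff PiE_def extensional_def)

text \<open>Entries grow weakly to the right and downwards, so a downward closed \<open>R\<close>
  selects boxes that again form the diagram of a partition.\<close>

lemma
  assumes "tableau P" and R: "\<And>x y. R y \<Longrightarrow> x \<le> y \<Longrightarrow> R x"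
  shows tableau_filter: "tableau (tab_filter R P)"
    and diagram_tab_filter: "diagram (fst (tab_filter R P)) = {b\<in>diagram (fst P). R (snd P b)}"
    and tword_tab_filter: "tword (tab_filter R P) = filter R (tword P)"
    and snd_tab_filter: "snd (tab_filter R P) = restrict (snd P) {b\<in>diagram (fst P). R (snd P b)}"
proof -
  let ?E = "{b\<in>diagram (fst P). R (snd P b)}"
  have par: "is_partition (fst P)" using assms(1) by (simp add: tableau_def)
  have down: "(i', j') \<in> ?E" if "(i, j) \<in> ?E" "1 \<le> i'" "i' \<le> i" "1 \<le> j'" "j' \<le> j" for i j i' j'
    using that diagram_downclosed[OF par] tableau_mono[OF assms(1)] R by blast
  have fin: "finite ?E" using par by simp
  have sh: "is_partition (shape_of ?E)" "diagram (shape_of ?E) = ?E"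
    by (rule partition_shape_of[OF fin _ down] diagram_shape_of[OF fin _ down]; auto simp: mem_diagram)+
  show d: "diagram (fst (tab_filter R P)) = ?E" by (simp add: tab_filter_def Let_def sh)
  show s: "snd (tab_filter R P) = restrict (snd P) ?E" by (simp add: tab_filter_def Let_def)
  show "tableau (tab_filter R P)" unfolding tableau_def d s
    using sh assms(1) ssyt_restrict[of "snd P" "diagram (fst P)" UNIV ?E] by (auto simp: tab_filter_def tableau_def Let_def)
  have "row_word ?E (restrict (snd P) ?E) = row_word ?E (snd P)" by (rule row_word_cong[OF fin]) auto
  then show "tword (tab_filter R P) = filter R (tword P)" unfolding d s using par by (simp add: filter_row_word)
qed

text \<open>Deleting all letters greater than \<open>a\<close> respects Knuth equivalence, so
  Greene's invariants fix the shape occupied by the entries at most \<open>a\<close>. These nested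
  shapes determine every entry.\<close>

theorem knuth_equiv_tableau_unique:
  assumes "tableau P" "tableau Q" "knuth_equiv (tword P) (tword Q)"
  shows "P = Q"
proof (rule prod_eqI)
  show sh: "fst P = fst Q" using assms by (intro shape_eqI_greene knuth_equiv_greene)
  have "{b\<in>diagram (fst P). snd P b \<le> a} = {b\<in>diagram (fst Q). snd Q b \<le> a}" for a
  proof -
    let ?R = "\<lambda>x. x \<le> a"
    have "knuth_equiv (tword (tab_filter ?R P)) (tword (tab_filter ?R Q))"
      using assms(1,2) by (subst (1 2) tword_tab_filter) (auto intro!: knuth_equiv_filter assms(3))
    then have "fst (tab_filter ?R P) = fst (tab_filter ?R Q)"
      using assms by (intro shape_eqI_greene knuth_equiv_greene tableau_filter) auto
    then show ?thesis using diagram_tab_filter[OF assms(1), of ?R] diagram_tab_filter[OF assms(2), of ?R]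
      by (metis (no_types, lifting) order.trans)
  qed
  then have *: "snd P b \<le> a \<longleftrightarrow> snd Q b \<le> a" if "b \<in> diagram (fst P)" for a b using that sh by blast
  show "snd P = snd Q"
  proof
    fix b show "snd P b = snd Q b"
    proof (cases "b \<in> diagram (fst P)")
      case True then show ?thesis using *[OF True] by (meson order_antisym order_refl)
    next
      case False
      moreover have "snd P \<in> extensional (diagram (fst P))" "snd Q \<in> extensional (diagram (fst P))"
        using assms sh by (auto simp: tableau_def ssyt_def fillings_def PiE_def)
      ultimately show ?thesis by (metis extensional_arb)
    qed
  qed
qed

section \<open>Row insertion\<close>

fun row_above :: "'a::linorder list \<Rightarrow> 'a list list \<Rightarrow> bool" where
  "row_above r [] = True"
| "row_above r (s # _) = (length s \<le> length r \<and> (\<forall>j<length s. r ! j < s ! j))"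

fun ltab :: "'a::linorder list list \<Rightarrow> bool" where
  "ltab [] = True"
| "ltab (r # rs) = (r \<noteq> [] \<and> sorted r \<and> row_above r rs \<and> ltab rs)"

text \<open>Row lengths, continued by 0, so that removing the last box of a row of length 1 is not a
  special case.\<close>

fun lens :: "'a list list \<Rightarrow> nat \<Rightarrow> nat" where
  "lens [] i = 0"
| "lens (r # rs) i = (case i of 0 \<Rightarrow> length r | Suc i' \<Rightarrow> lens rs i')"

fun ins :: "'a::linorder \<Rightarrow> 'a list list \<Rightarrow> 'a list list" where
  "ins x [] = [[x]]"
| "ins x (r # rs) = (case dropWhile (\<lambda>z. z \<le> x) r of
      [] \<Rightarrow> (r @ [x]) # rs
    | y # b \<Rightarrow> (takeWhile (\<lambda>z. z \<le> x) r @ x # b) # ins y rs)"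

lemma ins_append: "\<forall>z\<in>set r. z \<le> x \<Longrightarrow> ins x (r # rs) = (r @ [x]) # rs"
  by (simp add: dropWhile_eq_Nil_conv[THEN iffD2])

lemma ins_bump: "\<forall>z\<in>set a. z \<le> x \<Longrightarrow> x < y \<Longrightarrow> ins x ((a @ y # b) # rs) = (a @ x # b) # ins y rs"
  by (simp add: dropWhile_append takeWhile_append not_le[symmetric])

declare ins.simps(2) [simp del]

lemma row_cases:
  obtains "\<forall>z\<in>set r. z \<le> x" | a y b where "r = a @ y # b" "\<forall>z\<in>set a. z \<le> x" "x < (y::'a::linorder)"
proof (cases "\<forall>z\<in>set r. z \<le> x")
  case False
  then obtain a y b where "r = a @ y # b" "\<not> y \<le> x" "\<forall>z\<in>set a. \<not> \<not> z \<le> x"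
    using split_list_first_prop[of r "\<lambda>z. \<not> z \<le> x"] by blast
  then show ?thesis using that(2) by auto
qed (use that in blast)

lemma nth_replaced: "j \<noteq> length a \<Longrightarrow> (a @ x # b) ! j = (a @ y # b) ! j"
  by (auto simp: nth_append nth_Cons')

lemma nth_prefix_le: "\<forall>z\<in>set a. z \<le> x \<Longrightarrow> j \<le> length a \<Longrightarrow> (a @ x # b) ! j \<le> (x::'a::linorder)"
  by (cases "j = length a") (auto simp: nth_append)

text \<open>In the next row, an entry under the old place of \<open>y\<close> exceeds
  \<open>y\<close>, so \<open>y\<close> lands in the same column or further to the left, where the
  row above now has entries at most \<open>x\<close>.\<close>

lemma above_ins:
  assumes "row_above (a @ y # b) rs" "\<forall>z\<in>set a. z \<le> x" "x < y"
  shows "row_above (a @ x # b) (ins y rs)"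
proof (cases rs)
  case Nil
  then show ?thesis using nth_prefix_le[of a x 0 b] assms by auto
next
  case (Cons s rs')
  let ?r = "a @ y # b" and ?r' = "a @ x # b"
  have len: "length s \<le> length ?r" and lt: "\<And>j. j < length s \<Longrightarrow> ?r ! j < s ! j"
    using assms(1) Cons by auto
  have le: "?r' ! j \<le> ?r ! j" for j
    using nth_replaced[of j a x b y] assms(3) by (cases "j = length a") auto
  show ?thesis
  proof (cases s y rule: row_cases)
    case 1
    have "length s \<le> length a"
    proof (rule ccontr)
      assume "\<not> length s \<le> length a"
      then have "y < s ! length a" "s ! length a \<in> set s" using lt[of "length a"] by auto
      then show False using 1 by auto
    qed
    moreover have "?r' ! j < (s @ [y]) ! j" if "j < Suc (length s)" for j
    proof (cases "j = length s")
      case True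
      then show ?thesis using nth_prefix_le[OF assms(2), of j b] assms(3) \<open>length s \<le> length a\<close> by simp
    next
      case False
      then show ?thesis using le[of j] lt[of j] that by (simp add: nth_append)
    qed
    ultimately show ?thesis using Cons 1 by (auto simp: ins_append)
  next
    case (2 c y' d)
    have "length c \<le> length a"
    proof (rule ccontr)
      assume "\<not> length c \<le> length a"
      then have "y < s ! length a" "s ! length a \<in> set c" using lt[of "length a"] 2(1) by (auto simp: nth_append)
      then show False using 2 by auto
    qed
    have "?r' ! j < (c @ y # d) ! j" if "j < length s" for j
    proof (cases "j = length c")
      case True
      then show ?thesis using nth_prefix_le[OF assms(2), of j b] \<open>length c \<le> length a\<close> assms(3) by simp
    next
      case False
      then show ?thesis using le[of j] lt[OF that] nth_replaced[of j c y d y'] 2(1) by simp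
    qed
    then show ?thesis using Cons 2 len by (simp add: ins_bump)
  qed
qed

lemma ltab_ins: "ltab T \<Longrightarrow> ltab (ins x T)"
proof (induction T arbitrary: x)
  case (Cons r rs)
  show ?case
  proof (cases r x rule: row_cases)
    case 1
    have "row_above (r @ [x]) rs" using Cons.prems by (cases rs) (auto simp: nth_append)
    then show ?thesis using 1 Cons.prems by (simp add: ins_append sorted_append)
  next
    case (2 a y b)
    have "sorted (a @ x # b)" using 2 Cons.prems by (auto simp: sorted_append)
    moreover have "row_above (a @ x # b) (ins y rs)" using above_ins 2 Cons.prems by auto
    ultimately show ?thesis using 2 Cons by (simp add: ins_bump)
  qed
qed simp

lemma knuth_equiv_ins:
  "ltab T \<Longrightarrow> knuth_equiv (concat (rev T) @ [x]) (concat (rev (ins x T)))"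
proof (induction T arbitrary: x)
  case (Cons r rs)
  show ?case
  proof (cases r x rule: row_cases)
    case 1 then show ?thesis by (simp add: ins_append)
  next
    case (2 a y b)
    have "knuth_equiv (concat (rev rs) @ (r @ [x])) (concat (rev rs) @ (y # a @ x # b))"
      using 2 Cons.prems knuth_equiv_bump[of a y b x] by (intro knuth_equiv_append) auto
    also have "concat (rev rs) @ (y # a @ x # b) = (concat (rev rs) @ [y]) @ (a @ x # b)" by simp
    also have "knuth_equiv \<dots> (concat (rev (ins y rs)) @ (a @ x # b))"
      using Cons by (intro knuth_equiv_append) auto
    finally show ?thesis using 2 by (simp add: ins_bump)
  qed
qed simp

section \<open>Reverse insertion and uniqueness of its result\<close>

lemma ins_Nil_neq [simp]: "ins x T \<noteq> []"
  by (cases T) (auto simp: ins.simps(2) split: list.split)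

lemma ltab_lens_0: "ltab T \<Longrightarrow> lens T 0 = 0 \<Longrightarrow> T = []"
  by (cases T) auto

text \<open>\<open>y\<close> stands in the first row of \<open>ins y us\<close> not beyond the
  column of \<open>x\<close>, since the letters of \<open>b\<close> are at least \<open>y\<close>
  and cannot stand above it. Therefore an entry of \<open>us\<close> under the place of
  \<open>x\<close> exceeds \<open>y\<close>.\<close>

lemma above_unins:
  assumes "row_above (a @ x # b) (ins y us)" "ltab us" "x < y" "\<forall>z\<in>set b. y \<le> z"
  shows "row_above (a @ y # b) us"
proof (cases us)
  case (Cons s us')
  let ?r = "a @ x # b" and ?r' = "a @ y # b"
  show ?thesis
  proof (cases s y rule: row_cases)
    case 1
    have *: "length s < length ?r" "\<And>j. j < Suc (length s) \<Longrightarrow> ?r ! j < (s @ [y]) ! j"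
      using assms(1) 1 Cons by (auto simp: ins_append)
    have "length s \<le> length a"
    proof (rule ccontr)
      assume "\<not> length s \<le> length a"
      then have "?r ! length s \<in> set b" using *(1) by (auto simp: nth_append nth_Cons')
      then show False using *(2)[of "length s"] assms(4) by auto
    qed
    have "?r' ! j < s ! j" if "j < length s" for j
      using *(2)[of j] that \<open>length s \<le> length a\<close> by (auto simp: nth_append split: if_splits)
    then show ?thesis using Cons *(1) by auto
  next
    case (2 c z d)
    have *: "length s \<le> length ?r" "\<And>j. j < length s \<Longrightarrow> ?r ! j < (c @ y # d) ! j"
      using assms(1) 2 Cons by (auto simp: ins_bump)
    have ca: "length c \<le> length a"
    proof (rule ccontr)
      assume "\<not> length c \<le> length a"
      then have "?r ! length c \<in> set b" using *(1) 2 by (auto simp: nth_append nth_Cons')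
      then show False using *(2)[of "length c"] assms(4) 2 by auto
    qed
    have "?r' ! j < s ! j" if "j < length s" for j
    proof (cases "j = length a")
      case True
      have "sorted s" using assms(2) Cons by simp
      then have "s ! length c \<le> s ! j" using ca that True by (auto simp: sorted_iff_nth_mono)
      then show ?thesis using 2 True by (auto simp: nth_append)
    next
      case False
      moreover have "(c @ y # d) ! j \<le> s ! j" using nth_replaced[of j c y d z] 2 by (cases "j = length c") auto
      ultimately show ?thesis using *(2)[OF that] nth_replaced[of j a x b y] by simp
    qed
    then show ?thesis using Cons *(1) by auto
  qed
qed simp

lemma hd_ins:
  assumes "ltab us" shows "\<exists>q<length (hd (ins y us)). hd (ins y us) ! q = y"
proof (cases us)
  case (Cons s us')
  show ?thesis
  proof (cases s y rule: row_cases)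
    case 1 then show ?thesis using Cons by (intro exI[of _ "length s"]) (simp add: ins_append)
  next
    case (2 a z b) then show ?thesis using Cons by (intro exI[of _ "length a"]) (simp add: ins_bump)
  qed
qed simp

text \<open>Reverse bumping starts at the last box of row \<open>i\<close>, which is a corner
  because the next row is shorter. A letter \<open>y\<close> expelled from one row returns to the
  row above in place of the last letter smaller than \<open>y\<close>.\<close>

lemma ins_surj:
  assumes "ltab V" "0 < lens V i" "lens V (Suc i) < lens V i"
  shows "\<exists>U x. ltab U \<and> ins x U = V \<and> lens U = (lens V)(i := lens V i - 1)"
  using assms
proof (induction V arbitrary: i)
  case (Cons r rs)
  show ?case
  proof (cases i)
    case 0
    from Cons.prems obtain r0 x where r: "r = r0 @ [x]" by (cases r rule: rev_cases) auto
    show ?thesis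
    proof (cases "r0 = []")
      case True
      then have "rs = []" using Cons.prems 0 r by (intro ltab_lens_0) auto
      then show ?thesis using True r 0
        by (intro exI[of _ "[]"] exI[of _ x]) (auto simp: fun_eq_iff split: nat.split)
    next
      case False
      have "row_above r0 rs" using Cons.prems 0 r by (cases rs) (auto simp: nth_append)
      then show ?thesis using False r 0 Cons.prems
        by (intro exI[of _ "r0 # rs"] exI[of _ x])
           (auto simp: ins_append sorted_append fun_eq_iff split: nat.split)
    qed
  next
    case (Suc i')
    have "ltab rs" "0 < lens rs i'" "lens rs (Suc i') < lens rs i'" using Suc Cons.prems by auto
    from Cons.IH[OF this] obtain us y
      where us: "ltab us" "ins y us = rs" "lens us = (lens rs)(i' := lens rs i' - 1)" by blast
    \<comment> \<open>\<open>y\<close> occupies a box of the first row of \<open>rs\<close>, and the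
      entry of \<open>r\<close> above that box is smaller than \<open>y\<close>.\<close>
    obtain q where q: "q < length (hd rs)" "hd rs ! q = y" using hd_ins[OF us(1), of y] us(2) by auto
    moreover have "rs \<noteq> []" using us(2) by auto
    ultimately have "q < length r" "r ! q < y" using Cons.prems by (cases rs; auto)+
    then have "\<exists>x\<in>set r. x < y" by auto
    then obtain a x b where r: "r = a @ x # b" "x < y" "\<forall>z\<in>set b. \<not> z < y"
      using split_list_last_prop[of r "\<lambda>x. x < y"] by blast
    have b: "\<forall>z\<in>set b. y \<le> z" using r(3) by auto
    have "row_above (a @ y # b) us"
      using Cons.prems(1) by (intro above_unins[OF _ us(1) r(2) b]) (simp add: r(1) us(2))
    moreover have "sorted (a @ y # b)"
    proof -
      have "sorted (a @ x # b)" using Cons.prems(1) r(1) by simp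
      then show ?thesis using b r(2) by (auto simp: sorted_append)
    qed
    moreover have "\<forall>z\<in>set a. z \<le> x" using Cons.prems r by (auto simp: sorted_append)
    ultimately have "ltab ((a @ y # b) # us)" "ins x ((a @ y # b) # us) = r # rs"
      using us(1,2) r(1,2) by (simp_all add: ins_bump)
    then show ?thesis using us(3) r(1) Suc
      by (intro exI[of _ "(a @ y # b) # us"] exI[of _ x]) (auto simp: fun_eq_iff split: nat.split)
  qed
qed simp

text \<open>Both splittings cut the row at its last letter smaller than \<open>y\<close>.\<close>

lemma ins_bump_inj:
  assumes "a @ x # b = a' @ x' # b'" "x < y" "x' < y" "\<forall>z\<in>set b. y \<le> z" "\<forall>z\<in>set b'. y \<le> (z::'a::linorder)"
  shows "a = a' \<and> x = x' \<and> b = b'"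
proof -
  have "filter (\<lambda>z. z < y) b = []" "filter (\<lambda>z. z < y) b' = []" using assms(4,5) by (auto simp: filter_empty_conv)
  have "length b = length b'"
  proof (rule ccontr)
    assume ne: "length b \<noteq> length b'"
    have *: False if "a @ x # b = a' @ x' # b'" "x < y" "\<forall>z\<in>set b'. y \<le> z" "length b < length b'" for a b a' b' x x'
    proof -
      have l: "length a + length b = length a' + length b'" using arg_cong[OF that(1), of length] by simp
      then have "(a @ x # b) ! length a \<in> set b'" unfolding that(1) using that(4)
        by (auto simp: nth_append nth_Cons')
      then show False using that(2,3) by auto
    qed
    show False using *[OF assms(1,2,5)] *[OF assms(1)[symmetric] assms(3,4)] ne by linarith
  qed
  then show ?thesis using assms(1) by (metis append_eq_append_conv list.inject list.size(4))
qed

text \<open>The common shape before insertion decides in each row whether the letter was appended or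
  bumped another, because only appending lengthens the row. A bumped letter is then known from the
  rows below, and \<open>ins_bump_inj\<close> recovers its place.\<close>

lemma ins_inj:
  assumes "ltab U" "ltab U'" "lens U = lens U'" "ins x U = ins x' U'"
  shows "U = U' \<and> x = x'"
  using assms
proof (induction U arbitrary: U' x x')
  case Nil
  then have "U' = []" by (intro ltab_lens_0) (auto dest: fun_cong[of _ _ 0])
  then show ?case using Nil by simp
next
  case (Cons r rs)
  have "U' \<noteq> []" using Cons.prems(1,3) by (auto dest: fun_cong[of _ _ 0])
  then obtain r' rs' where U': "U' = r' # rs'" by (cases U') auto
  have len: "length r = length r'" using fun_cong[OF Cons.prems(3), of 0] U' by simp
  have lens: "lens rs = lens rs'"
  proof
    fix i show "lens rs i = lens rs' i" using fun_cong[OF Cons.prems(3), of "Suc i"] U' by simp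
  qed
  show ?case
  proof (cases r x rule: row_cases)
    case 1
    show ?thesis
    proof (cases r' x' rule: row_cases)
      case app: 1
      then show ?thesis using 1 Cons.prems U' by (auto simp: ins_append)
    next
      case (2 a y b)
      then show ?thesis using 1 Cons.prems(4) U' len by (auto simp: ins_append ins_bump dest: arg_cong[of _ _ length])
    qed
  next
    case (2 a y b)
    show ?thesis
    proof (cases r' x' rule: row_cases)
      case 1
      then show ?thesis using 2 Cons.prems(4) U' len by (auto simp: ins_append ins_bump dest: arg_cong[of _ _ length])
    next
      case (2 a' y' b')
      have eq: "a @ x # b = a' @ x' # b'" "ins y rs = ins y' rs'"
        using Cons.prems(4) \<open>r = a @ y # b\<close> \<open>\<forall>z\<in>set a. z \<le> x\<close> \<open>x < y\<close> 2 U' by (auto simp: ins_bump)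
      have "rs = rs' \<and> y = y'" using Cons.IH[OF _ _ lens eq(2)] Cons.prems U' by auto
      moreover have "a = a' \<and> x = x' \<and> b = b'"
        using Cons.prems(1,2) U' 2 \<open>r = a @ y # b\<close> \<open>x < y\<close> calculation
        by (intro ins_bump_inj[OF eq(1), of y]) (auto simp: sorted_append)
      ultimately show ?thesis using U' 2 \<open>r = a @ y # b\<close> by simp
    qed
  qed
qed

section \<open>First row under insertion of a weakly increasing word\<close>

definition hdrow :: "'a list list \<Rightarrow> 'a list" where
  "hdrow T = (case T of [] \<Rightarrow> [] | r # _ \<Rightarrow> r)"

lemma hdrow_simps [simp]: "hdrow [] = []" "hdrow (r # rs) = r"
  by (simp_all add: hdrow_def)

abbreviation ins_word :: "'a::linorder list list \<Rightarrow> 'a list \<Rightarrow> 'a list list" where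
  "ins_word T w \<equiv> foldl (\<lambda>T x. ins x T) T w"

lemma ltab_ins_word: "ltab T \<Longrightarrow> ltab (ins_word T w)"
  by (induction w arbitrary: T) (auto simp: ltab_ins)

lemma knuth_equiv_ins_word:
  "ltab T \<Longrightarrow> knuth_equiv (concat (rev T) @ w) (concat (rev (ins_word T w)))"
proof (induction w arbitrary: T)
  case (Cons x w)
  have "knuth_equiv ((concat (rev T) @ [x]) @ w) (concat (rev (ins x T)) @ w)"
    using Cons by (intro knuth_equiv_append knuth_equiv_ins) auto
  also have "knuth_equiv \<dots> (concat (rev (ins_word (ins x T) w)))"
    using Cons by (simp add: ltab_ins)
  finally show ?case by simp
qed simp

lemma sorted_hdrow: "ltab T \<Longrightarrow> sorted (hdrow T)"
  by (cases T) auto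

lemma hdrow_ins_append: "\<forall>z\<in>set (hdrow T). z \<le> x \<Longrightarrow> hdrow (ins x T) = hdrow T @ [x]"
  by (cases T) (auto simp: ins_append)

lemma hdrow_ins_bump:
  "hdrow T = a @ y # b \<Longrightarrow> \<forall>z\<in>set a. z \<le> x \<Longrightarrow> x < y \<Longrightarrow> hdrow (ins x T) = a @ x # b"
  by (cases T) (auto simp: ins_bump)

text \<open>Successive letters enter the first row in strictly increasing columns, so the last one
  stands at column \<open>length ys\<close> or beyond. Letters remain to its right only while every
  insertion has been a replacement, which preserves the length of the row.\<close>

lemma hdrow_ins_word_last:
  assumes "ltab T" "sorted ys" "ys \<noteq> []"
  shows "\<exists>A B. hdrow (ins_word T ys) = A @ last ys # B \<and> length ys \<le> Suc (length A) \<and>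
     (B = [] \<or> length (hdrow (ins_word T ys)) = length (hdrow T))"
  using assms(2,3)
proof (induction ys rule: rev_induct)
  case (snoc y ys)
  let ?T = "ins_word T ys"
  have T: "ltab ?T" using assms(1) by (rule ltab_ins_word)
  show ?case
  proof (cases "hdrow ?T" y rule: row_cases)
    case 1
    have "length ys \<le> length (hdrow ?T)"
    proof (cases "ys = []")
      case False
      then obtain A B where "hdrow ?T = A @ last ys # B" "length ys \<le> Suc (length A)"
        using snoc by (auto simp: sorted_append)
      then show ?thesis by simp
    qed simp
    then show ?thesis using hdrow_ins_append[OF 1] by (intro exI[of _ "hdrow ?T"] exI[of _ "[]"]) simp
  next
    case (2 a z b)
    have "length ys \<le> length a \<and> length (hdrow ?T) = length (hdrow T)"
    proof (cases "ys = []")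
      case False
      then obtain A B where AB: "hdrow ?T = A @ last ys # B" "length ys \<le> Suc (length A)"
        "B = [] \<or> length (hdrow ?T) = length (hdrow T)"
        using snoc by (auto simp: sorted_append)
      have le: "\<forall>x\<in>set (A @ [last ys]). x \<le> y"
        using sorted_hdrow[OF T] AB(1) snoc.prems False by (auto simp: sorted_append intro: order.trans)
      have "length A < length a"
      proof (rule ccontr)
        assume "\<not> length A < length a"
        then have "hdrow ?T ! length a \<in> set (A @ [last ys])" unfolding AB(1)
          by (auto simp: nth_append nth_Cons')
        then show False using le 2 by auto
      qed
      moreover have "B \<noteq> []"
      proof
        assume "B = []"
        then have "z \<in> set (A @ [last ys])" using AB(1) 2(1) by (metis in_set_conv_decomp)
        then show False using le 2(3) by auto
      qed
      ultimately show ?thesis using AB by simp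
    qed simp
    then show ?thesis using hdrow_ins_bump[OF 2] 2(1)
      by (intro exI[of _ a] exI[of _ b]) simp
  qed
qed simp

lemma hdrow_ins_word_append:
  assumes "ltab T" "sorted (ys @ zs)" "ys \<noteq> []" "length (hdrow T) \<le> length ys"
  shows "\<exists>A. hdrow (ins_word T (ys @ zs)) = A @ last ys # zs"
  using assms(2)
proof (induction zs rule: rev_induct)
  case Nil
  then obtain A B where AB: "hdrow (ins_word T ys) = A @ last ys # B" "length ys \<le> Suc (length A)"
     "B = [] \<or> length (hdrow (ins_word T ys)) = length (hdrow T)"
    using hdrow_ins_word_last[OF assms(1) _ assms(3)] by auto
  \<comment> \<open>A nonempty \<open>B\<close> would mean that the row has kept its original
    length, which is at most \<open>length ys\<close> and hence at most the column of the last
    inserted letter.\<close>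
  then have "B = []" using assms(4) by (cases B) auto
  then show ?case using AB(1) by simp
next
  case (snoc z zs)
  then obtain A where A: "hdrow (ins_word T (ys @ zs)) = A @ last ys # zs" by (auto simp: sorted_append)
  have "sorted (A @ last ys # zs)"
    using A sorted_hdrow[OF ltab_ins_word[OF assms(1)], of "ys @ zs"] by simp
  then have "\<forall>x\<in>set (A @ last ys # zs). x \<le> z"
    using snoc.prems assms(3) by (auto simp: sorted_append intro: order.trans)
  then show ?case using A hdrow_ins_append[of "ins_word T (ys @ zs)" z] by auto
qed

section \<open>Tableaux as lists of rows\<close>

definition of_ltab :: "'a::linorder list list \<Rightarrow> 'a tab" where
  "of_ltab T = (let l = case_nat 0 (lens T) in
     (l, \<lambda>b\<in>diagram l. T ! (fst b - 1) ! (snd b - 1)))"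

lemma fst_of_ltab: "fst (of_ltab T) = case_nat 0 (lens T)"
  by (simp add: of_ltab_def Let_def)

lemma lens_nth: "lens T i = (if i < length T then length (T ! i) else 0)"
  by (induction T arbitrary: i) (auto simp: nth_Cons split: nat.split)

lemma ltab_nth:
  "ltab T \<longleftrightarrow> (\<forall>i<length T. T ! i \<noteq> [] \<and> sorted (T ! i)) \<and>
     (\<forall>i. Suc i < length T \<longrightarrow> length (T ! Suc i) \<le> length (T ! i) \<and>
        (\<forall>j<length (T ! Suc i). T ! i ! j < T ! Suc i ! j))"
proof (induction T)
  case (Cons r rs)
  have "row_above r rs \<longleftrightarrow> (0 < length rs \<longrightarrow> length (rs ! 0) \<le> length r \<and> (\<forall>j<length (rs ! 0). r ! j < rs ! 0 ! j))"
    by (cases rs) auto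
  then show ?case using Cons by (auto simp: All_less_Suc2 nth_Cons split: nat.split)
qed simp

lemma tableauI:
  assumes "is_partition l" "M \<in> extensional (diagram l)"
    and row: "\<And>i j. (i, Suc j) \<in> diagram l \<Longrightarrow> 1 \<le> j \<Longrightarrow> M (i, j) \<le> M (i, Suc j)"
    and col: "\<And>i j. (Suc i, j) \<in> diagram l \<Longrightarrow> 1 \<le> i \<Longrightarrow> M (i, j) < M (Suc i, j)"
  shows "tableau (l, M)"
proof -
  have "M (i, j) \<le> M (i, j')" if "(i, j') \<in> diagram l" "1 \<le> j" "j < j'" for i j j'
    using that(3,1,2)
  proof (induction rule: strict_inc_induct)
    case (base i')
    then show ?case using row by simp
  next
    case (step j)
    have "(i, Suc j) \<in> diagram l" using step diagram_downclosed[OF assms(1)] by (auto simp: mem_diagram)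
    then show ?case using row[of i j] step by fastforce
  qed
  moreover have "M (i, j) < M (i', j)" if "(i', j) \<in> diagram l" "1 \<le> i" "i < i'" for i i' j
    using that(3,1,2)
  proof (induction rule: strict_inc_induct)
    case (base i)
    then show ?case using col by simp
  next
    case (step i)
    have "(Suc i, j) \<in> diagram l"
      using step(1,3) by (intro diagram_downclosed[OF assms(1) step(3)]) (auto simp: mem_diagram)
    then show ?case using col[of i j] step by fastforce
  qed
  ultimately show ?thesis
    using assms(1,2) by (auto simp: tableau_def ssyt_def fillings_def PiE_def mem_diagram)
qed

lemma mem_diagram_of_ltab:
  "(i, j) \<in> diagram (fst (of_ltab T)) \<longleftrightarrow> 1 \<le> i \<and> i \<le> length T \<and> 1 \<le> j \<and> j \<le> length (T ! (i - 1))"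
  by (cases i) (auto simp: mem_diagram fst_of_ltab lens_nth)

lemma snd_of_ltab:
  "(i, j) \<in> diagram (fst (of_ltab T)) \<Longrightarrow> snd (of_ltab T) (i, j) = T ! (i - 1) ! (j - 1)"
  by (simp add: of_ltab_def Let_def)

lemma tableau_of_ltab:
  assumes "ltab T" shows "tableau (of_ltab T)"
proof -
  let ?l = "fst (of_ltab T)"
  have adj: "lens T (Suc i) \<le> lens T i" for i using assms by (auto simp: lens_nth ltab_nth)
  have "lens T j \<le> lens T i" if "i \<le> j" for i j
    using that by (induction rule: dec_induct) (auto intro: order.trans[OF adj])
  moreover have "{i. ?l i \<noteq> 0} \<subseteq> {..length T}"
  proof
    fix i assume "i \<in> {i. ?l i \<noteq> 0}"
    then show "i \<in> {..length T}" by (cases i) (auto simp: fst_of_ltab lens_nth split: if_splits)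
  qed
  moreover have "finite {i. ?l i \<noteq> 0}" using calculation(2) by (rule finite_subset) simp
  ultimately have par: "is_partition ?l"
    unfolding is_partition_def by (auto simp: fst_of_ltab split: nat.split)
  have "tableau (?l, snd (of_ltab T))"
  proof (rule tableauI[OF par])
    show "snd (of_ltab T) \<in> extensional (diagram ?l)" by (simp add: of_ltab_def Let_def)
  next
    fix i j :: nat assume *: "(i, Suc j) \<in> diagram ?l" "1 \<le> j"
    moreover have "(i, j) \<in> diagram ?l" using * by (simp add: mem_diagram)
    ultimately show "snd (of_ltab T) (i, j) \<le> snd (of_ltab T) (i, Suc j)"
      using assms by (auto simp: snd_of_ltab mem_diagram_of_ltab ltab_nth intro!: sorted_nth_mono)
  next
    fix i j :: nat assume *: "(Suc i, j) \<in> diagram ?l" "1 \<le> i"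
    moreover have "(i, j) \<in> diagram ?l" using * by (intro diagram_downclosed[OF par *(1)]) (auto simp: mem_diagram)
    moreover obtain i' where "i = Suc i'" using * by (cases i) auto
    ultimately show "snd (of_ltab T) (i, j) < snd (of_ltab T) (Suc i, j)"
      using assms by (auto simp: snd_of_ltab mem_diagram_of_ltab ltab_nth)
  qed
  then show ?thesis by simp
qed

lemma of_ltab_inj:
  assumes "ltab T" "ltab T'" "of_ltab T = of_ltab T'" shows "T = T'"
proof -
  have l: "lens T = lens T'"
  proof
    fix i show "lens T i = lens T' i" using fun_cong[of _ _ "Suc i", OF arg_cong[OF assms(3), of fst]]
      by (simp add: fst_of_ltab)
  qed
  have "i < length T \<longleftrightarrow> i < length T'" for i
    using fun_cong[OF l, of i] assms(1,2) by (auto simp: lens_nth ltab_nth split: if_splits)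
  then have len: "length T = length T'" by (meson less_irrefl linorder_less_linear)
  show ?thesis
  proof (rule nth_equalityI[OF len])
    fix i assume i: "i < length T"
    show "T ! i = T' ! i"
    proof (rule nth_equalityI)
      show *: "length (T ! i) = length (T' ! i)" using fun_cong[OF l, of i] i len by (simp add: lens_nth)
      fix j assume j: "j < length (T ! i)"
      have "(Suc i, Suc j) \<in> diagram (fst (of_ltab T))" "(Suc i, Suc j) \<in> diagram (fst (of_ltab T'))"
        using i j len * by (auto simp: mem_diagram_of_ltab)
      then show "T ! i ! j = T' ! i ! j"
        using snd_of_ltab[of "Suc i" "Suc j" T] snd_of_ltab[of "Suc i" "Suc j" T'] assms(3) by simp
    qed
  qed
qed

lemma map_Suc_upt_nth: "map (\<lambda>i. xs ! (i - 1)) [1..<Suc (length xs)] = xs"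
proof (rule nth_equalityI)
  show "map (\<lambda>i. xs ! (i - 1)) [1..<Suc (length xs)] ! i = xs ! i"
    if "i < length (map (\<lambda>i. xs ! (i - 1)) [1..<Suc (length xs)])" for i
    using that by (simp del: upt_Suc)
qed (simp del: upt_Suc)

lemma tword_of_ltab:
  assumes "ltab T" shows "tword (of_ltab T) = concat (rev T)"
proof -
  let ?D = "diagram (fst (of_ltab T))"
  have rows: "{j. (i, j) \<in> ?D} = {1..<Suc (length (T ! (i - 1)))}" if "1 \<le> i" "i \<le> length T" for i
    using that by (auto simp: mem_diagram_of_ltab)
  have "fst ` ?D = {1..<Suc (length T)}"
  proof
    show "{1..<Suc (length T)} \<subseteq> fst ` ?D"
    proof
      fix i assume i: "i \<in> {1..<Suc (length T)}"
      then have "T ! (i - 1) \<noteq> []" using assms by (auto simp: ltab_nth)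
      then have "1 \<le> length (T ! (i - 1))" by (cases "T ! (i - 1)") auto
      then have "(i, 1) \<in> ?D" using i by (auto simp: mem_diagram_of_ltab)
      then show "i \<in> fst ` ?D" by force
    qed
  qed (auto simp: mem_diagram_of_ltab)
  then have "tword (of_ltab T) = concat (map (\<lambda>i. map (\<lambda>j. snd (of_ltab T) (i, j)) (sorted_list_of_set {j. (i, j) \<in> ?D})) (rev [1..<Suc (length T)]))"
    by (simp add: row_word_def del: upt_Suc)
  also have "map (\<lambda>i. map (\<lambda>j. snd (of_ltab T) (i, j)) (sorted_list_of_set {j. (i, j) \<in> ?D})) (rev [1..<Suc (length T)])
      = map (\<lambda>i. T ! (i - 1)) (rev [1..<Suc (length T)])"
  proof (rule map_cong[OF refl])
    fix i assume "i \<in> set (rev [1..<Suc (length T)])"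
    then have i: "1 \<le> i" "i \<le> length T" by auto
    have "map (\<lambda>j. snd (of_ltab T) (i, j)) (sorted_list_of_set {j. (i, j) \<in> ?D})
       = map (\<lambda>j. T ! (i - 1) ! (j - 1)) [1..<Suc (length (T ! (i - 1)))]"
      unfolding rows[OF i] sorted_list_of_set_range
      by (rule map_cong[OF refl], rule snd_of_ltab) (use i in \<open>auto simp: mem_diagram_of_ltab\<close>)
    also have "\<dots> = T ! (i - 1)" by (rule map_Suc_upt_nth)
    finally show "map (\<lambda>j. snd (of_ltab T) (i, j)) (sorted_list_of_set {j. (i, j) \<in> ?D}) = T ! (i - 1)" .
  qed
  also have "\<dots> = rev (map (\<lambda>i. T ! (i - 1)) [1..<Suc (length T)])" by (simp only: rev_map)
  also have "\<dots> = rev T" by (simp only: map_Suc_upt_nth)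
  finally show ?thesis .
qed

text \<open>Inserting the row word of \<open>P\<close> produces a tableau with a Knuth equivalent
  word, which is \<open>P\<close> itself by uniqueness.\<close>

lemma of_ltab_surj:
  assumes "tableau P" obtains T where "ltab T" "of_ltab T = P"
proof -
  have "knuth_equiv (concat (rev []) @ tword P) (concat (rev (ins_word [] (tword P))))"
    by (rule knuth_equiv_ins_word) simp
  moreover have "ltab (ins_word [] (tword P))" by (rule ltab_ins_word) simp
  ultimately have "of_ltab (ins_word [] (tword P)) = P"
    using assms by (intro knuth_equiv_tableau_unique) (auto simp: tableau_of_ltab tword_of_ltab intro: knuth_equiv_sym)
  then show ?thesis using that \<open>ltab (ins_word [] (tword P))\<close> by blast
qed

section \<open>Rectification of words\<close>

text \<open>The tableau representing the plactic class of a word. \<open>rect\<close> depends on a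
  filling only through its row word and is recovered by \<open>rect_ptab\<close>.\<close>

definition ptab :: "'a::linorder list \<Rightarrow> 'a tab" where
  "ptab w = (THE P. tableau P \<and> knuth_equiv (tword P) w)"

lemma ptab_exists: "\<exists>P. tableau P \<and> knuth_equiv (tword P) w"
proof -
  have "knuth_equiv (concat (rev []) @ w) (concat (rev (ins_word [] w)))"
    by (rule knuth_equiv_ins_word) simp
  moreover have "ltab (ins_word [] w)" by (rule ltab_ins_word) simp
  ultimately show ?thesis
    by (intro exI[of _ "of_ltab (ins_word [] w)"]) (simp add: tableau_of_ltab tword_of_ltab knuth_equiv_sym)
qed

lemma ptab_eqI: "tableau P \<Longrightarrow> knuth_equiv (tword P) w \<Longrightarrow> ptab w = P"
  unfolding ptab_def
  by (rule the_equality) (auto intro: knuth_equiv_tableau_unique knuth_equiv_trans knuth_equiv_sym)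

lemma tableau_ptab [simp]: "tableau (ptab w)"
  and knuth_equiv_ptab: "knuth_equiv (tword (ptab w)) w"
  using ptab_exists[of w] ptab_eqI by metis+

lemma ptab_eq_iff: "ptab w = ptab w' \<longleftrightarrow> knuth_equiv w w'"
  by (metis knuth_equiv_ptab knuth_equiv_sym knuth_equiv_trans ptab_eqI tableau_ptab)

lemma ptab_tword [simp]: "tableau P \<Longrightarrow> ptab (tword P) = P"
  by (simp add: ptab_eqI)

lemma rect_ptab: "rect D L = ptab (row_word D L)"
  by (simp add: rect_def ptab_def tableau_def conj_assoc)

lemma partition_ptab [simp]: "is_partition (fst (ptab w))"
  using tableau_ptab[of w] by (simp add: tableau_def)

lemma ptab_filter:
  assumes "\<And>x y. R y \<Longrightarrow> x \<le> y \<Longrightarrow> R x"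
  shows "ptab (filter R w) = tab_filter R (ptab w)"
proof (rule ptab_eqI)
  show "tableau (tab_filter R (ptab w))" by (rule tableau_filter[OF tableau_ptab assms])
  show "knuth_equiv (tword (tab_filter R (ptab w))) (filter R w)"
    by (subst tword_tab_filter[OF tableau_ptab assms])
       (use assms in \<open>auto intro!: knuth_equiv_filter[OF knuth_equiv_ptab]\<close>)
qed

lemma fst_ptab_eqI: "(\<And>k. greene k w = greene k w') \<Longrightarrow> fst (ptab w) = fst (ptab w')"
  by (rule shape_eqI_greene) (auto simp: knuth_equiv_greene[OF knuth_equiv_ptab])

lemma card_ptab: "card (diagram (fst (ptab w))) = length w"
  using knuth_equiv_length[OF knuth_equiv_ptab[of w]] by (simp add: length_row_word)

lemma tword_Nil_iff: "tableau P \<Longrightarrow> tword P = [] \<longleftrightarrow> diagram (fst P) = {}"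
  using length_row_word[of "diagram (fst P)" "snd P"] by (auto simp: tableau_def)

lemma remove_box_shape:
  assumes "is_partition l" "is_partition m" "diagram m = diagram l - {(a, j)}" "(a, j) \<in> diagram l"
  shows "m = l(a := l a - 1)" "l a = j" "l (Suc a) < l a"
proof -
  have a: "1 \<le> a" "1 \<le> j" "j \<le> l a" using assms(4) by (auto simp: mem_diagram)
  have m: "m i = card ({j. (i, j) \<in> diagram l} - {j'. i = a \<and> j' = j})" if "1 \<le> i" for i
    unfolding diagram_row_card[OF that, of m, symmetric] assms(3) by (rule arg_cong[of _ _ card]) auto
  have "{j. (i, j) \<in> diagram l} - {j'. i = a \<and> j' = j} = {j. (i, j) \<in> diagram l}" if "i \<noteq> a" for i
    using that by auto
  then have ne: "m i = l i" if "i \<noteq> a" for i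
    using m[of i] diagram_row_card[of i l] that assms(1,2) by (cases "i = 0") (auto simp: partition_0)
  have "m a = card ({j. (a, j) \<in> diagram l} - {j})"
    using m[OF a(1)] by simp
  also have "\<dots> = l a - 1"
    using assms(1,4) diagram_row_card[OF a(1), of l] by (subst card_Diff_singleton) auto
  finally have eq: "m a = l a - 1" .
  show "m = l(a := l a - 1)" using ne eq by auto
  have "(a, m a + 1) \<in> diagram l" "(a, m a + 1) \<notin> diagram m" using a eq by (auto simp: mem_diagram)
  then have "m a + 1 = j" using assms(3) by auto
  then show "l a = j" using eq a by simp
  have "m (Suc a) \<le> m a" using partition_antimono[OF assms(2) a(1)] by simp
  then show "l (Suc a) < l a" using ne[of "Suc a"] eq a by simp
qed

text \<open>\<open>b\<close> is a corner, since a partition remains when it is removed; so reverse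
  insertion can start there.\<close>

lemma ptab_snoc_surj:
  assumes "tableau V" "is_partition m" "diagram m = diagram (fst V) - {b}" "b \<in> diagram (fst V)"
  obtains U x where "tableau U" "fst U = m" "ptab (tword U @ [x]) = V"
proof -
  obtain T where T: "ltab T" "of_ltab T = V" using assms(1) by (rule of_ltab_surj)
  obtain a j where b: "b = (a, j)" by fastforce
  have par: "is_partition (fst V)" using assms(1) by (simp add: tableau_def)
  note r = remove_box_shape[OF par assms(2) assms(3)[unfolded b] assms(4)[unfolded b]]
  obtain i where i: "a = Suc i" using assms(4) b by (cases a) (auto simp: mem_diagram)
  have j: "1 \<le> j" using assms(4) b by (auto simp: mem_diagram)
  have V: "fst V = case_nat 0 (lens T)" using T(2) fst_of_ltab by metis
  have "0 < lens T i" "lens T (Suc i) < lens T i" using r V i j by auto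
  from ins_surj[OF T(1) this] obtain T' x
    where T': "ltab T'" "ins x T' = T" "lens T' = (lens T)(i := lens T i - 1)" by blast
  have "fst (of_ltab T') = m"
    unfolding r(1) fst_of_ltab V T'(3) i by (auto simp: fun_eq_iff split: nat.split)
  moreover have "ptab (tword (of_ltab T') @ [x]) = V"
    using knuth_equiv_ins[OF T'(1), of x] T T'
    by (intro ptab_eqI) (auto simp: tableau_of_ltab tword_of_ltab knuth_equiv_sym simp flip: T(2))
  ultimately show ?thesis using that tableau_of_ltab[OF T'(1)] by blast
qed

lemma ptab_snoc_inj:
  assumes "tableau U" "tableau U'" "fst U = fst U'" "ptab (tword U @ [x]) = ptab (tword U' @ [x'])"
  shows "U = U' \<and> x = x'"
proof -
  obtain T where T: "ltab T" "of_ltab T = U" using assms(1) by (rule of_ltab_surj)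
  obtain T' where T': "ltab T'" "of_ltab T' = U'" using assms(2) by (rule of_ltab_surj)
  have *: "ptab (tword (of_ltab T) @ [x]) = of_ltab (ins x T)" if "ltab T" for T x
    using knuth_equiv_ins[OF that, of x] that
    by (intro ptab_eqI) (auto simp: tableau_of_ltab tword_of_ltab ltab_ins knuth_equiv_sym)
  have "ins x T = ins x' T'"
    using assms(4) *[OF T(1), of x] *[OF T'(1), of x'] T T' by (intro of_ltab_inj) (auto simp: ltab_ins)
  moreover have "lens T = lens T'"
  proof
    fix i show "lens T i = lens T' i"
      using fun_cong[OF assms(3), of "Suc i"] T(2) T'(2) by (auto simp: fst_of_ltab)
  qed
  ultimately show ?thesis using ins_inj[OF T(1) T'(1)] T T' by auto
qed

section \<open>The Robinson--Schensted--Knuth correspondence\<close>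

text \<open>The positions of \<open>w\<close> carry the labels \<open>ls\<close>; \<open>winv ls w\<close> lists the labels in the (stable) order of
  the letters, so that for permutations it is the inverse and in general \<open>ptab (winv ls w)\<close> is the
  recording tableau of \<open>w\<close>.\<close>

definition winv :: "'b::linorder list \<Rightarrow> 'a::linorder list \<Rightarrow> 'b list" where
  "winv ls w = map fst (sort_key snd (zip ls w))"

definition lex_lt :: "'b::linorder \<times> 'a::linorder \<Rightarrow> 'b \<times> 'a \<Rightarrow> bool" where
  "lex_lt p q \<longleftrightarrow> snd p < snd q \<or> (snd p = snd q \<and> fst p < fst q)"

lemma sorted_wrt_insort_key:
  "sorted_wrt lex_lt ys \<Longrightarrow> \<forall>y\<in>set ys. fst z < fst y \<Longrightarrow> sorted_wrt lex_lt (insort_key snd z ys)"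
  by (induction ys) (auto simp: lex_lt_def set_insort_key)

lemma sorted_wrt_sort_key:
  "sorted_wrt (\<lambda>p q. fst p < fst q) zs \<Longrightarrow> sorted_wrt lex_lt (sort_key snd zs)"
proof (induction zs)
  case (Cons z zs)
  then have "sorted_wrt lex_lt (insort_key snd z (sort_key snd zs))"
    by (intro sorted_wrt_insort_key) auto
  then show ?case by simp
qed simp

text \<open>View the pairs as points in the plane. A colouring is admissible for either reading
  exactly if no two points of the same covered colour are ordered oppositely by their two
  coordinates, a condition symmetric in the coordinates.\<close>

lemma greene_pairs:
  fixes zs :: "('b::linorder \<times> 'a::linorder) list"
  assumes "sorted_wrt (\<lambda>p q. fst p < fst q) zs"
  shows "greene k (map snd zs) = greene k (map fst (sort_key snd zs))"
proof -
  let ?ys = "sort_key snd zs"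
  have dist: "distinct zs" using assms by (induction zs) auto
  then have disty: "distinct ?ys" by simp
  define good where "good c \<longleftrightarrow>
    (\<forall>p\<in>set zs. \<forall>q\<in>set zs. fst p < fst q \<and> c p = c q \<and> c p < k \<longrightarrow> snd p \<le> snd q)" for c :: "'b \<times> 'a \<Rightarrow> nat"
  have kw: "kcol k (map (\<lambda>p. (snd p, c p)) zs) \<longleftrightarrow> good c" for c :: "'b \<times> 'a \<Rightarrow> nat"
  proof -
    have "sorted_wrt Q zs \<longleftrightarrow> (\<forall>p\<in>set zs. \<forall>q\<in>set zs. fst p < fst q \<longrightarrow> Q p q)" for Q
      by (rule sorted_wrt_iff_ball[OF assms]) (rule less_not_sym)
    then show ?thesis unfolding kcol_def sorted_wrt_map good_def by auto
  qed
  have ki: "kcol k (map (\<lambda>p. (fst p, c p)) ?ys) \<longleftrightarrow> good c" for c :: "'b \<times> 'a \<Rightarrow> nat"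
  proof -
    have asym: "lex_lt p q \<Longrightarrow> \<not> lex_lt q p" for p q :: "'b \<times> 'a"
      by (auto simp: lex_lt_def)
    have "good c \<longleftrightarrow> (\<forall>p\<in>set zs. \<forall>q\<in>set zs. lex_lt p q \<longrightarrow> c p = c q \<and> c p < k \<longrightarrow> fst p \<le> fst q)"
    proof (intro iffI ballI impI)
      fix p q assume pq: "good c" "p \<in> set zs" "q \<in> set zs" "lex_lt p q" "c p = c q \<and> c p < k"
      show "fst p \<le> fst q"
      proof (rule ccontr)
        assume "\<not> fst p \<le> fst q"
        then have "snd p < snd q" "fst q < fst p" using pq(4) by (auto simp: lex_lt_def)
        then show False using pq unfolding good_def by (metis leD)
      qed
    next
      assume *: "\<forall>p\<in>set zs. \<forall>q\<in>set zs. lex_lt p q \<longrightarrow> c p = c q \<and> c p < k \<longrightarrow> fst p \<le> fst q"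
      have "snd p \<le> snd q" if "p \<in> set zs" "q \<in> set zs" "fst p < fst q" "c p = c q" "c p < k" for p q
      proof (rule ccontr)
        assume "\<not> snd p \<le> snd q"
        then have "lex_lt q p" by (simp add: lex_lt_def not_le)
        then show False using * that by (metis leD)
      qed
      then show "good c" unfolding good_def by blast
    qed
    then show ?thesis
      unfolding kcol_def sorted_wrt_map
      by (subst sorted_wrt_iff_ball[OF sorted_wrt_sort_key[OF assms] asym]) simp_all
  qed
  have len: "length (filter (\<lambda>x. snd x < k) (map (\<lambda>p. (snd p, c p)) zs)) =
     length (filter (\<lambda>x. snd x < k) (map (\<lambda>p. (fst p, c p)) ?ys))" for c :: "'b \<times> 'a \<Rightarrow> nat"
  proof -
    have "mset (filter (\<lambda>p. c p < k) ?ys) = mset (filter (\<lambda>p. c p < k) zs)" by simp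
    then have "length (filter (\<lambda>p. c p < k) ?ys) = length (filter (\<lambda>p. c p < k) zs)" by (rule mset_eq_length)
    then show ?thesis by (simp add: filter_map o_def)
  qed
  show ?thesis
  proof (rule antisym; rule greene_leI)
    fix xs assume xs: "kcol k xs" "map fst xs = map snd zs"
    then obtain c where "xs = map (\<lambda>p. (snd p, c p)) zs" using map_fst_eq_map_conv[OF dist] by blast
    then show "\<exists>zs'. kcol k zs' \<and> map fst zs' = map fst ?ys \<and>
         covered k xs \<le> covered k zs'"
      using xs kw[of c] ki[of c] len[of c] by (intro exI[of _ "map (\<lambda>p. (fst p, c p)) ?ys"]) simp
  next
    fix xs assume xs: "kcol k xs" "map fst xs = map fst ?ys"
    then obtain c where "xs = map (\<lambda>p. (fst p, c p)) ?ys" using map_fst_eq_map_conv[OF disty] by blast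
    then show "\<exists>zs'. kcol k zs' \<and> map fst zs' = map snd zs \<and>
         covered k xs \<le> covered k zs'"
      using xs kw[of c] ki[of c] len[of c] by (intro exI[of _ "map (\<lambda>p. (snd p, c p)) zs"]) simp
  qed
qed

lemma sorted_wrt_zip: "sorted_wrt (<) ls \<Longrightarrow> length ls = length w \<Longrightarrow> sorted_wrt (\<lambda>p q. fst p < fst q) (zip ls w)"
  by (auto simp: sorted_wrt_iff_nth_less)

lemma fst_ptab_winv:
  assumes "sorted_wrt (<) ls" "length ls = length w"
  shows "fst (ptab (winv ls w)) = fst (ptab w)"
proof (rule fst_ptab_eqI)
  fix k show "greene k (winv ls w) = greene k w"
    using greene_pairs[OF sorted_wrt_zip[OF assms], of k] assms by (simp add: winv_def)
qed

lemma mset_winv: "length ls = length w \<Longrightarrow> mset (winv ls w) = mset ls"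
  unfolding winv_def mset_map mset_sort by (simp flip: mset_map)

lemma filter_winv_append:
  assumes "sorted_wrt (<) (ls @ ls')" "length ls = length w" "length ls' = length w'"
  shows "filter (\<lambda>x. x \<in> set ls) (winv (ls @ ls') (w @ w')) = winv ls w"
    and "filter (\<lambda>x. x \<in> set ls') (winv (ls @ ls') (w @ w')) = winv ls' w'"
proof -
  have d: "set ls \<inter> set ls' = {}" using assms(1) by (auto simp: sorted_wrt_append)
  have "filter (\<lambda>p. fst p \<in> set ls) (zip ls w) = zip ls w" "filter (\<lambda>p. fst p \<in> set ls) (zip ls' w') = []"
    "filter (\<lambda>p. fst p \<in> set ls') (zip ls w) = []" "filter (\<lambda>p. fst p \<in> set ls') (zip ls' w') = zip ls' w'"
    using d by (auto simp: filter_id_conv filter_empty_conv dest: set_zip_leftD)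
  then show "filter (\<lambda>x. x \<in> set ls) (winv (ls @ ls') (w @ w')) = winv ls w"
    and "filter (\<lambda>x. x \<in> set ls') (winv (ls @ ls') (w @ w')) = winv ls' w'"
    using assms(2,3) by (simp_all add: winv_def filter_map o_def filter_sort)
qed

text \<open>The last position carries the largest label, so deleting that label from the recording
  tableau undoes the last insertion.\<close>

lemma ptab_winv_butlast:
  assumes "sorted_wrt (<) (ls @ [l])" "length ls = length w"
  shows "tab_filter (\<lambda>y. y < l) (ptab (winv (ls @ [l]) (w @ [x]))) = ptab (winv ls w)"
proof -
  have "set (winv (ls @ [l]) (w @ [x])) = set (ls @ [l])"
    using mset_winv[of "ls @ [l]" "w @ [x]"] assms(2) by (metis length_append_singleton mset_eq_setD)
  then have "filter (\<lambda>y. y < l) (winv (ls @ [l]) (w @ [x])) = filter (\<lambda>y. y \<in> set ls) (winv (ls @ [l]) (w @ [x]))"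
    using assms(1) by (intro filter_cong) (auto simp: sorted_wrt_append)
  also have "\<dots> = winv ls w" using filter_winv_append(1)[OF assms, of "[x]"] by simp
  finally show ?thesis using ptab_filter[of "\<lambda>y. y < l" "winv (ls @ [l]) (w @ [x])"] by auto
qed

lemma ptab_append: "ptab (tword (ptab u) @ tword (ptab v)) = ptab (u @ v)"
  by (simp add: ptab_eq_iff knuth_equiv_append knuth_equiv_ptab)

lemma ptab_snoc: "ptab (tword (ptab u) @ [x]) = ptab (u @ [x])"
  by (simp add: ptab_eq_iff knuth_equiv_append knuth_equiv_ptab)

text \<open>The recording tableau without its largest label gives the shape before the last
  insertion, and for a known shape the last insertion can be undone in only one way.\<close>

theorem rsk_inj:
  assumes "sorted_wrt (<) ls" "length w = length ls" "length w' = length ls"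
    "ptab w = ptab w'" "ptab (winv ls w) = ptab (winv ls w')"
  shows "w = w'"
  using assms
proof (induction ls arbitrary: w w' rule: rev_induct)
  case (snoc l ls)
  obtain u x where w: "w = u @ [x]" using snoc.prems(2) by (cases w rule: rev_cases) auto
  obtain u' x' where w': "w' = u' @ [x']" using snoc.prems(3) by (cases w' rule: rev_cases) auto
  have len: "length ls = length u" "length ls = length u'" and s: "sorted_wrt (<) ls"
    using snoc.prems w w' by (auto simp: sorted_wrt_append)
  have Q: "ptab (winv ls u) = ptab (winv ls u')"
    using ptab_winv_butlast[OF snoc.prems(1) len(1), of x] ptab_winv_butlast[OF snoc.prems(1) len(2), of x']
      snoc.prems(5) w w' by simp
  then have "fst (ptab u) = fst (ptab u')" using fst_ptab_winv[OF s] len by metis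
  then have "ptab u = ptab u' \<and> x = x'"
    by (rule ptab_snoc_inj[OF tableau_ptab tableau_ptab]) (unfold ptab_snoc, use snoc.prems(4) w w' in simp)
  then show ?case using snoc.IH[OF s _ _ _ Q] len w w' by simp
qed simp

text \<open>The box of the largest label in \<open>Q\<close> tells where reverse insertion into
  \<open>V\<close> has to start; the shorter word then comes from the induction hypothesis.\<close>

theorem rsk_surj:
  assumes "sorted_wrt (<) ls" "tableau V" "tableau Q" "fst V = fst Q" "mset (tword Q) = mset ls"
  shows "\<exists>w. length w = length ls \<and> ptab w = V \<and> ptab (winv ls w) = Q"
  using assms
proof (induction ls arbitrary: V Q rule: rev_induct)
  case Nil
  then have "tword Q = []" by simp
  then have "tword V = []" using Nil tword_Nil_iff by metis
  then have "ptab [] = V" "ptab [] = Q" using Nil(2,3) \<open>tword Q = []\<close> by (auto intro!: ptab_eqI)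
  then show ?case by (simp add: winv_def)
next
  case (snoc l ls)
  let ?D = "diagram (fst Q)" and ?R = "\<lambda>y. y < l"
  have fin: "finite ?D" and par: "is_partition (fst Q)" using snoc.prems(3) by (auto simp: tableau_def)
  have s: "sorted_wrt (<) ls" and lt: "\<forall>y\<in>set ls. y < l" using snoc.prems(1) by (auto simp: sorted_wrt_append)
  have "distinct (ls @ [l])" using snoc.prems(1) strict_sorted_iff by blast
  then have inj: "inj_on (snd Q) ?D" using snoc.prems(5) fin by (metis distinct_row_word mset_eq_imp_distinct_iff)
  have img: "snd Q ` ?D = insert l (set ls)"
    using set_row_word[OF fin, of "snd Q"] mset_eq_setD[OF snoc.prems(5)] by simp
  then obtain b where b: "b \<in> ?D" "snd Q b = l" by (metis imageE insertI1)
  have E: "{c\<in>?D. ?R (snd Q c)} = ?D - {b}"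
  proof -
    have "snd Q c < l \<longleftrightarrow> c \<noteq> b" if "c \<in> ?D" for c
    proof -
      have "snd Q c \<in> insert l (set ls)" using img that by blast
      then show ?thesis using lt b inj that by (auto dest: inj_onD)
    qed
    then show ?thesis using b by auto
  qed
  let ?Q' = "tab_filter ?R Q"
  have Q': "tableau ?Q'" "diagram (fst ?Q') = ?D - {b}" "tword ?Q' = filter ?R (tword Q)"
    "snd ?Q' = restrict (snd Q) (?D - {b})"
    using tableau_filter[OF snoc.prems(3), of ?R] diagram_tab_filter[OF snoc.prems(3), of ?R]
      tword_tab_filter[OF snoc.prems(3), of ?R] snd_tab_filter[OF snoc.prems(3), of ?R] E
    by (auto intro: le_less_trans)
  have "mset (tword ?Q') = filter_mset ?R (mset (ls @ [l]))" unfolding Q'(3) using snoc.prems(5) by simp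
  also have "\<dots> = mset ls" using lt by (simp add: filter_mset_eq_conv)
  finally have msQ': "mset (tword ?Q') = mset ls" .
  have parQ': "is_partition (fst ?Q')" using Q'(1) by (simp add: tableau_def)
  obtain U x where U: "tableau U" "fst U = fst ?Q'" "ptab (tword U @ [x]) = V"
    using ptab_snoc_surj[OF snoc.prems(2) parQ', of b] Q'(2) b(1) snoc.prems(4) by auto
  obtain w where w: "length w = length ls" "ptab w = U" "ptab (winv ls w) = ?Q'"
    using snoc.IH[OF s U(1) Q'(1) U(2) msQ'] by blast
  \<comment> \<open>The recording tableau of the extended word has the shape of \<open>Q\<close> and
    agrees with \<open>Q\<close> outside \<open>b\<close>. Its entry at \<open>b\<close> is a label
    that is not smaller than \<open>l\<close>, hence \<open>l\<close>.\<close>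
  let ?Q2 = "ptab (winv (ls @ [l]) (w @ [x]))"
  have V: "ptab (w @ [x]) = V" using U(3) w(2) ptab_snoc by metis
  have len: "length (ls @ [l]) = length (w @ [x])" using w by simp
  have f: "tab_filter ?R ?Q2 = ?Q'" using ptab_winv_butlast[OF snoc.prems(1), of w x] w by simp
  have sh: "fst ?Q2 = fst Q" using fst_ptab_winv[OF snoc.prems(1) len] V snoc.prems(4) by simp
  have R: "?R x" if "?R y" "x \<le> y" for x y using that by (rule le_less_trans[rotated])
  have E2: "{c\<in>?D. ?R (snd ?Q2 c)} = ?D - {b}"
    using diagram_tab_filter[where R = ?R and P = "ptab (winv (ls @ [l]) (w @ [x]))", OF tableau_ptab R] unfolding f Q'(2) sh by simp
  have S2: "restrict (snd ?Q2) (?D - {b}) = restrict (snd Q) (?D - {b})"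
    using snd_tab_filter[where R = ?R and P = "ptab (winv (ls @ [l]) (w @ [x]))", OF tableau_ptab R] unfolding f Q'(4) sh E2 by simp
  have "set (tword ?Q2) = set (ls @ [l])"
    using knuth_equiv_set[OF knuth_equiv_ptab] mset_winv[OF len] mset_eq_setD by metis
  then have "snd ?Q2 ` ?D = insert l (set ls)" using set_row_word[OF fin, of "snd ?Q2"] sh by simp
  then have "snd ?Q2 b \<in> insert l (set ls)" using b by blast
  moreover have "\<not> snd ?Q2 b < l" using E2 b by blast
  ultimately have b2: "snd ?Q2 b = l" using lt by auto
  have "snd ?Q2 = snd Q"
  proof
    fix c show "snd ?Q2 c = snd Q c"
    proof (cases "c \<in> ?D")
      case True
      then show ?thesis using b b2 fun_cong[OF S2, of c] by (cases "c = b") auto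
    next
      case False
      moreover have "snd Q \<in> extensional ?D" "snd ?Q2 \<in> extensional ?D"
        using snoc.prems(3) tableau_ptab[of "winv (ls @ [l]) (w @ [x])"] sh
        by (auto simp: tableau_def ssyt_def fillings_def PiE_def)
      ultimately show ?thesis by (metis extensional_arb)
    qed
  qed
  then have "?Q2 = Q" using sh by (simp add: prod_eq_iff)
  then show ?case using V len by (intro exI[of _ "w @ [x]"]) simp
qed

section \<open>Labelled words\<close>


text \<open>\<open>n x\<close> is the number of labels already given to the letter \<open>x\<close>.\<close>

fun labf :: "(nat \<Rightarrow> nat) \<Rightarrow> nat list \<Rightarrow> lab list" where
  "labf n [] = []"
| "labf n (x # w) = Lab x (Suc (n x)) # labf (n(x := Suc (n x))) w"

abbreviation labw :: "nat list \<Rightarrow> lab list" where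
  "labw \<equiv> labf (\<lambda>_. 0)"

lemma labf_append: "labf n (u @ v) = labf n u @ labf (\<lambda>x. n x + count_list u x) v"
proof (induction u arbitrary: n)
  case (Cons a u)
  have "(\<lambda>x. (n(a := Suc (n a))) x + count_list u x) = (\<lambda>x. n x + count_list (a # u) x)"
    by (auto simp: fun_eq_iff)
  then show ?case using Cons.IH[of "n(a := Suc (n a))"] by (simp only: append_Cons labf.simps)
qed simp

lemma map_lab_val_labf [simp]: "map lab_val (labf n w) = w"
  by (induction w arbitrary: n) auto

lemma length_labf [simp]: "length (labf n w) = length w"
  by (metis length_map map_lab_val_labf)

lemma labf_bounds: "y \<in> set (labf n w) \<Longrightarrow> n (lab_val y) < lab_idx y"
proof (induction w arbitrary: n)
  case (Cons x w)
  show ?case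
  proof (cases "y = Lab x (Suc (n x))")
    case False
    then have "y \<in> set (labf (n(x := Suc (n x))) w)" using Cons.prems by simp
    from Cons.IH[OF this] show ?thesis by (auto split: if_splits)
  qed simp
qed simp

abbreviation labels_sorted :: "lab list \<Rightarrow> bool" where
  "labels_sorted \<equiv> sorted_wrt (\<lambda>x y. lab_val x = lab_val y \<longrightarrow> x < y)"

lemma sorted_labf: "labels_sorted (labf n w)"
proof (induction w arbitrary: n)
  case (Cons x w)
  have "Lab x (Suc (n x)) < y" if "y \<in> set (labf (n(x := Suc (n x))) w)" "x = lab_val y" for y
    using labf_bounds[OF that(1)] that(2) by (simp add: less_lab_def)
  then show ?case using Cons by auto
qed simp

text \<open>Different letters draw their subscripts from separate counters, so adjacent different
  letters can be exchanged together with their labels.\<close>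

lemma labf_swap:
  assumes "x \<noteq> y"
  obtains X Y where "labf n (u @ x # y # v) = labf n u @ X # Y # labf (\<lambda>z. n z + count_list (u @ [x, y]) z) v"
    "labf n (u @ y # x # v) = labf n u @ Y # X # labf (\<lambda>z. n z + count_list (u @ [x, y]) z) v"
    "lab_val X = x" "lab_val Y = y"
proof -
  let ?m = "\<lambda>z. n z + count_list u z"
  have "(\<lambda>z. n z + count_list (u @ [x, y]) z) = ?m(x := Suc (?m x), y := Suc (?m y))"
    "(\<lambda>z. n z + count_list (u @ [x, y]) z) = ?m(y := Suc (?m y), x := Suc (?m x))"
    using assms by (auto simp: fun_eq_iff)
  then show ?thesis using assms
    by (intro that[of "Lab x (Suc (?m x))" "Lab y (Suc (?m y))"]) (auto simp: labf_append)
qed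

lemma labw_swap3:
  assumes "x \<noteq> y"
  obtains X Y B R where "labw (u @ [b, x, y] @ v) = labw u @ [B, X, Y] @ R"
    "labw (u @ [b, y, x] @ v) = labw u @ [B, Y, X] @ R"
    "lab_val X = x" "lab_val Y = y" "lab_val B = b"
proof -
  obtain X Y where *: "labw ((u @ [b]) @ x # y # v) = labw (u @ [b]) @ X # Y # labf (\<lambda>z. 0 + count_list ((u @ [b]) @ [x, y]) z) v"
    "labw ((u @ [b]) @ y # x # v) = labw (u @ [b]) @ Y # X # labf (\<lambda>z. 0 + count_list ((u @ [b]) @ [x, y]) z) v"
    "lab_val X = x" "lab_val Y = y"
    by (rule labf_swap[OF assms, of "\<lambda>_. 0" "u @ [b]" v])
  show ?thesis using * by (intro that) (auto simp: labf_append)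
qed

lemma labw_swap3':
  assumes "x \<noteq> y"
  obtains X Y B R where "labw (u @ [x, y, b] @ v) = labw u @ [X, Y, B] @ R"
    "labw (u @ [y, x, b] @ v) = labw u @ [Y, X, B] @ R"
    "lab_val X = x" "lab_val Y = y" "lab_val B = b"
proof -
  obtain X Y where *: "labw (u @ x # y # b # v) = labw u @ X # Y # labf (\<lambda>z. 0 + count_list (u @ [x, y]) z) (b # v)"
    "labw (u @ y # x # b # v) = labw u @ Y # X # labf (\<lambda>z. 0 + count_list (u @ [x, y]) z) (b # v)"
    "lab_val X = x" "lab_val Y = y"
    by (rule labf_swap[OF assms, of "\<lambda>_. 0" u "b # v"])
  show ?thesis using * by (intro that) auto
qed

lemma sorted_lab_before:
  assumes "labels_sorted (u @ xs @ v)"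
  shows "labels_sorted xs"
  using assms by (simp add: sorted_wrt_append)

lemma lab_val_mono: "x \<le> y \<Longrightarrow> lab_val x \<le> lab_val y"
  by (auto simp: less_eq_lab_def)

text \<open>The exchanged letters differ and keep their labels. A tie with the witness is allowed
  only for a letter whose reading order relative to it agrees with the weak inequality, and
  subscripts increase in reading order.\<close>

lemma knuth_step_labw:
  assumes "knuth_step w w'" shows "knuth_step (labw w) (labw w')"
  using assms
proof cases
  case (1 a b c u v)
  then have "c \<noteq> a" by auto
  then obtain C A B R where *: "labw (u @ [b, c, a] @ v) = labw u @ [B, C, A] @ R"
    "labw (u @ [b, a, c] @ v) = labw u @ [B, A, C] @ R" "lab_val C = c" "lab_val A = a" "lab_val B = b"
    by (rule labw_swap3)
  have "labels_sorted [B, C, A]"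
    by (rule sorted_lab_before[of "labw u" _ R]) (unfold *(1)[symmetric], rule sorted_labf)
  then have "A < B" "B \<le> C" using 1(3,4) *(3-5) by (auto simp: less_lab_def less_eq_lab_def)
  then show ?thesis unfolding 1 *(1,2) by (rule knuth_step.intros)
next
  case (2 a b c u v)
  then have "a \<noteq> c" by auto
  then obtain A C B R where *: "labw (u @ [a, c, b] @ v) = labw u @ [A, C, B] @ R"
    "labw (u @ [c, a, b] @ v) = labw u @ [C, A, B] @ R" "lab_val A = a" "lab_val C = c" "lab_val B = b"
    by (rule labw_swap3')
  have "labels_sorted [A, C, B]"
    by (rule sorted_lab_before[of "labw u" _ R]) (unfold *(1)[symmetric], rule sorted_labf)
  then have "a = b \<longrightarrow> A < B" using *(3-5) by simp
  then have "A \<le> B" "B < C" using 2(3,4) *(3-5) by (auto simp: less_lab_def less_eq_lab_def)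
  then show ?thesis unfolding 2 *(1,2) by (rule knuth_step.intros)
qed

lemma knuth_equiv_labw: "knuth_equiv w w' \<Longrightarrow> knuth_equiv (labw w) (labw w')"
  by (erule knuth_equiv_hom) (intro knuth_equiv_step knuth_step_labw)

definition is_labw :: "lab list \<Rightarrow> bool" where
  "is_labw u \<longleftrightarrow> labw (map lab_val u) = u"

lemma is_labw_labw [simp]: "is_labw (labw w)"
  by (simp add: is_labw_def)

lemma is_labw_sorted: "is_labw u \<Longrightarrow> labels_sorted u"
  unfolding is_labw_def by (metis sorted_labf)

lemma lab_val_lt: "x \<le> y \<Longrightarrow> (lab_val y = lab_val x \<longrightarrow> y < x) \<Longrightarrow> lab_val x < lab_val y"
  by (auto simp: less_lab_def less_eq_lab_def)

text \<open>The strict inequality between labels stays strict for the values: with equal values the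
  label read first would be the smaller one, whereas here it is the larger one. So the move is also
  a Knuth move of the unlabelled words.\<close>

lemma is_labw_step:
  assumes "knuth_step u u' \<or> knuth_step u' u" "is_labw u"
  shows "is_labw u' \<and> knuth_equiv (map lab_val u) (map lab_val u')"
proof -
  have A1: "is_labw (p @ [b, y, x] @ q) \<and> lab_val a < lab_val b \<and> lab_val b \<le> lab_val c"
    if "is_labw (p @ [b, x, y] @ q)" "a < b" "b \<le> c" "x = a \<and> y = c \<or> x = c \<and> y = a" for p q a b c x y
  proof -
    have "labels_sorted [b, x, y]"
      by (rule sorted_lab_before[OF is_labw_sorted[OF that(1)]])
    then have lt: "lab_val a < lab_val b" "lab_val b \<le> lab_val c"
      using that by (auto intro: lab_val_lt lab_val_mono)
    then have "lab_val x \<noteq> lab_val y" using that by auto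
    then obtain X Y B R where *: "labw (map lab_val p @ [lab_val b, lab_val x, lab_val y] @ map lab_val q) = labw (map lab_val p) @ [B, X, Y] @ R"
      "labw (map lab_val p @ [lab_val b, lab_val y, lab_val x] @ map lab_val q) = labw (map lab_val p) @ [B, Y, X] @ R"
      by (rule labw_swap3)
    have "labw (map lab_val p) @ [B, X, Y] @ R = p @ [b, x, y] @ q" using that(1) *(1) by (simp add: is_labw_def)
    then have "labw (map lab_val p) = p \<and> B = b \<and> X = x \<and> Y = y \<and> R = q" by (simp add: append_eq_append_conv)
    then show ?thesis using *(2) lt by (simp add: is_labw_def)
  qed
  have A2: "is_labw (p @ [y, x, b] @ q) \<and> lab_val a \<le> lab_val b \<and> lab_val b < lab_val c"
    if "is_labw (p @ [x, y, b] @ q)" "a \<le> b" "b < c" "x = a \<and> y = c \<or> x = c \<and> y = a" for p q a b c x y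
  proof -
    have "labels_sorted [x, y, b]"
      by (rule sorted_lab_before[OF is_labw_sorted[OF that(1)]])
    then have lt: "lab_val a \<le> lab_val b" "lab_val b < lab_val c"
      using that by (auto intro: lab_val_lt lab_val_mono)
    then have "lab_val x \<noteq> lab_val y" using that by auto
    then obtain X Y B R where *: "labw (map lab_val p @ [lab_val x, lab_val y, lab_val b] @ map lab_val q) = labw (map lab_val p) @ [X, Y, B] @ R"
      "labw (map lab_val p @ [lab_val y, lab_val x, lab_val b] @ map lab_val q) = labw (map lab_val p) @ [Y, X, B] @ R"
      by (rule labw_swap3')
    have "labw (map lab_val p) @ [X, Y, B] @ R = p @ [x, y, b] @ q" using that(1) *(1) by (simp add: is_labw_def)
    then have "labw (map lab_val p) = p \<and> B = b \<and> X = x \<and> Y = y \<and> R = q" by (simp add: append_eq_append_conv)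
    then show ?thesis using *(2) lt by (simp add: is_labw_def)
  qed
  show ?thesis
    using assms(1)
  proof
    assume "knuth_step u u'"
    then show ?thesis
    proof cases
      case (1 a b c p q)
      then show ?thesis using \<open>is_labw u\<close> A1[of p b c a q a c]
        knuth_step.intros(1)[of "lab_val a" "lab_val b" "lab_val c" "map lab_val p" "map lab_val q"]
        by (auto intro: knuth_equiv_step)
    next
      case (2 a b c p q)
      then show ?thesis using \<open>is_labw u\<close> A2[of p a c b q a c]
        knuth_step.intros(2)[of "lab_val a" "lab_val b" "lab_val c" "map lab_val p" "map lab_val q"]
        by (auto intro: knuth_equiv_step)
    qed
  next
    assume "knuth_step u' u"
    then show ?thesis
    proof cases
      case (1 a b c p q)
      then show ?thesis using \<open>is_labw u\<close> A1[of p b a c q a c]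
        knuth_step.intros(1)[of "lab_val a" "lab_val b" "lab_val c" "map lab_val p" "map lab_val q"]
        by (auto intro: knuth_equiv_step knuth_equiv_sym)
    next
      case (2 a b c p q)
      then show ?thesis using \<open>is_labw u\<close> A2[of p c a b q a c]
        knuth_step.intros(2)[of "lab_val a" "lab_val b" "lab_val c" "map lab_val p" "map lab_val q"]
        by (auto intro: knuth_equiv_step knuth_equiv_sym)
    qed
  qed
qed

lemma is_labw_knuth_equiv:
  assumes "knuth_equiv u u'" "is_labw u"
  shows "is_labw u' \<and> knuth_equiv (map lab_val u) (map lab_val u')"
  using assms
proof (induction rule: knuth_equiv_induct)
  case (step x y)
  then show ?case using is_labw_step[of x y] by (meson knuth_equiv_trans)
qed simp

section \<open>Labelled tableaux and their row words\<close>

lemma labw_map_boxes: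
  assumes "sorted_wrt read_lt bs"
  shows "labw (map L bs) = map (\<lambda>b. Lab (L b) (card {b'\<in>set bs. L b' = L b \<and> read_le b' b})) bs"
  using assms
proof (induction bs rule: rev_induct)
  case (snoc b bs)
  have s: "sorted_wrt read_lt bs" "\<forall>c\<in>set bs. read_lt c b" using snoc.prems by (auto simp: sorted_wrt_append)
  have "distinct bs"
    using s(1) by (induction bs) (auto simp: read_lt_def)
  have "{b'\<in>set (bs @ [b]). L b' = L c \<and> read_le b' c} = {b'\<in>set bs. L b' = L c \<and> read_le b' c}"
    if "c \<in> set bs" for c
    using s(2) that by (auto simp: read_lt_def read_le_def)
  then have 1: "map (\<lambda>c. Lab (L c) (card {b'\<in>set (bs @ [b]). L b' = L c \<and> read_le b' c})) bs = labw (map L bs)"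
    using snoc.IH[OF s(1)] by simp
  have "{b'\<in>set (bs @ [b]). L b' = L b \<and> read_le b' b} = insert b {b'\<in>set bs. L b' = L b}"
    using s(2) by (auto simp: read_lt_def read_le_def)
  moreover have "b \<notin> set bs" using s(2) by (auto simp: read_lt_def)
  ultimately have "card {b'\<in>set (bs @ [b]). L b' = L b \<and> read_le b' b} = Suc (card {b'\<in>set bs. L b' = L b})"
    by simp
  also have "card {b'\<in>set bs. L b' = L b} = count_list (map L bs) (L b)"
    using \<open>distinct bs\<close> unfolding count_list_eq_length_filter filter_map length_map
    by (simp add: distinct_card[symmetric] o_def eq_commute)
  finally show ?case using 1 by (simp add: labf_append)
qed simp

lemma row_word_phi_T:
  assumes "finite D" shows "row_word D (phi_T D L) = labw (row_word D L)"
proof -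
  have "row_word D (phi_T D L) = map (\<lambda>b. Lab (L b) (card {b'\<in>D. L b' = L b \<and> read_le b' b})) (boxes D)"
    unfolding row_word_boxes by (rule map_cong[OF refl]) (use assms in \<open>simp add: phi_T_def\<close>)
  then show ?thesis
    using labw_map_boxes[OF sorted_boxes, of L] assms by (simp add: row_word_boxes)
qed

lemma lab_val_phi_T: "b \<in> D \<Longrightarrow> lab_val (phi_T D L b) = L b"
  by (simp add: phi_T_def)

lemma row_word_sorted_wrt:
  assumes "finite D"
  shows "sorted_wrt R (row_word D M) \<longleftrightarrow> (\<forall>b\<in>D. \<forall>b'\<in>D. read_lt b b' \<longrightarrow> R (M b) (M b'))"
  unfolding row_word_boxes sorted_wrt_map
  by (subst sorted_wrt_iff_ball[OF sorted_boxes read_lt_asym]) (use assms in auto)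

lemma phi_T_inj: "finite D \<Longrightarrow> inj_on (phi_T D L) D"
proof -
  assume fin: "finite D"
  have "distinct xs" if "labels_sorted xs" for xs
    using that by (induction xs) auto
  then have "distinct (row_word D (phi_T D L))" unfolding row_word_phi_T[OF fin] using sorted_labf by blast
  then show ?thesis using fin by (simp add: distinct_row_word)
qed

lemma phi_T_less:
  assumes "finite D" "b \<in> D" "b' \<in> D" "read_lt b b'" "L b \<le> L b'"
  shows "phi_T D L b < phi_T D L b'"
proof (cases "L b = L b'")
  case True
  have "labels_sorted (row_word D (phi_T D L))"
    unfolding row_word_phi_T[OF assms(1)] by (rule sorted_labf)
  then have "lab_val (phi_T D L b) = lab_val (phi_T D L b') \<longrightarrow> phi_T D L b < phi_T D L b'"
    unfolding row_word_sorted_wrt[OF assms(1)] using assms(2-4) by blast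
  then show ?thesis using True assms(2,3) by (simp add: lab_val_phi_T)
next
  case False
  then show ?thesis using assms by (simp add: less_lab_def lab_val_phi_T)
qed

lemma ssyt_phi_T:
  assumes "finite D" "L \<in> ssyt D X" shows "phi_T D L \<in> ssyt D UNIV"
  unfolding ssyt_def fillings_def
proof (intro CollectI conjI allI impI)
  show "phi_T D L \<in> D \<rightarrow>\<^sub>E UNIV" by (auto simp: phi_T_def)
  fix i j j' :: nat assume *: "(i, j) \<in> D \<and> (i, j') \<in> D \<and> j < j'"
  then show "phi_T D L (i, j) \<le> phi_T D L (i, j')"
    using assms by (intro less_imp_le[OF phi_T_less]) (auto simp: read_lt_def ssyt_def)
next
  fix i i' j :: nat assume *: "(i, j) \<in> D \<and> (i', j) \<in> D \<and> i < i'"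
  then have "L (i, j) < L (i', j)" using assms by (auto simp: ssyt_def)
  then show "phi_T D L (i, j) < phi_T D L (i', j)" using * by (simp add: less_lab_def lab_val_phi_T)
qed

text \<open>Equal values in a column would have subscripts increasing from bottom to top, against
  the strict increase of \<open>M\<close> downwards; so the columns remain strict.\<close>

lemma ssyt_lab_val:
  assumes "finite D" "M \<in> ssyt D UNIV" "is_labw (row_word D M)"
  shows "(\<lambda>b\<in>D. lab_val (M b)) \<in> ssyt D UNIV"
  unfolding ssyt_def fillings_def
proof (intro CollectI conjI allI impI)
  fix i j j' :: nat assume *: "(i, j) \<in> D \<and> (i, j') \<in> D \<and> j < j'"
  then show "(\<lambda>b\<in>D. lab_val (M b)) (i, j) \<le> (\<lambda>b\<in>D. lab_val (M b)) (i, j')"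
    using assms(2) by (auto simp: ssyt_def intro: lab_val_mono)
next
  fix i i' j :: nat assume *: "(i, j) \<in> D \<and> (i', j) \<in> D \<and> i < i'"
  then have "M (i, j) < M (i', j)" using assms(2) by (auto simp: ssyt_def)
  moreover have "lab_val (M (i', j)) = lab_val (M (i, j)) \<longrightarrow> M (i', j) < M (i, j)"
    using is_labw_sorted[OF assms(3)] * assms(1) by (auto simp: row_word_sorted_wrt read_lt_def)
  ultimately show "(\<lambda>b\<in>D. lab_val (M b)) (i, j) < (\<lambda>b\<in>D. lab_val (M b)) (i', j)"
    using * by (simp add: lab_val_lt)
qed simp

definition tab_val :: "lab tab \<Rightarrow> nat tab" where
  "tab_val P = (fst P, \<lambda>b\<in>diagram (fst P). lab_val (snd P b))"

lemma row_word_lab_val: "finite D \<Longrightarrow> row_word D (\<lambda>b\<in>D. lab_val (M b)) = map lab_val (row_word D M)"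
  by (simp add: row_word_boxes)

text \<open>The property \<open>is_labw\<close> passes along Knuth moves, so the rectification of a
  labelled word is labelled as well. Forgetting the subscripts then yields a tableau that is Knuth
  equivalent to \<open>w\<close>.\<close>

lemma ptab_labw: "ptab w = tab_val (ptab (labw w))"
proof (rule ptab_eqI)
  let ?P = "ptab (labw w)"
  have fin: "finite (diagram (fst ?P))" by simp
  have 1: "is_labw (tword ?P)" "knuth_equiv (map lab_val (labw w)) (map lab_val (tword ?P))"
    using is_labw_knuth_equiv[OF knuth_equiv_sym[OF knuth_equiv_ptab[of "labw w"]]] by auto
  then show "tableau (tab_val ?P)"
    using ssyt_lab_val[OF fin _ 1(1)] tableau_ptab[of "labw w"] by (simp add: tableau_def tab_val_def)
  show "knuth_equiv (tword (tab_val ?P)) w"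
    using 1(2) by (simp add: tab_val_def row_word_lab_val knuth_equiv_sym)
qed

section \<open>Products of tableaux and rectifications of skew tableaux\<close>

lemma knuth_equiv_filter_on:
  assumes "knuth_equiv w w'"
    and P: "\<And>a b c. a \<in> set w \<Longrightarrow> b \<in> set w \<Longrightarrow> c \<in> set w \<Longrightarrow> P a \<Longrightarrow> P c \<Longrightarrow> a \<le> b \<Longrightarrow> b \<le> c \<Longrightarrow> P b"
  shows "knuth_equiv (filter P w) (filter P w')"
proof -
  \<comment> \<open>\<open>?H\<close> is the convex hull of the letters of \<open>w\<close>
    satisfying \<open>P\<close>; on the letters of \<open>w\<close> it agrees with
    \<open>P\<close>.\<close>
  let ?H = "\<lambda>x. \<exists>a\<in>set w. \<exists>c\<in>set w. P a \<and> P c \<and> a \<le> x \<and> x \<le> c"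
  have *: "P x \<longleftrightarrow> ?H x" if "x \<in> set w" for x using that P by blast
  have "filter P w = filter ?H w" by (rule filter_cong[OF refl *])
  moreover have "filter P w' = filter ?H w'"
    by (rule filter_cong[OF refl *]) (simp add: knuth_equiv_set[OF assms(1)])
  moreover have "knuth_equiv (filter ?H w) (filter ?H w')"
    by (rule knuth_equiv_filter[OF assms(1)]) (meson order.trans)
  ultimately show ?thesis by simp
qed

definition lr_pairs ::
  "('a::linorder) tab \<Rightarrow> (nat \<Rightarrow> nat) \<Rightarrow> (nat \<Rightarrow> nat) \<Rightarrow>
     ('a tab \<times> 'a tab) set" where
  "lr_pairs V mu nu = {(U, T). tableau U \<and> fst U = mu \<and> tableau T \<and> fst T = nu \<and>
     ptab (tword U @ tword T) = V}"

text \<open>The recording tableaux of the words \<open>x @ y\<close> for which \<open>x\<close> and \<open>y\<close> have the recording tableaux \<open>M\<close>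
  and \<open>N\<close>.\<close>

definition recording :: "(nat \<Rightarrow> nat) \<Rightarrow> ('b::linorder) tab \<Rightarrow>
     'b tab \<Rightarrow> ('b tab) set" where
  "recording lam M N = {Q. tableau Q \<and> fst Q = lam \<and> mset (tword Q) = mset (tword M) + mset (tword N) \<and>
     ptab (filter (\<lambda>x. x \<in> set (tword M)) (tword Q)) = M \<and>
     ptab (filter (\<lambda>x. x \<in> set (tword N)) (tword Q)) = N}"

text \<open>\<open>W\<close> consists of the words with insertion tableau \<open>V\<close> whose two
  parts have the recording tableaux \<open>M\<close> and \<open>N\<close>. Such a word is determined
  by the recording tableau of the whole word, and equally by the insertion tableaux of its two
  parts; both maps are bijections by RSK.\<close>

lemma card_lr_pairs:
  fixes V :: "('a::linorder) tab" and M N :: "('b::linorder) tab"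
  assumes V: "tableau V" and M: "tableau M" and N: "tableau N"
    and dist: "distinct (tword M)" "distinct (tword N)"
    and lt: "\<And>x y. x \<in> set (tword M) \<Longrightarrow> y \<in> set (tword N) \<Longrightarrow> x < y"
  shows "card (lr_pairs V (fst M) (fst N)) = card (recording (fst V) M N)"
proof -
  define ls1 where "ls1 = sort (tword M)"
  define ls2 where "ls2 = sort (tword N)"
  have ms: "mset ls1 = mset (tword M)" "mset ls2 = mset (tword N)" by (simp_all add: ls1_def ls2_def)
  have st: "set ls1 = set (tword M)" "set ls2 = set (tword N)" by (simp_all add: ls1_def ls2_def)
  have s1: "sorted_wrt (<) ls1" and s2: "sorted_wrt (<) ls2"
    using dist by (simp_all add: ls1_def ls2_def strict_sorted_iff)
  then have s: "sorted_wrt (<) (ls1 @ ls2)" using lt st by (auto simp: sorted_wrt_append)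
  define W where "W = {w. length w = length (ls1 @ ls2) \<and> ptab w = V \<and>
     ptab (winv ls1 (take (length ls1) w)) = M \<and> ptab (winv ls2 (drop (length ls1) w)) = N}"
  have split: "w = take (length ls1) w @ drop (length ls1) w" "length (take (length ls1) w) = length ls1"
    "length (drop (length ls1) w) = length ls2" if "length w = length (ls1 @ ls2)" for w :: "'a list"
    using that by auto
  have fil: "filter (\<lambda>x. x \<in> set (tword M)) (winv (ls1 @ ls2) w) = winv ls1 (take (length ls1) w)"
    "filter (\<lambda>x. x \<in> set (tword N)) (winv (ls1 @ ls2) w) = winv ls2 (drop (length ls1) w)"
    if "length w = length (ls1 @ ls2)" for w :: "'a list"
    using filter_winv_append[OF s, of "take (length ls1) w" "drop (length ls1) w"] split[OF that] st by auto
  \<comment> \<open>All labels of \<open>M\<close> lie below those of \<open>N\<close>. Hence both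
    label sets are convex among the labels that occur, and restricting to either respects Knuth
    equivalence.\<close>
  have conv1: "x \<in> set (tword M)" if "x \<in> set (ls1 @ ls2)" "c \<in> set (tword M)" "x \<le> c" for x c
    using that lt st by force
  have conv2: "x \<in> set (tword N)" if "x \<in> set (ls1 @ ls2)" "c \<in> set (tword N)" "c \<le> x" for x c
    using that lt st by force
  have pfil: "ptab (filter (\<lambda>x. x \<in> set (tword M)) u) = ptab (filter (\<lambda>x. x \<in> set (tword M)) u')"
    "ptab (filter (\<lambda>x. x \<in> set (tword N)) u) = ptab (filter (\<lambda>x. x \<in> set (tword N)) u')"
    if "knuth_equiv u u'" "set u = set (ls1 @ ls2)" for u u'
    unfolding ptab_eq_iff
    by (rule knuth_equiv_filter_on[OF that(1)]; unfold that(2); meson conv1 conv2)+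
  have setw: "set (winv (ls1 @ ls2) w) = set (ls1 @ ls2)" if "length w = length (ls1 @ ls2)" for w :: "'a list"
    using mset_winv[of "ls1 @ ls2" w] that by (intro mset_eq_setD) simp
  have bij1: "bij_betw (\<lambda>w. ptab (winv (ls1 @ ls2) w)) W (recording (fst V) M N)"
    unfolding bij_betw_def
  proof
    show "inj_on (\<lambda>w. ptab (winv (ls1 @ ls2) w)) W"
      by (rule inj_onI) (auto simp: W_def intro: rsk_inj[OF s])
    show "(\<lambda>w. ptab (winv (ls1 @ ls2) w)) ` W = recording (fst V) M N"
    proof (intro equalityI subsetI)
      fix Q assume "Q \<in> (\<lambda>w. ptab (winv (ls1 @ ls2) w)) ` W"
      then obtain w where w: "w \<in> W" "Q = ptab (winv (ls1 @ ls2) w)" by blast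
      then have len: "length w = length (ls1 @ ls2)" by (simp add: W_def)
      have eq: "knuth_equiv (winv (ls1 @ ls2) w) (tword Q)" unfolding w(2) by (rule knuth_equiv_sym[OF knuth_equiv_ptab])
      have "fst Q = fst V" using fst_ptab_winv[OF s, of w] len w by (simp add: W_def)
      moreover have "mset (tword Q) = mset (tword M) + mset (tword N)"
        using knuth_equiv_mset[OF eq] mset_winv[of "ls1 @ ls2" w] len ms by simp
      ultimately show "Q \<in> recording (fst V) M N"
        using pfil[OF eq setw[OF len]] w fil[OF len] by (auto simp: recording_def W_def)
    next
      fix Q assume Q: "Q \<in> recording (fst V) M N"
      then have "mset (tword Q) = mset (ls1 @ ls2)" "tableau Q" "fst V = fst Q" using ms by (auto simp: recording_def)
      from rsk_surj[OF s V this(2,3,1)] obtain w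
        where w: "length w = length (ls1 @ ls2)" "ptab w = V" "ptab (winv (ls1 @ ls2) w) = Q" by blast
      have eq: "knuth_equiv (winv (ls1 @ ls2) w) (tword Q)" using w(3) knuth_equiv_sym[OF knuth_equiv_ptab] by blast
      have "ptab (filter (\<lambda>x. x \<in> set (tword M)) (tword Q)) = M" "ptab (filter (\<lambda>x. x \<in> set (tword N)) (tword Q)) = N"
        using Q unfolding recording_def by blast+
      then have "w \<in> W" using pfil[OF eq setw[OF w(1)]] unfolding W_def fil[OF w(1)] using w(1,2) by simp
      then show "Q \<in> (\<lambda>w. ptab (winv (ls1 @ ls2) w)) ` W" using w(3) by blast
    qed
  qed
  have bij2: "bij_betw (\<lambda>w. (ptab (take (length ls1) w), ptab (drop (length ls1) w))) W (lr_pairs V (fst M) (fst N))"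
    unfolding bij_betw_def
  proof
    show "inj_on (\<lambda>w. (ptab (take (length ls1) w), ptab (drop (length ls1) w))) W"
    proof (rule inj_onI)
      fix w w' assume w: "w \<in> W" "w' \<in> W" "(ptab (take (length ls1) w), ptab (drop (length ls1) w)) =
        (ptab (take (length ls1) w'), ptab (drop (length ls1) w'))"
      then have len: "length w = length (ls1 @ ls2)" "length w' = length (ls1 @ ls2)" by (auto simp: W_def)
      have "take (length ls1) w = take (length ls1) w'"
        using w len by (intro rsk_inj[OF s1]) (auto simp: W_def)
      moreover have "drop (length ls1) w = drop (length ls1) w'"
        using w len by (intro rsk_inj[OF s2]) (auto simp: W_def)
      ultimately show "w = w'" by (metis append_take_drop_id)
    qed
    show "(\<lambda>w. (ptab (take (length ls1) w), ptab (drop (length ls1) w))) ` W = lr_pairs V (fst M) (fst N)"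
    proof (intro equalityI subsetI)
      fix p assume "p \<in> (\<lambda>w. (ptab (take (length ls1) w), ptab (drop (length ls1) w))) ` W"
      then obtain w where w: "w \<in> W" "p = (ptab (take (length ls1) w), ptab (drop (length ls1) w))" by blast
      then have len: "length w = length (ls1 @ ls2)" by (simp add: W_def)
      have "fst (ptab (take (length ls1) w)) = fst M" "fst (ptab (drop (length ls1) w)) = fst N"
        using fst_ptab_winv[OF s1, of "take (length ls1) w"] fst_ptab_winv[OF s2, of "drop (length ls1) w"] len w(1)
        by (auto simp: W_def)
      then show "p \<in> lr_pairs V (fst M) (fst N)"
        using w ptab_append[of "take (length ls1) w" "drop (length ls1) w"] by (simp add: lr_pairs_def W_def)
    next
      fix p assume "p \<in> lr_pairs V (fst M) (fst N)"
      then obtain U T where p: "p = (U, T)" "tableau U" "tableau T" "fst U = fst M" "fst T = fst N"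
        "ptab (tword U @ tword T) = V" by (auto simp: lr_pairs_def)
      obtain x where x: "length x = length ls1" "ptab x = U" "ptab (winv ls1 x) = M"
        using rsk_surj[OF s1 p(2) M p(4)] ms by auto
      obtain y where y: "length y = length ls2" "ptab y = T" "ptab (winv ls2 y) = N"
        using rsk_surj[OF s2 p(3) N p(5)] ms by auto
      have "x @ y \<in> W" using x y p(6) ptab_append[of x y] by (simp add: W_def)
      then show "p \<in> (\<lambda>w. (ptab (take (length ls1) w), ptab (drop (length ls1) w))) ` W"
        using x y p(1) by (intro image_eqI[of _ _ "x @ y"]) simp_all
    qed
  qed
  show ?thesis using bij_betw_same_card[OF bij1] bij_betw_same_card[OF bij2] by simp
qed

section \<open>Recording tableaux as extensions of \<open>M\<close> by skew tableaux\<close>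

lemma skew_diagram_subset:
  assumes "is_skew lam mu"
  shows "diagram mu \<subseteq> diagram lam" "diagram lam = diagram mu \<union> skew_diagram lam mu"
    "diagram mu \<inter> skew_diagram lam mu = {}"
proof -
  show "diagram mu \<subseteq> diagram lam"
    using assms by (auto simp: is_skew_def mem_diagram) (meson le_trans)
  then show "diagram lam = diagram mu \<union> skew_diagram lam mu" "diagram mu \<inter> skew_diagram lam mu = {}"
    by (auto simp: skew_diagram_def)
qed

text \<open>The small labels of \<open>Q\<close> form a subtableau that equals its own rectification
  \<open>M\<close>, so they fill \<open>diagram mu\<close>; the rest is a skew tableau rectifying to
  \<open>N\<close>. Conversely, such a skew tableau can be glued to \<open>M\<close>, because every
  entry of \<open>M\<close> is smaller.\<close>

lemma card_recording:
  fixes M N :: "('b::linorder) tab"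
  assumes skew: "is_skew lam mu" and M: "tableau M" "fst M = mu" and N: "tableau N"
    and lt: "\<And>x y. x \<in> set (tword M) \<Longrightarrow> y \<in> set (tword N) \<Longrightarrow> x < y"
  shows "card (recording lam M N) =
    card {L \<in> ssyt (skew_diagram lam mu) UNIV. ptab (row_word (skew_diagram lam mu) L) = N}"
proof -
  let ?D = "skew_diagram lam mu" and ?A = "set (tword M)" and ?B = "set (tword N)"
  have fin: "finite ?D" "finite (diagram lam)" "finite (diagram mu)" and par: "is_partition lam" "is_partition mu"
    using skew by (auto simp: is_skew_def)
  note sub = skew_diagram_subset[OF skew]
  have disj: "?A \<inter> ?B = {}" using lt by blast
  have main: "{b \<in> diagram lam. snd Q b \<in> ?A} = diagram mu \<and> {b \<in> diagram lam. snd Q b \<in> ?B} = ?D \<and>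
      (\<forall>b\<in>diagram mu. snd Q b = snd M b)" if "Q \<in> recording lam M N" for Q
  proof -
    have Q: "tableau Q" "fst Q = lam" "mset (tword Q) = mset (tword M) + mset (tword N)"
      "ptab (filter (\<lambda>x. x \<in> ?A) (tword Q)) = M" using that by (auto simp: recording_def)
    have "set (tword Q) = set_mset (mset (tword Q))" by simp
    also have "\<dots> = ?A \<union> ?B" unfolding Q(3) by simp
    finally have st: "set (tword Q) = ?A \<union> ?B" .
    then have im: "snd Q ` diagram lam = ?A \<union> ?B" using fin by (simp add: Q(2) set_row_word)
    \<comment> \<open>\<open>tab_filter\<close> asks for a downward closed predicate; among the
      labels that occur, \<open>R\<close> only selects those of \<open>M\<close>.\<close>
    define R where "R = (\<lambda>x. \<exists>y\<in>?A. x \<le> y)"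
    have R: "R x" if "R y" "x \<le> y" for x y using that order.trans unfolding R_def by blast
    have RA: "R x \<longleftrightarrow> x \<in> ?A" if "x \<in> ?A \<union> ?B" for x
      using that lt unfolding R_def by (auto dest: leD)
    have "filter R (tword Q) = filter (\<lambda>x. x \<in> ?A) (tword Q)"
      by (rule filter_cong[OF refl RA]) (simp add: st)
    then have "tab_filter R Q = M" using ptab_filter[where R = R and w = "tword Q", OF R] Q(1,4) by simp
    then have "diagram mu = {b \<in> diagram lam. R (snd Q b)}" "snd M = restrict (snd Q) {b \<in> diagram lam. R (snd Q b)}"
      using diagram_tab_filter[where R = R, OF Q(1) R] snd_tab_filter[where R = R, OF Q(1) R] M(2) Q(2) by auto
    moreover have RA': "R (snd Q b) \<longleftrightarrow> snd Q b \<in> ?A" if "b \<in> diagram lam" for b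
      using that im by (intro RA) blast
    ultimately have *: "{b \<in> diagram lam. snd Q b \<in> ?A} = diagram mu" "\<forall>b\<in>diagram mu. snd Q b = snd M b"
      by auto
    have "{b \<in> diagram lam. snd Q b \<in> ?B} = diagram lam - {b \<in> diagram lam. snd Q b \<in> ?A}"
      using im disj by blast
    then show ?thesis using * by (simp add: skew_diagram_def)
  qed
  have "bij_betw (\<lambda>Q. restrict (snd Q) ?D) (recording lam M N)
    {L \<in> ssyt ?D UNIV. ptab (row_word ?D L) = N}"
    unfolding bij_betw_def
  proof
    show "inj_on (\<lambda>Q. restrict (snd Q) ?D) (recording lam M N)"
    proof (rule inj_onI)
      fix Q Q' assume *: "Q \<in> recording lam M N" "Q' \<in> recording lam M N" "restrict (snd Q) ?D = restrict (snd Q') ?D"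
      have "snd Q b = snd Q' b" for b
      proof (cases "b \<in> diagram lam")
        case True
        then consider "b \<in> diagram mu" | "b \<in> ?D" using sub by blast
        then show ?thesis using main[OF *(1)] main[OF *(2)] fun_cong[OF *(3), of b] by cases auto
      next
        case False
        moreover have "snd Q \<in> extensional (diagram lam)" "snd Q' \<in> extensional (diagram lam)"
          using *(1,2) by (auto simp: recording_def tableau_def ssyt_def fillings_def PiE_def)
        ultimately show ?thesis by (metis extensional_arb)
      qed
      then show "Q = Q'" using *(1,2) by (intro prod_eqI) (auto simp: recording_def)
    qed
    show "(\<lambda>Q. restrict (snd Q) ?D) ` recording lam M N = {L \<in> ssyt ?D UNIV. ptab (row_word ?D L) = N}"
    proof (intro equalityI subsetI)
      fix L assume "L \<in> (\<lambda>Q. restrict (snd Q) ?D) ` recording lam M N"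
      then obtain Q where Q: "Q \<in> recording lam M N" "L = restrict (snd Q) ?D" by blast
      then have t: "tableau Q" "fst Q = lam" "ptab (filter (\<lambda>x. x \<in> ?B) (tword Q)) = N" by (auto simp: recording_def)
      have "L \<in> ssyt ?D UNIV"
        using t ssyt_restrict[of "snd Q" "diagram lam" UNIV ?D] sub Q(2) by (auto simp: tableau_def)
      moreover have "row_word ?D L = filter (\<lambda>x. x \<in> ?B) (tword Q)"
      proof -
        have "row_word ?D L = row_word ?D (snd Q)" by (rule row_word_cong[OF fin(1)]) (simp add: Q(2))
        then show ?thesis unfolding t(2) filter_row_word[OF fin(2)] using main[OF Q(1)] by simp
      qed
      ultimately show "L \<in> {L \<in> ssyt ?D UNIV. ptab (row_word ?D L) = N}" using t(3) by auto
    next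
      fix L assume "L \<in> {L \<in> ssyt ?D UNIV. ptab (row_word ?D L) = N}"
      then have L: "L \<in> ssyt ?D UNIV" "ptab (row_word ?D L) = N" by auto
      have eq: "knuth_equiv (tword N) (row_word ?D L)" using L(2) knuth_equiv_ptab by blast
      have LB: "L ` ?D = ?B" using knuth_equiv_set[OF eq] by (simp add: set_row_word fin)
      have MA: "snd M ` diagram mu = ?A" using M by (simp add: set_row_word fin)
      define q where "q = (\<lambda>b\<in>diagram lam. if b \<in> diagram mu then snd M b else L b)"
      have q1: "q b = snd M b" if "b \<in> diagram mu" for b using that sub by (auto simp: q_def)
      have q2: "q b = L b" if "b \<in> ?D" for b using that sub by (auto simp: q_def)
      have qlt: "q b < q b'" if "b \<in> diagram mu" "b' \<in> ?D" for b b'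
        using that q1 q2 lt LB MA by (metis imageI)
      have Mss: "snd M \<in> ssyt (diagram mu) UNIV" using M by (auto simp: tableau_def)
      have down: "(i', j') \<in> diagram mu" if "(i, j) \<in> diagram mu" "(i', j') \<in> diagram lam" "i' \<le> i" "j' \<le> j" for i j i' j'
        using that by (intro diagram_downclosed[OF par(2) that(1)]) (auto simp: mem_diagram)
      have "q \<in> ssyt (diagram lam) UNIV"
        unfolding ssyt_def fillings_def
      proof (intro CollectI conjI allI impI)
        show "q \<in> diagram lam \<rightarrow>\<^sub>E UNIV" by (auto simp: q_def)
        fix i j j' :: nat assume *: "(i, j) \<in> diagram lam \<and> (i, j') \<in> diagram lam \<and> j < j'"
        show "q (i, j) \<le> q (i, j')"
        proof (cases "(i, j') \<in> diagram mu")
          case True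
          then have "(i, j) \<in> diagram mu" using * down by (meson less_imp_le order_refl)
          then show ?thesis using True Mss * q1 by (auto simp: ssyt_def)
        next
          case False
          then have D: "(i, j') \<in> ?D" using * sub by blast
          show ?thesis
          proof (cases "(i, j) \<in> diagram mu")
            case True then show ?thesis using D qlt less_imp_le by blast
          next
            case False
            then have "(i, j) \<in> ?D" using * sub by blast
            then show ?thesis using D L(1) * q2 by (auto simp: ssyt_def)
          qed
        qed
      next
        fix i i' j :: nat assume *: "(i, j) \<in> diagram lam \<and> (i', j) \<in> diagram lam \<and> i < i'"
        show "q (i, j) < q (i', j)"
        proof (cases "(i', j) \<in> diagram mu")
          case True
          then have "(i, j) \<in> diagram mu" using * down by (meson less_imp_le order_refl)
          then show ?thesis using True Mss * q1 by (auto simp: ssyt_def)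
        next
          case False
          then have D: "(i', j) \<in> ?D" using * sub by blast
          show ?thesis
          proof (cases "(i, j) \<in> diagram mu")
            case True then show ?thesis using D qlt by blast
          next
            case False
            then have "(i, j) \<in> ?D" using * sub by blast
            then show ?thesis using D L(1) * q2 by (auto simp: ssyt_def)
          qed
        qed
      qed
      then have tq: "tableau (lam, q)" using par by (simp add: tableau_def)
      have "image_mset q (mset_set (diagram lam)) = image_mset q (mset_set (diagram mu)) + image_mset q (mset_set ?D)"
        unfolding sub(2) by (subst mset_set_Union) (use fin sub(3) in auto)
      also have "image_mset q (mset_set (diagram mu)) = mset (tword M)"
        unfolding M(2) mset_row_word[OF fin(3)] by (rule image_mset_cong) (use fin q1 in simp)
      also have "image_mset q (mset_set ?D) = image_mset L (mset_set ?D)"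
        using fin q2 by (intro image_mset_cong) auto
      also have "\<dots> = mset (tword N)" using knuth_equiv_mset[OF eq] fin by (simp add: mset_row_word)
      finally have ms: "mset (tword (lam, q)) = mset (tword M) + mset (tword N)"
        using fin by (simp add: mset_row_word)
      have "{b \<in> diagram lam. q b \<in> ?A} = diagram mu" "{b \<in> diagram lam. q b \<in> ?B} = ?D"
      proof -
        have inA: "q b \<in> ?A" if "b \<in> diagram mu" for b using q1[OF that] MA that by blast
        have inB: "q b \<in> ?B" if "b \<in> ?D" for b using q2[OF that] LB that by blast
        show "{b \<in> diagram lam. q b \<in> ?A} = diagram mu" "{b \<in> diagram lam. q b \<in> ?B} = ?D"
          using sub(2) inA inB disj by blast+
      qed
      then have "filter (\<lambda>x. x \<in> ?A) (tword (lam, q)) = tword M" "filter (\<lambda>x. x \<in> ?B) (tword (lam, q)) = row_word ?D L"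
        using fin M(2) q1 q2 by (auto simp: filter_row_word intro: row_word_cong)
      then have "(lam, q) \<in> recording lam M N" using tq ms L(2) ptab_tword[OF M(1)] by (simp add: recording_def)
      moreover have "L = restrict q ?D"
        using L(1) q2 by (auto simp: ssyt_def fillings_def PiE_def extensional_def fun_eq_iff restrict_def)
      ultimately show "L \<in> (\<lambda>Q. restrict (snd Q) ?D) ` recording lam M N"
        by (intro image_eqI[of _ _ "(lam, q)"]) simp_all
    qed
  qed
  then show ?thesis by (rule bij_betw_same_card)
qed

lemma labelled_tableau_exists:
  assumes "is_partition mu"
  obtains M where "tableau M" "fst M = mu" "distinct (tword M)" "\<And>x. x \<in> set (tword M) \<Longrightarrow> lab_val x = c"
proof -
  \<comment> \<open>\<open>?C\<close> exceeds every column index, so row-by-row numbering with this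
    width increases along rows and columns and determines the box.\<close>
  let ?C = "Suc (mu 1)"
  define m where "m = (\<lambda>b\<in>diagram mu. Lab c (fst b * ?C + snd b))"
  have fin: "finite (diagram mu)" using assms by simp
  have bound: "j < ?C" if "(i, j) \<in> diagram mu" for i j
    using that partition_antimono[OF assms, of 1 i] by (auto simp: mem_diagram)
  have t: "tableau (mu, m)"
  proof (rule tableauI[OF assms])
    show "m \<in> extensional (diagram mu)" by (simp add: m_def)
    fix i j :: nat assume "(i, Suc j) \<in> diagram mu" "1 \<le> j"
    moreover have "(i, j) \<in> diagram mu" using calculation by (simp add: mem_diagram)
    ultimately show "m (i, j) \<le> m (i, Suc j)" by (simp add: m_def less_eq_lab_def)
  next
    fix i j :: nat assume *: "(Suc i, j) \<in> diagram mu" "1 \<le> i"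
    moreover have "(i, j) \<in> diagram mu"
      by (rule diagram_downclosed[OF assms *(1) *(2)]) (use * in \<open>simp_all add: mem_diagram\<close>)
    ultimately show "m (i, j) < m (Suc i, j)" by (simp add: m_def less_lab_def)
  qed
  have "inj_on m (diagram mu)"
  proof (rule inj_onI)
    fix x y assume xy: "x \<in> diagram mu" "y \<in> diagram mu" "m x = m y"
    then have e: "fst x * ?C + snd x = fst y * ?C + snd y" by (simp add: m_def)
    have b: "snd x < ?C" "snd y < ?C" using xy bound[of "fst x" "snd x"] bound[of "fst y" "snd y"] by auto
    have "(fst x * ?C + snd x) div ?C = fst x" "(fst y * ?C + snd y) div ?C = fst y"
      using b by (simp_all del: mult_Suc_right)
    then have "fst x = fst y" using e by metis
    then show "x = y" using e by (simp add: prod_eq_iff)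
  qed
  then have "distinct (tword (mu, m))" using fin by (simp add: distinct_row_word)
  moreover have "lab_val x = c" if "x \<in> set (tword (mu, m))" for x
    using that fin by (auto simp: set_row_word m_def)
  ultimately show ?thesis using t by (intro that[of "(mu, m)"]) auto
qed

text \<open>For one fixed choice of \<open>M\<close> and \<open>N\<close>, both numbers are the
  cardinality of the same \<open>recording\<close> set. The values 0 and 1 place all of
  \<open>M\<close> before \<open>N\<close>.\<close>

lemma card_lr_pairs_cong:
  fixes V V' :: "('a::linorder) tab"
  assumes "tableau V" "tableau V'" "fst V = fst V'" "is_partition mu" "is_partition nu"
  shows "card (lr_pairs V mu nu) = card (lr_pairs V' mu nu)"
proof -
  obtain M where M: "tableau M" "fst M = mu" "distinct (tword M)" "\<And>x. x \<in> set (tword M) \<Longrightarrow> lab_val x = 0"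
    using labelled_tableau_exists[OF assms(4)] by metis
  obtain N where N: "tableau N" "fst N = nu" "distinct (tword N)" "\<And>x. x \<in> set (tword N) \<Longrightarrow> lab_val x = 1"
    using labelled_tableau_exists[OF assms(5)] by metis
  have lt: "x < y" if "x \<in> set (tword M)" "y \<in> set (tword N)" for x y
    using M(4)[OF that(1)] N(4)[OF that(2)] by (simp add: less_lab_def)
  show ?thesis
    using card_lr_pairs[OF assms(1) M(1) N(1) M(3) N(3) lt] card_lr_pairs[OF assms(2) M(1) N(1) M(3) N(3) lt]
    using assms(3) M(2) N(2) by simp
qed

text \<open>Transports a fibre of rectification to tableaux with distinct entries, to which
  \<open>card_recording\<close> applies. For surjectivity, Knuth moves keep a word labelled, so
  \<open>S\<close> is the labelling of its own values.\<close>

lemma bij_betw_phi_T: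
  fixes T :: "nat tab"
  assumes fin: "finite D" and T: "tableau T" and pos: "\<And>x. x \<in> set (tword T) \<Longrightarrow> 1 \<le> x"
  shows "bij_betw (phi_T D) {L \<in> SSYT D. ptab (row_word D L) = T}
     {S \<in> ssyt D UNIV. ptab (row_word D S) = ptab (labw (tword T))}"
  unfolding bij_betw_def
proof
  show "inj_on (phi_T D) {L \<in> SSYT D. ptab (row_word D L) = T}"
  proof (rule inj_onI)
    fix L L' assume "L \<in> {L \<in> SSYT D. ptab (row_word D L) = T}" "L' \<in> {L \<in> SSYT D. ptab (row_word D L) = T}"
      "phi_T D L = phi_T D L'"
    then have *: "L \<in> D \<rightarrow>\<^sub>E {1..}" "L' \<in> D \<rightarrow>\<^sub>E {1..}" "phi_T D L = phi_T D L'"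
      by (simp_all add: ssyt_def fillings_def)
    have "L b = L' b" if "b \<in> D" for b
      using lab_val_phi_T[OF that, of L] lab_val_phi_T[OF that, of L'] *(3) by simp
    then show "L = L'" by (rule PiE_ext[OF *(1,2)])
  qed
  show "phi_T D ` {L \<in> SSYT D. ptab (row_word D L) = T} = {S \<in> ssyt D UNIV. ptab (row_word D S) = ptab (labw (tword T))}"
  proof (intro equalityI subsetI)
    fix S assume "S \<in> phi_T D ` {L \<in> SSYT D. ptab (row_word D L) = T}"
    then obtain L where L: "L \<in> SSYT D" "ptab (row_word D L) = T" "S = phi_T D L" by blast
    have "knuth_equiv (row_word D L) (tword T)" using L(2) knuth_equiv_ptab knuth_equiv_sym by blast
    then have "ptab (row_word D S) = ptab (labw (tword T))"
      unfolding ptab_eq_iff L(3) row_word_phi_T[OF fin] by (rule knuth_equiv_labw)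
    then show "S \<in> {S \<in> ssyt D UNIV. ptab (row_word D S) = ptab (labw (tword T))}"
      using ssyt_phi_T[OF fin L(1)] L(3) by simp
  next
    fix S assume "S \<in> {S \<in> ssyt D UNIV. ptab (row_word D S) = ptab (labw (tword T))}"
    then have S: "S \<in> ssyt D UNIV" "knuth_equiv (labw (tword T)) (row_word D S)"
      by (auto simp: ptab_eq_iff knuth_equiv_sym)
    have il: "is_labw (row_word D S)" "knuth_equiv (tword T) (map lab_val (row_word D S))"
      using is_labw_knuth_equiv[OF S(2)] by auto
    define L where "L = (\<lambda>b\<in>D. lab_val (S b))"
    have LS: "L \<in> ssyt D UNIV" unfolding L_def by (rule ssyt_lab_val[OF fin S(1) il(1)])
    have w: "row_word D L = map lab_val (row_word D S)" unfolding L_def by (rule row_word_lab_val[OF fin])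
    have "ptab (row_word D L) = T" using il(2) T unfolding w by (intro ptab_eqI) auto
    moreover have "L \<in> SSYT D"
    proof -
      have "L ` D = set (tword T)" using knuth_equiv_set[OF il(2)] set_row_word[OF fin, of L] w by simp
      then have "1 \<le> L b" if "b \<in> D" for b using pos that by blast
      then show ?thesis using LS by (auto simp: ssyt_def fillings_def PiE_def)
    qed
    moreover have "phi_T D L = S"
    proof
      have "row_word D (phi_T D L) = row_word D S"
        unfolding row_word_phi_T[OF fin] w using il(1) by (simp add: is_labw_def)
      then have *: "phi_T D L b = S b" if "b \<in> D" for b using that fin by (simp add: row_word_boxes)
      fix b show "phi_T D L b = S b"
      proof (cases "b \<in> D")
        case False
        moreover have "S \<in> extensional D" "phi_T D L \<in> extensional D"
          using S(1) by (auto simp: ssyt_def fillings_def PiE_def phi_T_def)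
        ultimately show ?thesis by (metis extensional_arb)
      qed (rule *)
    qed
    ultimately show "S \<in> phi_T D ` {L \<in> SSYT D. ptab (row_word D L) = T}" by blast
  qed
qed

theorem card_rect_fibre:
  fixes T :: "nat tab" and V :: "('a::linorder) tab"
  assumes skew: "is_skew lam mu" and T: "tableau T" and pos: "\<And>x. x \<in> set (tword T) \<Longrightarrow> 1 \<le> x"
    and V: "tableau V" "fst V = lam"
  shows "card {L \<in> SSYT (skew_diagram lam mu). rect (skew_diagram lam mu) L = T} =
    card (lr_pairs V mu (fst T))"
proof -
  let ?D = "skew_diagram lam mu"
  have fin: "finite ?D" and mu: "is_partition mu" using skew by (auto simp: is_skew_def)
  define N where "N = ptab (labw (tword T))"
  have N: "tableau N" "knuth_equiv (labw (tword T)) (tword N)"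
    by (auto simp: N_def knuth_equiv_sym knuth_equiv_ptab)
  have "fst T = fst (tab_val N)" unfolding N_def ptab_labw[symmetric] using T by simp
  then have shN: "fst N = fst T" by (simp add: tab_val_def)
  \<comment> \<open>The value 0 does not occur in \<open>T\<close>, so all labels of
    \<open>M\<close> precede those of the labelled \<open>T\<close>.\<close>
  obtain M where M: "tableau M" "fst M = mu" "distinct (tword M)" "\<And>x. x \<in> set (tword M) \<Longrightarrow> lab_val x = 0"
    using labelled_tableau_exists[OF mu] by metis
  have "distinct xs" if "labels_sorted xs" for xs
    using that by (induction xs) auto
  then have dN: "distinct (tword N)" using sorted_labf knuth_equiv_distinct[OF N(2)] by blast
  have lt: "x < y" if "x \<in> set (tword M)" "y \<in> set (tword N)" for x y
  proof -
    have "y \<in> set (labw (tword T))" using that(2) knuth_equiv_set[OF N(2)] by simp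
    then have "lab_val y \<in> set (map lab_val (labw (tword T)))" by (simp del: map_lab_val_labf)
    then have "1 \<le> lab_val y" using pos by simp
    then show ?thesis using M(4)[OF that(1)] by (simp add: less_lab_def)
  qed
  have "card (lr_pairs V mu (fst T)) = card (recording lam M N)"
    using card_lr_pairs[OF V(1) M(1) N(1) M(3) dN lt] M(2) shN V(2) by simp
  also have "\<dots> = card {L \<in> ssyt ?D UNIV. ptab (row_word ?D L) = N}"
    by (rule card_recording[OF skew M(1,2) N(1) lt])
  also have "\<dots> = card {L \<in> SSYT ?D. ptab (row_word ?D L) = T}"
    unfolding N_def by (rule bij_betw_same_card[OF bij_betw_phi_T[OF fin T pos], symmetric])
  finally show ?thesis by (simp add: rect_ptab)
qed

section \<open>Littlewood--Richardson coefficients\<close>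

text \<open>The highest weight tableau of shape \<open>l\<close>, whose content is \<open>l\<close>
  itself.\<close>

definition superstd :: "(nat \<Rightarrow> nat) \<Rightarrow> nat \<times> nat \<Rightarrow> nat" where
  "superstd l = (\<lambda>b\<in>diagram l. fst b)"

definition tabs :: "(nat \<Rightarrow> nat) \<Rightarrow> nat multiset \<Rightarrow> (nat \<times> nat \<Rightarrow> nat) set" where
  "tabs l A = {M \<in> SSYT (diagram l). mset (row_word (diagram l) M) = A}"

lemma schur_tabs: "is_partition l \<Longrightarrow> schur l A = int (card (tabs l A))"
  by (simp add: schur_def tabs_def mset_row_word)

lemma SSYT_ssyt: "M \<in> SSYT D \<longleftrightarrow> M \<in> ssyt D UNIV \<and> (\<forall>b\<in>D. 1 \<le> M b)"
  by (auto simp: ssyt_def fillings_def PiE_def Pi_def)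

lemmas SSYT_ssyt' = SSYT_ssyt[unfolded One_nat_def]

lemma superstd_SSYT: "superstd l \<in> SSYT (diagram l)"
  by (auto simp: superstd_def ssyt_def fillings_def mem_diagram)

lemma tableau_superstd: "is_partition l \<Longrightarrow> tableau (l, superstd l)"
  using superstd_SSYT[of l] by (simp add: tableau_def SSYT_ssyt')

lemma finite_tabs:
  assumes "is_partition l" shows "finite (tabs l A)"
proof (rule finite_subset)
  show "tabs l A \<subseteq> diagram l \<rightarrow>\<^sub>E set_mset A"
  proof
    fix M assume "M \<in> tabs l A"
    then have "M \<in> diagram l \<rightarrow>\<^sub>E {1..}" "M ` diagram l = set_mset A"
      using set_row_word[of "diagram l" M] assms by (auto simp: tabs_def ssyt_def fillings_def)
    then show "M \<in> diagram l \<rightarrow>\<^sub>E set_mset A" by (auto simp: PiE_def Pi_def)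
  qed
  show "finite (diagram l \<rightarrow>\<^sub>E set_mset A)" using assms by (intro finite_PiE) auto
qed

lemma finite_submultisets: "finite {B. B \<subseteq># (A :: 'a multiset)}"
proof (rule finite_subset)
  show "{B. B \<subseteq># A} \<subseteq> mset ` {xs. set xs \<subseteq> set_mset A \<and> length xs \<le> size A}"
  proof
    fix B assume "B \<in> {B. B \<subseteq># A}"
    moreover obtain xs where "mset xs = B" using ex_mset by blast
    ultimately show "B \<in> mset ` {xs. set xs \<subseteq> set_mset A \<and> length xs \<le> size A}"
      by (intro image_eqI[of _ _ xs]) (use set_mset_mono[of B A] size_mset_mono[of B A] in auto)
  qed
  show "finite (mset ` {xs. set xs \<subseteq> set_mset A \<and> length xs \<le> size A})"
    by (intro finite_imageI finite_lists_length_le) simp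
qed

lemma partition_bounds:
  assumes "is_partition l" "(i, j) \<in> diagram l" shows "i \<le> card (diagram l)" "j \<le> card (diagram l)"
proof -
  have ij: "1 \<le> i" "1 \<le> j" using assms(2) by (auto simp: mem_diagram)
  have sub: "{1..i} \<times> {1} \<subseteq> diagram l" "{1} \<times> {1..j} \<subseteq> diagram l"
    using diagram_downclosed[OF assms] ij by auto
  have "card ({1..i} \<times> {1::nat}) \<le> card (diagram l)" "card ({1::nat} \<times> {1..j}) \<le> card (diagram l)"
    by (rule card_mono[OF finite_diagram[OF assms(1)] sub(1)] card_mono[OF finite_diagram[OF assms(1)] sub(2)])+
  then show "i \<le> card (diagram l)" "j \<le> card (diagram l)" by (simp_all add: card_cartesian_product)
qed

lemma finite_partitions: "finite {l. is_partition l \<and> card (diagram l) = n}"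
proof (rule finite_imageD)
  have "diagram ` {l. is_partition l \<and> card (diagram l) = n} \<subseteq> Pow ({..n} \<times> {..n})"
    using partition_bounds by auto
  then show "finite (diagram ` {l. is_partition l \<and> card (diagram l) = n})" by (rule finite_subset) simp
  show "inj_on diagram {l. is_partition l \<and> card (diagram l) = n}"
    by (rule inj_onI) (auto intro: diagram_inj)
qed

text \<open>\<open>superstd lam\<close> is merely a representative of its shape, see
  \<open>lrc_tableau\<close>.\<close>

definition lrc :: "(nat \<Rightarrow> nat) \<Rightarrow> (nat \<Rightarrow> nat) \<Rightarrow> (nat \<Rightarrow> nat) \<Rightarrow> int" where
  "lrc mu nu lam = (if is_partition lam then int (card (lr_pairs (lam, superstd lam) mu nu)) else 0)"

lemma lrc_tableau:
  fixes V :: "nat tab"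
  assumes "is_partition mu" "is_partition nu" "tableau V"
  shows "int (card (lr_pairs V mu nu)) = lrc mu nu (fst V)"
proof -
  have "is_partition (fst V)" using assms(3) by (simp add: tableau_def)
  then show ?thesis
    using card_lr_pairs_cong[of V "(fst V, superstd (fst V))", OF assms(3) tableau_superstd _ assms(1,2)]
    by (simp add: lrc_def)
qed

lemma lrc_size:
  assumes "lrc mu nu lam \<noteq> 0"
  shows "is_partition lam" "card (diagram lam) = card (diagram mu) + card (diagram nu)"
proof -
  show "is_partition lam" using assms by (auto simp: lrc_def split: if_splits)
  have "lr_pairs (lam, superstd lam) mu nu \<noteq> {}" using assms by (auto simp: lrc_def split: if_splits)
  then obtain U T where UT: "tableau U" "fst U = mu" "tableau T" "fst T = nu" "ptab (tword U @ tword T) = (lam, superstd lam)"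
    by (auto simp: lr_pairs_def)
  have "card (diagram lam) = length (tword U @ tword T)" using card_ptab[of "tword U @ tword T"] UT(5) by simp
  then show "card (diagram lam) = card (diagram mu) + card (diagram nu)"
    using UT(1-4) by (auto simp: length_row_word tableau_def)
qed

lemma finite_lrc: "finite {lam. lrc mu nu lam \<noteq> 0}"
  by (rule finite_subset[OF _ finite_partitions[of "card (diagram mu) + card (diagram nu)"]])
     (auto dest: lrc_size)

text \<open>Pairs of tableaux with joint content \<open>A\<close> are grouped by their product
  \<open>V\<close> in the plactic monoid. The size of a group depends only on the shape of
  \<open>V\<close>, so the tableaux \<open>V\<close> of one shape add up to a multiple of its Schur
  function.\<close>

lemma series_mult_schur:
  assumes mu: "is_partition mu" and nu: "is_partition nu"
  shows "series_mult (schur mu) (schur nu) A = (\<Sum>lam | lrc mu nu lam \<noteq> 0. lrc mu nu lam * schur lam A)"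
proof -
  define P where "P = (\<Union>B\<in>{B. B \<subseteq># A}. tabs mu B \<times> tabs nu (A - B))"
  define g where "g = (\<lambda>(U, T). ptab (row_word (diagram mu) U @ row_word (diagram nu) (T :: nat \<times> nat \<Rightarrow> nat)))"
  define VA where "VA = (SIGMA l:{l. is_partition l \<and> card (diagram l) = size A}. tabs l A)"
  have finP: "finite P" unfolding P_def
    by (intro finite_UN_I finite_submultisets finite_cartesian_product finite_tabs mu nu)
  have finV: "finite VA" unfolding VA_def
    by (intro finite_SigmaI finite_partitions) (auto intro: finite_tabs)
  have P: "(U, T) \<in> P \<longleftrightarrow> U \<in> SSYT (diagram mu) \<and> T \<in> SSYT (diagram nu) \<and>
      mset (row_word (diagram mu) U) + mset (row_word (diagram nu) T) = A" for U T
    unfolding P_def tabs_def by auto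
  have V: "V \<in> VA \<longleftrightarrow> tableau V \<and> mset (tword V) = A \<and> (\<forall>x\<in>#A. 1 \<le> x)" for V
  proof -
    obtain l M where V: "V = (l, M)" by fastforce
    have e0: "card (diagram l) = size A" "(\<forall>b\<in>diagram l. 1 \<le> M b) \<longleftrightarrow> (\<forall>x\<in>#A. 1 \<le> x)"
      if "is_partition l" "mset (row_word (diagram l) M) = A"
    proof -
      have "size A = card (diagram l)" unfolding that(2)[symmetric] using that(1) by (simp add: length_row_word)
      moreover have "set_mset A = M ` diagram l" unfolding that(2)[symmetric] using that(1) by (simp add: set_row_word)
      ultimately show "card (diagram l) = size A" "(\<forall>b\<in>diagram l. 1 \<le> M b) \<longleftrightarrow> (\<forall>x\<in>#A. 1 \<le> x)"
        by simp_all
    qed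
    have e1: "is_partition l \<and> card (diagram l) = size A \<and> M \<in> ssyt (diagram l) UNIV \<and>
        (\<forall>b\<in>diagram l. 1 \<le> M b) \<and> mset (row_word (diagram l) M) = A \<longleftrightarrow>
      is_partition l \<and> M \<in> ssyt (diagram l) UNIV \<and> mset (row_word (diagram l) M) = A \<and> (\<forall>x\<in>#A. 1 \<le> x)"
    proof (cases "is_partition l \<and> mset (row_word (diagram l) M) = A")
      case True
      then show ?thesis using e0 by metis
    next
      case False
      then show ?thesis by metis
    qed
    have e2: "(l, M) \<in> VA \<longleftrightarrow> is_partition l \<and> card (diagram l) = size A \<and> M \<in> ssyt (diagram l) UNIV \<and>
        (\<forall>b\<in>diagram l. 1 \<le> M b) \<and> mset (row_word (diagram l) M) = A"
      unfolding VA_def tabs_def mem_Sigma_iff mem_Collect_eq SSYT_ssyt conj_assoc ..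
    show ?thesis using trans[OF e2 e1] unfolding V tableau_def fst_conv snd_conv conj_assoc .
  qed
  have "series_mult (schur mu) (schur nu) A = (\<Sum>B | B \<subseteq># A. int (card (tabs mu B \<times> tabs nu (A - B))))"
    by (simp add: series_mult_def schur_tabs mu nu card_cartesian_product)
  also have "\<dots> = int (card P)"
  proof -
    have "card P = (\<Sum>B | B \<subseteq># A. card (tabs mu B \<times> tabs nu (A - B)))"
      unfolding P_def
    proof (rule card_UN_disjoint[OF finite_submultisets])
      show "\<forall>B\<in>{B. B \<subseteq># A}. finite (tabs mu B \<times> tabs nu (A - B))"
        by (simp add: finite_tabs mu nu)
      have "tabs mu B \<inter> tabs mu B' = {}" if "B \<noteq> B'" for B B'
        using that unfolding tabs_def by blast
      then have "(tabs mu B \<times> tabs nu (A - B)) \<inter> (tabs mu B' \<times> tabs nu (A - B')) = {}" if "B \<noteq> B'" for B B'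
        unfolding Times_Int_Times using that by (metis Sigma_empty1)
      then show "\<forall>B\<in>{B. B \<subseteq># A}. \<forall>B'\<in>{B. B \<subseteq># A}. B \<noteq> B' \<longrightarrow>
          (tabs mu B \<times> tabs nu (A - B)) \<inter> (tabs mu B' \<times> tabs nu (A - B')) = {}"
        by (intro ballI impI)
    qed
    then have "int (card P) = int (\<Sum>B | B \<subseteq># A. card (tabs mu B \<times> tabs nu (A - B)))"
      by (rule arg_cong)
    also have "\<dots> = (\<Sum>B | B \<subseteq># A. int (card (tabs mu B \<times> tabs nu (A - B))))"
      by (rule of_nat_sum)
    finally show ?thesis by (rule sym)
  qed
  also have "\<dots> = (\<Sum>p\<in>P. 1)" by simp
  also have "\<dots> = (\<Sum>V\<in>VA. \<Sum>p\<in>{p\<in>P. g p = V}. 1)"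
  proof (rule sum.group[symmetric, OF finP finV])
    show "g ` P \<subseteq> VA"
    proof (rule image_subsetI)
      fix p assume "p \<in> P"
      moreover obtain U T where p: "p = (U, T)" by fastforce
      ultimately have UT: "(U, T) \<in> P" by simp
      let ?w = "row_word (diagram mu) U @ row_word (diagram nu) T"
      have w: "mset ?w = A" using UT P by simp
      have "1 \<le> x" if "x \<in> set ?w" for x using that UT mu nu by (auto simp: P SSYT_ssyt' set_row_word)
      then have "\<forall>x\<in>#A. 1 \<le> x" unfolding w[symmetric] by simp
      then show "g p \<in> VA" unfolding V g_def p using knuth_equiv_mset[OF knuth_equiv_ptab[of ?w]] w by simp
    qed
  qed
  also have "\<dots> = (\<Sum>V\<in>VA. lrc mu nu (fst V))"
  proof (rule sum.cong[OF refl])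
    fix V assume "V \<in> VA"
    then have VV: "tableau V" "mset (tword V) = A" "\<forall>x\<in>#A. 1 \<le> x" using V by auto
    have "bij_betw (\<lambda>(U, T). ((mu, U), (nu, T))) {p\<in>P. g p = V} (lr_pairs V mu nu)"
      unfolding bij_betw_def
    proof
      show "inj_on (\<lambda>(U, T). ((mu, U), (nu, T))) {p\<in>P. g p = V}" by (auto simp: inj_on_def)
      show "(\<lambda>(U, T). ((mu, U), (nu, T))) ` {p\<in>P. g p = V} = lr_pairs V mu nu"
      proof (intro equalityI subsetI)
        fix q assume "q \<in> (\<lambda>(U, T). ((mu, U), (nu, T))) ` {p\<in>P. g p = V}"
        then obtain U T where "(U, T) \<in> P" "g (U, T) = V" "q = ((mu, U), (nu, T))" by auto
        then show "q \<in> lr_pairs V mu nu"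
          using mu nu by (simp add: lr_pairs_def g_def P tableau_def SSYT_ssyt')
      next
        fix q assume "q \<in> lr_pairs V mu nu"
        then obtain U T where q: "q = ((mu, U), (nu, T))" "tableau (mu, U)" "tableau (nu, T)" "g (U, T) = V"
          by (auto simp: lr_pairs_def g_def)
        let ?w = "row_word (diagram mu) U @ row_word (diagram nu) T"
        have "mset ?w = A" using knuth_equiv_mset[OF knuth_equiv_ptab[of ?w]] q(4) VV(2) by (simp add: g_def)
        moreover from this have "\<forall>x\<in>set ?w. 1 \<le> x" using VV(3) by (metis set_mset_mset)
        ultimately have "(U, T) \<in> P" using q(2,3) mu nu by (auto simp: P SSYT_ssyt' tableau_def set_row_word)
        then show "q \<in> (\<lambda>(U, T). ((mu, U), (nu, T))) ` {p\<in>P. g p = V}" using q by force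
      qed
    qed
    then show "(\<Sum>p\<in>{p\<in>P. g p = V}. 1) = lrc mu nu (fst V)"
      using lrc_tableau[OF mu nu VV(1)] by (simp add: bij_betw_same_card)
  qed
  also have "\<dots> = (\<Sum>l | is_partition l \<and> card (diagram l) = size A. \<Sum>M\<in>tabs l A. lrc mu nu l)"
    unfolding VA_def by (subst sum.Sigma) (auto simp: finite_partitions finite_tabs split_beta)
  also have "\<dots> = (\<Sum>l | is_partition l \<and> card (diagram l) = size A. lrc mu nu l * schur l A)"
    by (rule sum.cong) (auto simp: schur_tabs)
  \<comment> \<open>Shapes whose size differs from \<open>size A\<close> carry no tableau of content
    \<open>A\<close>, and shapes with coefficient 0 contribute nothing.\<close>
  also have "\<dots> = (\<Sum>lam | lrc mu nu lam \<noteq> 0. lrc mu nu lam * schur lam A)"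
  proof (rule sum.mono_neutral_cong[OF finite_lrc finite_partitions])
    fix l assume l: "l \<in> {lam. lrc mu nu lam \<noteq> 0} - {l. is_partition l \<and> card (diagram l) = size A}"
    then have par: "is_partition l" "card (diagram l) \<noteq> size A" by (auto dest: lrc_size)
    have "tabs l A = {}"
      using par by (auto simp: tabs_def) (metis finite_diagram length_row_word size_mset)
    then show "lrc mu nu l * schur l A = 0" by (simp add: schur_tabs par)
  qed auto
  finally show ?thesis .
qed

section \<open>Dominance order and linear independence of Schur functions\<close>

lemma SSYT_row_le:
  assumes "is_partition l" "M \<in> SSYT (diagram l)" "(i, j) \<in> diagram l"
  shows "i \<le> M (i, j)"
  using assms(3)
proof (induction i)
  case (Suc i)
  show ?case
  proof (cases "i = 0")
    case True
    then show ?thesis using assms(2) Suc.prems by (auto simp: SSYT_ssyt')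
  next
    case False
    then have "(i, j) \<in> diagram l"
      by (intro diagram_downclosed[OF assms(1) Suc.prems]) (use Suc.prems in \<open>auto simp: mem_diagram\<close>)
    then have "i \<le> M (i, j)" "M (i, j) < M (Suc i, j)" using Suc assms(2) by (auto simp: SSYT_ssyt' ssyt_def)
    then show ?thesis by simp
  qed
qed simp

text \<open>In a tableau of shape \<open>m\<close> the entries at most \<open>k\<close> lie in the
  first \<open>k\<close> rows, and the content of \<open>superstd l\<close> prescribes their number
  as the sum of the first \<open>k\<close> parts of \<open>l\<close>.\<close>

lemma dominance:
  assumes "is_partition l" "is_partition m" "schur m (mset (row_word (diagram l) (superstd l))) \<noteq> 0"
  shows "(\<Sum>i=1..k. l i) \<le> (\<Sum>i=1..k. m i)"
proof -
  obtain M where M: "M \<in> SSYT (diagram m)" "mset (row_word (diagram m) M) = mset (row_word (diagram l) (superstd l))"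
    using assms by (force simp: schur_tabs tabs_def card_eq_0_iff)
  have count: "card {b\<in>D. L b \<le> k} = size (filter_mset (\<lambda>x. x \<le> k) (mset (row_word D L)))" if "finite D" for D and L :: "nat \<times> nat \<Rightarrow> nat"
  proof -
    have "size (filter_mset (\<lambda>x. x \<le> k) (mset (row_word D L))) = length (filter (\<lambda>x. x \<le> k) (row_word D L))"
      by (simp flip: mset_filter)
    then show ?thesis using that by (simp add: filter_row_word length_row_word)
  qed
  have "(\<Sum>i=1..k. l i) = card {b\<in>diagram l. superstd l b \<le> k}"
    unfolding card_diagram_rows[symmetric] by (rule arg_cong[of _ _ card]) (auto simp: superstd_def)
  also have "\<dots> = card {b\<in>diagram m. M b \<le> k}" using count[of "diagram l" "superstd l"] count[of "diagram m" M] assms M by simp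
  also have "\<dots> \<le> card {b\<in>diagram m. fst b \<le> k}"
  proof (rule card_mono)
    show "{b\<in>diagram m. M b \<le> k} \<subseteq> {b\<in>diagram m. fst b \<le> k}"
      using SSYT_row_le[OF assms(2) M(1)] by (auto intro: le_trans[rotated])
  qed (use assms in simp)
  finally show ?thesis by (simp add: card_diagram_rows)
qed

lemma schur_superstd_pos: "is_partition l \<Longrightarrow> schur l (mset (row_word (diagram l) (superstd l))) > 0"
  using finite_tabs[of l] superstd_SSYT[of l] by (auto simp: schur_tabs tabs_def card_gt_0_iff)

text \<open>Kostka triangularity: at the content of \<open>superstd l\<close> for \<open>l\<close> maximal in dominance order, only
  \<open>schur l\<close> contributes.\<close>

lemma schur_independent:
  assumes fin: "finite C" and par: "\<And>l. l \<in> C \<Longrightarrow> is_partition l"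
    and zero: "\<And>A. (\<Sum>l\<in>C. d l * schur l A) = 0" and "l \<in> C"
  shows "d l = 0"
proof (rule ccontr)
  assume "d l \<noteq> 0"
  define C' where "C' = {l\<in>C. d l \<noteq> 0}"
  have C': "finite C'" "C' \<noteq> {}" using fin \<open>l \<in> C\<close> \<open>d l \<noteq> 0\<close> by (auto simp: C'_def)
  \<comment> \<open>\<open>K\<close> bounds the number of rows of all shapes in \<open>C\<close>.
    Hence \<open>f\<close>, the sum of the partial sums up to \<open>K\<close>, is strictly
    increasing for dominance on \<open>C\<close>, and a maximum of \<open>f\<close> is a maximal
    shape.\<close>
  define K where "K = (\<Sum>l\<in>C. card (diagram l))"
  define f where "f l = (\<Sum>k=1..K. \<Sum>i=1..k. l i)" for l :: "nat \<Rightarrow> nat"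
  have "Max (f ` C') \<in> f ` C'" using C' by (intro Max_in) auto
  then obtain m where m: "m \<in> C'" "f m = Max (f ` C')" by auto
  then have m: "m \<in> C'" "\<And>l. l \<in> C' \<Longrightarrow> f l \<le> f m" using C' by auto
  then have mC: "m \<in> C" "is_partition m" "d m \<noteq> 0" using par by (auto simp: C'_def)
  let ?A = "mset (row_word (diagram m) (superstd m))"
  have other: "d l * schur l ?A = 0" if "l \<in> C - {m}" for l
  proof (rule ccontr)
    assume *: "d l * schur l ?A \<noteq> 0"
    then have l: "l \<in> C'" "is_partition l" "l \<noteq> m" using that par by (auto simp: C'_def)
    have le: "(\<Sum>i=1..k. m i) \<le> (\<Sum>i=1..k. l i)" for k
      using dominance[OF mC(2) l(2)] * by auto
    then have "f m \<le> f l" unfolding f_def by (rule sum_mono)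
    then have "f m = f l" using m(2)[OF l(1)] by simp
    then have eqK: "(\<Sum>i=1..k. m i) = (\<Sum>i=1..k. l i)" if "k \<in> {1..K}" for k
      using sum_mono_inv[of "\<lambda>k. \<Sum>i=1..k. m i" "{1..K}" "\<lambda>k. \<Sum>i=1..k. l i" k] le that \<open>f m = f l\<close>
      unfolding f_def by blast
    have big: "l' i = 0" if "l' \<in> C" "K < i" for l' i
    proof (rule ccontr)
      assume "l' i \<noteq> 0"
      then have "(i, 1) \<in> diagram l'" using that by (auto simp: mem_diagram)
      then have "i \<le> card (diagram l')" using partition_bounds(1) par that by blast
      also have "\<dots> \<le> K" unfolding K_def using that fin by (intro member_le_sum) auto
      finally show False using that by simp
    qed
    have "m i = l i" for i
    proof -
      consider "i = 0" | "K < i" | k where "i = Suc k" "Suc k \<le> K" by (cases i) (auto simp: not_le[symmetric])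
      then show ?thesis
      proof cases
        case 1 then show ?thesis using partition_0[OF mC(2)] partition_0[OF l(2)] by simp
      next
        case 2 then show ?thesis using big[of m i] big[of l i] mC(1) l(1) unfolding C'_def by auto
      next
        case 3
        have "(\<Sum>i=1..k. m i) = (\<Sum>i=1..k. l i)" using eqK[of k] 3 by (cases k) auto
        then show ?thesis using eqK[of "Suc k"] 3 by simp
      qed
    qed
    then show False using l(3) by auto
  qed
  have "(\<Sum>l\<in>C. d l * schur l ?A) = d m * schur m ?A + (\<Sum>l\<in>C - {m}. d l * schur l ?A)"
    using fin mC by (simp add: sum.remove)
  also have "(\<Sum>l\<in>C - {m}. d l * schur l ?A) = 0" using other by (intro sum.neutral) blast
  finally have "d m * schur m ?A = 0" using zero by simp
  then show False using mC schur_superstd_pos[OF mC(2)] by simp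
qed

text \<open>Two expansions of the product are compared on the union of their finite supports, where
  the Schur functions are linearly independent.\<close>

theorem lr_coeff_eq:
  assumes "is_partition mu" "is_partition nu"
  shows "lr_coeff mu nu = lrc mu nu"
  unfolding lr_coeff_def
proof (rule the_equality)
  show "finite {lam. lrc mu nu lam \<noteq> 0} \<and> {lam. lrc mu nu lam \<noteq> 0} \<subseteq> {lam. is_partition lam} \<and>
     (\<forall>A. series_mult (schur mu) (schur nu) A = (\<Sum>lam | lrc mu nu lam \<noteq> 0. lrc mu nu lam * schur lam A))"
    using finite_lrc series_mult_schur[OF assms] lrc_size by auto
next
  fix c assume c: "finite {lam. c lam \<noteq> 0} \<and> {lam. c lam \<noteq> 0} \<subseteq> {lam. is_partition lam} \<and>
     (\<forall>A. series_mult (schur mu) (schur nu) A = (\<Sum>lam | c lam \<noteq> 0. c lam * schur lam A))"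
  let ?C = "{lam. c lam \<noteq> 0} \<union> {lam. lrc mu nu lam \<noteq> 0}"
  have fin: "finite ?C" using c finite_lrc by simp
  have "c l - lrc mu nu l = 0" if "l \<in> ?C" for l
  proof (rule schur_independent[OF fin _ _ that])
    show "is_partition l" if "l \<in> ?C" for l using that c lrc_size by auto
    fix A
    have "(\<Sum>l\<in>?C. c l * schur l A) = (\<Sum>lam | c lam \<noteq> 0. c lam * schur lam A)"
      using fin by (intro sum.mono_neutral_right) auto
    moreover have "(\<Sum>l\<in>?C. lrc mu nu l * schur l A) = (\<Sum>lam | lrc mu nu lam \<noteq> 0. lrc mu nu lam * schur lam A)"
      using fin by (intro sum.mono_neutral_right) auto
    ultimately show "(\<Sum>l\<in>?C. (c l - lrc mu nu l) * schur l A) = 0"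
      using c series_mult_schur[OF assms, of A] by (simp add: left_diff_distrib sum_subtractf)
  qed
  then have "c l = lrc mu nu l" for l by (cases "l \<in> ?C") auto
  then show "c = lrc mu nu" by blast
qed

section \<open>The right arm\<close>

lemma ssyt_subset: "M \<in> ssyt D X \<Longrightarrow> E \<subseteq> D \<Longrightarrow> restrict M E \<in> ssyt E UNIV"
  using ssyt_restrict[of M D UNIV E] unfolding ssyt_def fillings_def by (auto simp: PiE_def)

lemma ptab_row1_le_card: "fst (ptab w) 1 \<le> length w"
proof -
  have "fst (ptab w) 1 = card {j. (1, j) \<in> diagram (fst (ptab w))}" by (rule diagram_row_card[symmetric]) simp
  also have "\<dots> = card (Pair (1::nat) ` {j. (1, j) \<in> diagram (fst (ptab w))})"
    by (rule card_image[symmetric]) (auto simp: inj_on_def)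
  also have "\<dots> \<le> card (diagram (fst (ptab w)))" by (rule card_mono) auto
  finally show ?thesis by (simp add: card_ptab)
qed

lemma ptab_row1: "fst (ptab w) 1 = greene 1 w"
  using greene_tword[OF tableau_ptab[of w], of 1] knuth_equiv_greene[OF knuth_equiv_ptab[of w], of 1]
  by (simp add: card_diagram_rows)

lemma greene_1_le_columns:
  assumes "finite D" "M \<in> ssyt D UNIV" shows "greene 1 (row_word D M) \<le> card (snd ` D)"
proof -
  define e where "e j = (SOME b. b \<in> D \<and> snd b = j)" for j
  have e: "e j \<in> D \<and> snd (e j) = j" if "j \<in> snd ` D" for j
    unfolding e_def by (rule someI_ex) (use that in auto)
  have "greene 1 (row_word D M) \<le> card (e ` snd ` D)"
  proof (rule greene_row_word_le[OF assms])
    show "e ` snd ` D \<subseteq> D" using e by blast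
  next
    fix j assume c: "card {b \<in> D. snd b = j} \<le> 1"
    show "{b \<in> D. snd b = j} \<subseteq> e ` snd ` D"
    proof
      fix b assume b: "b \<in> {b \<in> D. snd b = j}"
      then have "j \<in> snd ` D" by auto
      then have "e j \<in> {b \<in> D. snd b = j}" using e by auto
      moreover have "finite {b \<in> D. snd b = j}" using assms(1) by simp
      ultimately have "e j = b" using c b card_le_Suc0_iff_eq[of "{b \<in> D. snd b = j}"] unfolding One_nat_def by blast
      then show "b \<in> e ` snd ` D" using \<open>j \<in> snd ` D\<close> by blast
    qed
  next
    fix j assume "card {b \<in> D. snd b = j} > 1"
    then have "{b \<in> D. snd b = j} \<noteq> {}" by (intro notI) simp
    then have "j \<in> snd ` D" by force
    then have "e j \<in> {b \<in> e ` snd ` D. snd b = j}" using e by auto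
    moreover have "finite {b \<in> e ` snd ` D. snd b = j}" using assms(1) by simp
    ultimately have "0 < card {b \<in> e ` snd ` D. snd b = j}" unfolding card_gt_0_iff by blast
    then show "1 \<le> card {b \<in> e ` snd ` D. snd b = j}" by simp
  qed
  also have "\<dots> \<le> card (snd ` D)" by (rule card_image_le) (use assms in simp)
  finally show ?thesis .
qed

text \<open>The minimum in \<open>arm_start\<close> combines two bounds for the first row of the
  tableau of the lower rows: it is at most \<open>lam 2\<close>, by columns, and at most the number
  of boxes. From that position on, the letters of the first row of \<open>M\<close> end up at the
  end of the first row of \<open>P\<close>, so an arm entry keeps its distance
  \<open>lam 1 - j\<close> from the end.\<close>

lemma right_arm_position:
  fixes M :: "nat \<times> nat \<Rightarrow> 'a::linorder"
  assumes skew: "is_skew lam mu" and M: "M \<in> ssyt (skew_diagram lam mu) UNIV"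
    and j: "(1, j) \<in> skew_diagram lam mu" "arm_start lam mu \<le> j"
  defines "P \<equiv> ptab (row_word (skew_diagram lam mu) M)"
  shows "(1, fst P 1 - (lam 1 - j)) \<in> diagram (fst P)"
    and "snd P (1, fst P 1 - (lam 1 - j)) = M (1, j)"
proof -
  let ?D = "skew_diagram lam mu"
  have par: "is_partition lam" "is_partition mu" and fin: "finite ?D" using skew by (auto simp: is_skew_def)
  have mem: "(i, k) \<in> ?D \<longleftrightarrow> 1 \<le> i \<and> mu i < k \<and> k \<le> lam i" for i k
    by (auto simp: skew_diagram_def mem_diagram)
  define D2 where "D2 = {b\<in>?D. fst b \<noteq> 1}"
  define y where "y = map (\<lambda>k. M (1, k)) [Suc (mu 1)..<Suc (lam 1)]"
  define x where "x = row_word D2 M"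
  have fin2: "finite D2" using fin by (simp add: D2_def)
  have w: "row_word ?D M = x @ y"
  proof -
    have "boxes ?D = boxes D2 @ map (Pair 1) [Suc (mu 1)..<Suc (lam 1)]"
    proof (rule boxes_eqI[OF fin])
      have "sorted_wrt read_lt (map (Pair (1::nat)) [Suc (mu 1)..<Suc (lam 1)])"
        unfolding sorted_wrt_map by (rule sorted_wrt_mono_rel[OF _ sorted_wrt_upt]) (simp add: read_lt_def)
      then show "sorted_wrt read_lt (boxes D2 @ map (Pair 1) [Suc (mu 1)..<Suc (lam 1)])"
        using sorted_boxes fin2
        by (simp add: sorted_wrt_append del: upt_Suc) (auto simp: read_lt_def D2_def mem)
      show "set (boxes D2 @ map (Pair 1) [Suc (mu 1)..<Suc (lam 1)]) = ?D"
        using fin2 by (auto simp: D2_def mem simp del: upt_Suc)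
    qed
    then show ?thesis by (simp add: row_word_boxes x_def y_def del: upt_Suc)
  qed
  have jb: "mu 1 < j" "j \<le> lam 1" using j(1) mem by auto
  \<comment> \<open>The position, counted from 1, of \<open>M (1, j)\<close> in the word
    \<open>y\<close> of the first row.\<close>
  define p where "p = j - mu 1"
  have m: "min (lam 2) (\<Sum>i | 2 \<le> i \<and> lam i \<noteq> 0. lam i - mu i) \<le> p"
    using j(2) by (simp add: arm_start_def p_def)
  have D2s: "D2 = Sigma {i. 2 \<le> i \<and> lam i \<noteq> 0} (\<lambda>i. {Suc (mu i)..lam i})"
    by (auto simp: D2_def mem)
  have "fst (ptab x) 1 \<le> p"
  proof (cases "lam 2 \<le> p")
    case True
    have "restrict M D2 \<in> ssyt D2 UNIV" by (rule ssyt_subset[OF M]) (simp add: D2_def)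
    from greene_1_le_columns[OF fin2 this] have "greene 1 (row_word D2 (restrict M D2)) \<le> card (snd ` D2)" .
    moreover have "row_word D2 (restrict M D2) = x" unfolding x_def by (rule row_word_cong[OF fin2]) simp
    moreover have "snd ` D2 \<subseteq> {1..lam 2}"
      using partition_antimono[OF par(1), of 2] unfolding D2s by (fastforce intro: order.trans)
    then have "card (snd ` D2) \<le> lam 2" using card_mono[of "{1..lam 2}" "snd ` D2"] by simp
    ultimately have "greene 1 x \<le> lam 2" by simp
    then show ?thesis unfolding ptab_row1 using True by (rule order.trans)
  next
    case False
    then have "(\<Sum>i | 2 \<le> i \<and> lam i \<noteq> 0. lam i - mu i) \<le> p" using m by simp
    moreover have "finite {i. 2 \<le> i \<and> lam i \<noteq> 0}" using par(1) by (simp add: is_partition_def)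
    then have "card D2 = (\<Sum>i | 2 \<le> i \<and> lam i \<noteq> 0. lam i - mu i)" unfolding D2s by (subst card_SigmaI) auto
    ultimately show ?thesis using ptab_row1_le_card[of x] fin2 by (simp add: x_def length_row_word)
  qed
  obtain T where T: "ltab T" "of_ltab T = ptab x" using tableau_ptab by (rule of_ltab_surj)
  have lenT: "length (hdrow T) \<le> p"
  proof -
    have "fst (ptab x) 1 = lens T 0" unfolding T(2)[symmetric] fst_of_ltab by simp
    also have "\<dots> = length (hdrow T)" by (cases T) auto
    finally show ?thesis using \<open>fst (ptab x) 1 \<le> p\<close> by simp
  qed
  have leny: "length y = lam 1 - mu 1" by (simp add: y_def del: upt_Suc)
  have "sorted y"
    unfolding y_def sorted_map
  proof (rule sorted_wrt_mono_rel[OF _ sorted_wrt_upt])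
    fix a b assume ab: "a \<in> set [Suc (mu 1)..<Suc (lam 1)]" "b \<in> set [Suc (mu 1)..<Suc (lam 1)]" "a < b"
    then have "(1, a) \<in> ?D" "(1, b) \<in> ?D" by (auto simp: mem)
    then show "M (1, a) \<le> M (1, b)" using M ab(3) by (auto simp: ssyt_def)
  qed
  then have "sorted (take p y @ drop p y)" by simp
  moreover have ne: "take p y \<noteq> []" using jb leny by (auto simp: p_def)
  moreover have "length (hdrow T) \<le> length (take p y)" using lenT jb leny by (simp add: p_def)
  ultimately obtain A where A: "hdrow (ins_word T y) = A @ last (take p y) # drop p y"
    using hdrow_ins_word_append[OF T(1)] by fastforce
  have lt: "ltab (ins_word T y)" using T(1) by (rule ltab_ins_word)
  have Pof: "P = of_ltab (ins_word T y)"
    unfolding P_def w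
  proof (rule ptab_eqI)
    show "tableau (of_ltab (ins_word T y))" using lt by (rule tableau_of_ltab)
    have "concat (rev T) = tword (ptab x)" using tword_of_ltab[OF T(1)] T(2) by simp
    then have "knuth_equiv (concat (rev T) @ y) (x @ y)" by (simp add: knuth_equiv_append knuth_equiv_ptab)
    then show "knuth_equiv (tword (of_ltab (ins_word T y))) (x @ y)"
      using knuth_equiv_ins_word[OF T(1), of y] tword_of_ltab[OF lt] by (metis knuth_equiv_sym knuth_equiv_trans)
  qed
  obtain rs where rs: "ins_word T y = (A @ last (take p y) # drop p y) # rs"
    using A by (cases "ins_word T y") auto
  have P1: "fst P 1 = Suc (length A) + (lam 1 - j)"
    unfolding Pof fst_of_ltab rs using leny jb by (simp add: p_def)
  then have col: "fst P 1 - (lam 1 - j) = Suc (length A)" by simp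
  show in_diag: "(1, fst P 1 - (lam 1 - j)) \<in> diagram (fst P)" unfolding col using P1 by (simp add: mem_diagram)
  have "snd P (1, Suc (length A)) = last (take p y)"
    using snd_of_ltab[of 1 "Suc (length A)" "ins_word T y"] in_diag[unfolded col] unfolding Pof rs by simp
  also have "\<dots> = y ! (p - 1)"
    using jb leny last_conv_nth[OF ne] by (simp add: last_conv_nth p_def min_absorb2)
  also have "\<dots> = M (1, j)" using jb unfolding y_def p_def by (subst nth_map) (auto simp del: upt_Suc)
  finally show "snd P (1, fst P 1 - (lam 1 - j)) = M (1, j)" unfolding col .
qed

section \<open>Transposition\<close>

text \<open>Each letter of the column is smaller than the one before it, which stands at the head of
  the remaining row and so lets it pass through \<open>r\<close> by
  \<open>knuth_equiv_row_small\<close>.\<close>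

lemma knuth_equiv_column_pass:
  assumes "sorted (c # r)" "sorted_wrt (>) (c # ds)"
  shows "knuth_equiv (c # r @ ds) (c # ds @ r)"
  using assms
proof (induction ds arbitrary: c)
  case (Cons d ds)
  have "knuth_equiv ((c # r @ [d]) @ ds) ((c # d # r) @ ds)"
    using Cons.prems by (intro knuth_equiv_append knuth_equiv_row_small) auto
  moreover have "knuth_equiv (d # r @ ds) (d # ds @ r)"
    using Cons.prems by (intro Cons.IH) (auto intro: order.trans less_imp_le)
  then have "knuth_equiv (c # d # r @ ds) (c # d # ds @ r)" by (rule knuth_equiv_Cons)
  ultimately show ?case by (simp add: knuth_equiv_trans)
qed simp

lemma knuth_equiv_first_column:
  assumes "sorted_wrt (\<lambda>i i'. C i > C i') is" "\<And>i. i \<in> set is \<Longrightarrow> sorted (C i # R i)"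
  shows "knuth_equiv (concat (map (\<lambda>i. C i # R i) is)) (map C is @ concat (map R is))"
  using assms
proof (induction "is")
  case (Cons i "is")
  have "knuth_equiv ((C i # R i) @ concat (map (\<lambda>i. C i # R i) is)) ((C i # R i) @ (map C is @ concat (map R is)))"
    using Cons by (intro knuth_equiv_append) auto
  also have "(C i # R i) @ (map C is @ concat (map R is)) = (C i # R i @ map C is) @ concat (map R is)" by simp
  also have "knuth_equiv \<dots> ((C i # map C is @ R i) @ concat (map R is))"
    using Cons.prems by (intro knuth_equiv_append knuth_equiv_column_pass) (auto simp: sorted_wrt_map)
  finally show ?case by simp
qed simp

definition transp_tab :: "'a tab \<Rightarrow> 'a tab" where
  "transp_tab P = (conj_partition (fst P), \<lambda>b\<in>diagram (conj_partition (fst P)). snd P (prod.swap b))"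

lemma conj_skew:
  assumes "is_skew lam mu"
  shows "is_skew (conj_partition lam) (conj_partition mu)"
    and "(i, j) \<in> skew_diagram (conj_partition lam) (conj_partition mu) \<longleftrightarrow> (j, i) \<in> skew_diagram lam mu"
proof -
  have par: "is_partition lam" "is_partition mu" using assms by (auto simp: is_skew_def)
  have "conj_partition mu i \<le> conj_partition lam i" for i
  proof (cases "i = 0 \<or> conj_partition mu i = 0")
    case True
    then show ?thesis by (auto simp: conj_partition_def)
  next
    case False
    then have "(i, conj_partition mu i) \<in> diagram (conj_partition mu)" by (auto simp: mem_diagram)
    then have "(conj_partition mu i, i) \<in> diagram lam"
      using skew_diagram_subset(1)[OF assms] mem_diagram_conj[OF par(2)] by blast
    then have "(i, conj_partition mu i) \<in> diagram (conj_partition lam)" using mem_diagram_conj[OF par(1)] by blast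
    then show ?thesis by (simp add: mem_diagram)
  qed
  then show "is_skew (conj_partition lam) (conj_partition mu)" using par by (simp add: is_skew_def partition_conj)
  show "(i, j) \<in> skew_diagram (conj_partition lam) (conj_partition mu) \<longleftrightarrow> (j, i) \<in> skew_diagram lam mu"
    using mem_diagram_conj[OF par(1)] mem_diagram_conj[OF par(2)] by (auto simp: skew_diagram_def)
qed

lemma boxes_rows:
  assumes "finite E" "\<And>i j. (i, j) \<in> E \<Longrightarrow> 1 \<le> i \<and> i \<le> n"
  shows "boxes E = concat (map (\<lambda>i. map (Pair i) (sorted_list_of_set {j. (i, j) \<in> E})) (rev [1..<Suc n]))"
proof (rule boxes_eqI[OF assms(1)])
  show "sorted_wrt read_lt (concat (map (\<lambda>i. map (Pair i) (sorted_list_of_set {j. (i, j) \<in> E})) (rev [1..<Suc n])))"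
    by (rule sorted_wrt_rows) (simp add: sorted_wrt_rev del: upt_Suc)
  show "set (concat (map (\<lambda>i. map (Pair i) (sorted_list_of_set {j. (i, j) \<in> E})) (rev [1..<Suc n]))) = E"
    using assms by (fastforce simp: finite_row simp del: upt_Suc)
qed

text \<open>The columns are moved to the front of the row word one after the other.\<close>

lemma row_word_columns:
  fixes M :: "nat \<times> nat \<Rightarrow> 'a::linorder"
  assumes skew: "is_skew lam mu" and M: "M \<in> ssyt (skew_diagram lam mu) UNIV"
  defines "D \<equiv> skew_diagram lam mu"
  defines "rws c \<equiv> rev [Suc (conj_partition mu c)..<Suc (conj_partition lam c)]"
  shows "knuth_equiv (row_word D M)
    (concat (map (\<lambda>c. map (\<lambda>i. M (i, c)) (rws c)) [1..<Suc c]) @ row_word {b\<in>D. c < snd b} M)"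
proof (induction c)
  case 0
  have "{b\<in>D. 0 < snd b} = D" by (auto simp: D_def skew_diagram_def mem_diagram)
  then show ?case by simp
next
  case (Suc c)
  let ?E = "\<lambda>c. {b\<in>D. c < snd b}"
  define i1 where "i1 = conj_partition mu (Suc c)"
  define i2 where "i2 = conj_partition lam (Suc c)"
  have par: "is_partition lam" "is_partition mu" using skew by (auto simp: is_skew_def)
  have fin: "finite D" using skew by (simp add: D_def)
  have le: "i1 \<le> i2" using conj_skew(1)[OF skew] by (simp add: is_skew_def i1_def i2_def)
  have lam: "(i, Suc c) \<in> diagram lam \<longleftrightarrow> 1 \<le> i \<and> i \<le> i2" for i
    unfolding mem_diagram_conj[OF par(1), symmetric] by (simp add: mem_diagram i2_def)
  have mu: "(i, Suc c) \<in> diagram mu \<longleftrightarrow> 1 \<le> i \<and> i \<le> i1" for i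
    unfolding mem_diagram_conj[OF par(2), symmetric] by (simp add: mem_diagram i1_def)
  have colD: "(i, Suc c) \<in> D \<longleftrightarrow> i1 < i \<and> i \<le> i2" for i
    unfolding D_def skew_diagram_def using lam[of i] mu[of i] by auto
  have rowsE: "1 \<le> i \<and> i \<le> i2" if "(i, j) \<in> D" "c < j" for i j
  proof -
    have "(i, Suc c) \<in> diagram lam"
      using that diagram_downclosed[OF par(1), of i j i "Suc c"] by (auto simp: D_def skew_diagram_def mem_diagram)
    then show ?thesis using lam by blast
  qed
  define R where "R i = map (\<lambda>j. M (i, j)) (sorted_list_of_set {j. (i, j) \<in> ?E (Suc c)})" for i
  \<comment> \<open>The rows after \<open>i1\<close> contain a box in column \<open>Suc c\<close>;
    in the rows up to \<open>i1\<close> this column belongs to \<open>mu\<close>, so nothing is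
    taken from them.\<close>
  have split: "rev [1..<Suc i2] = rev [Suc i1..<Suc i2] @ rev [1..<Suc i1]"
    using le upt_add_eq_append[of 1 "Suc i1" "i2 - i1"] by (simp del: upt_Suc)
  have finE: "finite (?E c)" "finite (?E (Suc c))" using fin by auto
  have w2: "row_word (?E (Suc c)) M = concat (map R (rev [Suc i1..<Suc i2])) @ concat (map R (rev [1..<Suc i1]))"
  proof -
    have "boxes (?E (Suc c)) = concat (map (\<lambda>i. map (Pair i) (sorted_list_of_set {j. (i, j) \<in> ?E (Suc c)})) (rev [1..<Suc i2]))"
      by (rule boxes_rows[OF finE(2)]) (use rowsE in \<open>simp, meson Suc_lessD\<close>)
    then have "row_word (?E (Suc c)) M = concat (map R (rev [1..<Suc i2]))"
      by (simp add: row_word_boxes map_concat o_def R_def[abs_def] del: upt_Suc)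
    then show ?thesis unfolding split by simp
  qed
  have row1: "sorted_list_of_set {j. (i, j) \<in> ?E c} = Suc c # sorted_list_of_set {j. (i, j) \<in> ?E (Suc c)}"
    if "i1 < i" "i \<le> i2" for i
  proof -
    have "{j. (i, j) \<in> ?E c} = insert (Suc c) {j. (i, j) \<in> ?E (Suc c)}"
      using colD[of i] that by (auto intro: Suc_lessI)
    moreover have "finite {j. (i, j) \<in> ?E (Suc c)}" by (rule finite_row[OF finE(2)])
    ultimately show ?thesis
      by (subst sorted_list_of_set.idem_if_sorted_distinct[symmetric, of "Suc c # sorted_list_of_set {j. (i, j) \<in> ?E (Suc c)}"])
         auto
  qed
  have row2: "{j. (i, j) \<in> ?E c} = {j. (i, j) \<in> ?E (Suc c)}" if "i \<le> i1" for i
  proof -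
    have "Suc c < x" if "(i, x) \<in> D" "c < x" for x using that colD[of i] \<open>i \<le> i1\<close> by (cases "x = Suc c") auto
    then show ?thesis by auto
  qed
  have w1: "row_word (?E c) M = concat (map (\<lambda>i. M (i, Suc c) # R i) (rev [Suc i1..<Suc i2])) @ concat (map R (rev [1..<Suc i1]))"
  proof -
    let ?r = "\<lambda>i. map (\<lambda>j. M (i, j)) (sorted_list_of_set {j. (i, j) \<in> ?E c})"
    have "boxes (?E c) = concat (map (\<lambda>i. map (Pair i) (sorted_list_of_set {j. (i, j) \<in> ?E c})) (rev [1..<Suc i2]))"
      by (rule boxes_rows[OF finE(1)]) (use rowsE in \<open>simp, meson Suc_lessD\<close>)
    then have "row_word (?E c) M = concat (map ?r (rev [1..<Suc i2]))"
      by (simp add: row_word_boxes map_concat o_def del: upt_Suc)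
    also have "\<dots> = concat (map ?r (rev [Suc i1..<Suc i2])) @ concat (map ?r (rev [1..<Suc i1]))"
      unfolding split by simp
    also have "map ?r (rev [Suc i1..<Suc i2]) = map (\<lambda>i. M (i, Suc c) # R i) (rev [Suc i1..<Suc i2])"
    proof (rule map_cong[OF refl])
      fix i assume "i \<in> set (rev [Suc i1..<Suc i2])"
      then have "i1 < i" "i \<le> i2" by auto
      then show "?r i = M (i, Suc c) # R i" unfolding row1[OF \<open>i1 < i\<close> \<open>i \<le> i2\<close>] R_def by simp
    qed
    also have "map ?r (rev [1..<Suc i1]) = map R (rev [1..<Suc i1])"
      by (rule map_cong[OF refl]) (simp only: R_def, subst row2, auto)
    finally show ?thesis .
  qed
  have "knuth_equiv (concat (map (\<lambda>i. M (i, Suc c) # R i) (rev [Suc i1..<Suc i2])))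
     (map (\<lambda>i. M (i, Suc c)) (rev [Suc i1..<Suc i2]) @ concat (map R (rev [Suc i1..<Suc i2])))"
  proof (rule knuth_equiv_first_column)
    have "sorted_wrt (\<lambda>i i'. M (i, Suc c) < M (i', Suc c)) [Suc i1..<Suc i2]"
    proof (rule sorted_wrt_mono_rel[OF _ sorted_wrt_upt])
      fix a b assume ab: "a \<in> set [Suc i1..<Suc i2]" "b \<in> set [Suc i1..<Suc i2]" "a < b"
      then have "(a, Suc c) \<in> D" "(b, Suc c) \<in> D" by (auto simp: colD)
      then show "M (a, Suc c) < M (b, Suc c)" using M ab(3) by (auto simp: ssyt_def D_def)
    qed
    then show "sorted_wrt (\<lambda>i i'. M (i, Suc c) > M (i', Suc c)) (rev [Suc i1..<Suc i2])"
      by (simp add: sorted_wrt_rev del: upt_Suc)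
    fix i assume "i \<in> set (rev [Suc i1..<Suc i2])"
    then have i: "i1 < i" "i \<le> i2" by auto
    have "M (i, Suc c) # R i = map (\<lambda>j. M (i, j)) (sorted_list_of_set {j. (i, j) \<in> ?E c})"
      by (simp add: row1[OF i] R_def del: mem_Collect_eq)
    moreover have "sorted (map (\<lambda>j. M (i, j)) (sorted_list_of_set {j. (i, j) \<in> ?E c}))"
      unfolding sorted_map
    proof (rule sorted_wrt_mono_rel[OF _ strict_sorted_list_of_set])
      fix a b assume "a \<in> set (sorted_list_of_set {j. (i, j) \<in> ?E c})" "b \<in> set (sorted_list_of_set {j. (i, j) \<in> ?E c})" "a < b"
      then show "M (i, a) \<le> M (i, b)" using M finite_row[OF finE(1)] by (auto simp: ssyt_def D_def)
    qed
    ultimately show "sorted (M (i, Suc c) # R i)" by simp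
  qed
  then have "knuth_equiv (row_word (?E c) M) (map (\<lambda>i. M (i, Suc c)) (rev [Suc i1..<Suc i2]) @ row_word (?E (Suc c)) M)"
    unfolding w1 w2 append_assoc[symmetric] by (rule knuth_equiv_append) simp
  then have "knuth_equiv (concat (map (\<lambda>c. map (\<lambda>i. M (i, c)) (rws c)) [1..<Suc c]) @ row_word (?E c) M)
     (concat (map (\<lambda>c. map (\<lambda>i. M (i, c)) (rws c)) [1..<Suc c]) @
       (map (\<lambda>i. M (i, Suc c)) (rws (Suc c)) @ row_word (?E (Suc c)) M))"
    unfolding rws_def i1_def i2_def by (intro knuth_equiv_append) simp_all
  from knuth_equiv_trans[OF Suc.IH this] show ?case
    by (simp only: upt_Suc_append[of 1 "Suc c", OF le_add1[of 1 c, unfolded plus_1_eq_Suc]]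
        map_append concat_append list.map concat.simps append_assoc append_Nil append_Nil2)
qed

text \<open>The column word read backwards is the row word of the transposed filling, and
  \<open>row_word_columns\<close> reaches the full column word at \<open>lam 1\<close>. Distinctness
  permits the reversal.\<close>

lemma rev_row_word_transpose:
  fixes M :: "nat \<times> nat \<Rightarrow> 'a::linorder"
  assumes skew: "is_skew lam mu" and M: "M \<in> ssyt (skew_diagram lam mu) UNIV" and inj: "inj_on M (skew_diagram lam mu)"
  shows "knuth_equiv (rev (row_word (skew_diagram lam mu) M))
    (row_word (skew_diagram (conj_partition lam) (conj_partition mu)) (\<lambda>b. M (prod.swap b)))"
proof -
  let ?D = "skew_diagram lam mu" and ?D' = "skew_diagram (conj_partition lam) (conj_partition mu)"
  let ?rws = "\<lambda>c. rev [Suc (conj_partition mu c)..<Suc (conj_partition lam c)]"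
  have par: "is_partition lam" "is_partition mu" and fin: "finite ?D" using skew by (auto simp: is_skew_def)
  note cs = conj_skew[OF skew]
  have fin': "finite ?D'" using cs(1) by simp
  define cb where "cb = concat (map (\<lambda>c. map (\<lambda>i. (c, i)) [Suc (conj_partition mu c)..<Suc (conj_partition lam c)]) (rev [1..<Suc (lam 1)]))"
  have mem: "(c, i) \<in> ?D' \<longleftrightarrow> 1 \<le> c \<and> conj_partition mu c < i \<and> i \<le> conj_partition lam c" for c i
    by (auto simp: skew_diagram_def mem_diagram)
  have lam1: "c \<le> lam 1" if "(c, i) \<in> ?D'" for c i
  proof -
    have "(i, c) \<in> ?D" using that cs(2) by blast
    then show ?thesis using partition_antimono[OF par(1), of 1 i] by (auto simp: skew_diagram_def mem_diagram)
  qed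
  have "boxes ?D' = cb"
  proof -
    have "sorted_list_of_set {i. (c, i) \<in> ?D'} = [Suc (conj_partition mu c)..<Suc (conj_partition lam c)]" if "1 \<le> c" for c
    proof -
      have "{i. (c, i) \<in> ?D'} = {Suc (conj_partition mu c)..<Suc (conj_partition lam c)}" using that by (auto simp: mem)
      then show ?thesis by (simp del: upt_Suc)
    qed
    then have "map (\<lambda>c. map (Pair c) (sorted_list_of_set {i. (c, i) \<in> ?D'})) (rev [1..<Suc (lam 1)])
       = map (\<lambda>c. map (\<lambda>i. (c, i)) [Suc (conj_partition mu c)..<Suc (conj_partition lam c)]) (rev [1..<Suc (lam 1)])"
      by (intro map_cong) auto
    then show ?thesis
      unfolding cb_def using boxes_rows[OF fin', of "lam 1"] lam1 mem by metis
  qed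
  then have rw: "row_word ?D' (\<lambda>b. M (prod.swap b)) =
      rev (concat (map (\<lambda>c. map (\<lambda>i. M (i, c)) (?rws c)) [1..<Suc (lam 1)]))"
    by (simp add: row_word_boxes cb_def map_concat rev_concat rev_map o_def del: upt_Suc)
  have "{b\<in>?D. lam 1 < snd b} = {}"
    using lam1 cs(2) by fastforce
  then have "knuth_equiv (row_word ?D M) (concat (map (\<lambda>c. map (\<lambda>i. M (i, c)) (?rws c)) [1..<Suc (lam 1)]))"
    using row_word_columns[OF skew M, of "lam 1"] by (simp only: row_word_empty append_Nil2)
  then show ?thesis unfolding rw
    by (rule knuth_equiv_rev_distinct) (use inj fin in \<open>simp add: distinct_row_word\<close>)
qed

lemma partition_empty: "is_partition (\<lambda>_. 0)"
  by (simp add: is_partition_def)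

lemma skew_empty: "is_partition l \<Longrightarrow> is_skew l (\<lambda>_. 0)"
  by (simp add: is_skew_def partition_empty)

lemma skew_diagram_empty: "skew_diagram l (\<lambda>_. 0) = diagram l"
  by (auto simp: skew_diagram_def mem_diagram)

lemma conj_partition_empty: "conj_partition (\<lambda>_. 0) = (\<lambda>_. 0)"
  by (auto simp: conj_partition_def)

text \<open>Reversing the row word amounts to transposing, both for the skew filling and for its
  rectification, which is treated as a skew shape with empty inner partition.\<close>

lemma ptab_transpose:
  fixes M :: "nat \<times> nat \<Rightarrow> 'a::linorder"
  assumes skew: "is_skew lam mu" and M: "M \<in> ssyt (skew_diagram lam mu) UNIV" and inj: "inj_on M (skew_diagram lam mu)"
  shows "ptab (row_word (skew_diagram (conj_partition lam) (conj_partition mu)) (\<lambda>b. M (prod.swap b))) =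
    transp_tab (ptab (row_word (skew_diagram lam mu) M))"
proof (rule ptab_eqI)
  let ?D = "skew_diagram lam mu"
  have fin: "finite ?D" using skew by simp
  define P where "P = ptab (row_word ?D M)"
  have P: "tableau P" "knuth_equiv (tword P) (row_word ?D M)" by (simp_all add: P_def knuth_equiv_ptab)
  have par: "is_partition (fst P)" and ss: "snd P \<in> ssyt (diagram (fst P)) UNIV" using P(1) by (auto simp: tableau_def)
  have dw: "distinct (row_word ?D M)" using inj fin by (simp add: distinct_row_word)
  then have "distinct (tword P)" using knuth_equiv_distinct[OF P(2)] by blast
  then have injP: "inj_on (snd P) (diagram (fst P))" using par by (simp add: distinct_row_word)
  have eq: "knuth_equiv (rev (tword P)) (row_word (diagram (conj_partition (fst P))) (\<lambda>b. snd P (prod.swap b)))"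
    using rev_row_word_transpose[OF skew_empty[OF par], of "snd P"] ss injP
    by (simp add: skew_diagram_empty conj_partition_empty)
  have "row_word (diagram (conj_partition (fst P))) (\<lambda>b. snd P (prod.swap b)) = tword (transp_tab P)"
    using par by (auto simp: transp_tab_def partition_conj intro!: row_word_cong)
  then have "knuth_equiv (tword (transp_tab P)) (rev (tword P))" using eq by (simp add: knuth_equiv_sym)
  also have "knuth_equiv \<dots> (rev (row_word ?D M))"
    using P(2) \<open>distinct (tword P)\<close> by (rule knuth_equiv_rev_distinct)
  also have "knuth_equiv \<dots> (row_word (skew_diagram (conj_partition lam) (conj_partition mu)) (\<lambda>b. M (prod.swap b)))"
    by (rule rev_row_word_transpose[OF skew M inj])
  finally show "knuth_equiv (tword (transp_tab (ptab (row_word ?D M))))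
    (row_word (skew_diagram (conj_partition lam) (conj_partition mu)) (\<lambda>b. M (prod.swap b)))"
    unfolding P_def .
  have "tableau (conj_partition (fst P), snd (transp_tab P))"
  proof (rule tableauI[OF partition_conj[OF par]])
    let ?C = "diagram (conj_partition (fst P))"
    have memC: "(i, j) \<in> ?C \<longleftrightarrow> (j, i) \<in> diagram (fst P)" for i j by (rule mem_diagram_conj[OF par])
    show "snd (transp_tab P) \<in> extensional ?C" by (simp add: transp_tab_def)
    fix i j :: nat
    {
      assume *: "(i, Suc j) \<in> ?C" "1 \<le> j"
      then have "(Suc j, i) \<in> diagram (fst P)" using memC by blast
      then have "(j, i) \<in> diagram (fst P)"
        by (rule diagram_downclosed[OF par _ *(2)]) (use * in \<open>simp_all add: mem_diagram\<close>)
      then show "snd (transp_tab P) (i, j) \<le> snd (transp_tab P) (i, Suc j)"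
        using * ss by (auto simp: transp_tab_def memC ssyt_def less_imp_le)
    next
      assume *: "(Suc i, j) \<in> ?C" "1 \<le> i"
      then have "(j, Suc i) \<in> diagram (fst P)" using memC by blast
      moreover from this have "(j, i) \<in> diagram (fst P)" using *(2) by (simp add: mem_diagram)
      ultimately have d: "(j, i) \<in> diagram (fst P)" "(j, Suc i) \<in> diagram (fst P)" by simp_all
      then have "snd P (j, i) \<le> snd P (j, Suc i)" using ss by (auto simp: ssyt_def)
      moreover have "snd P (j, i) \<noteq> snd P (j, Suc i)" using injP d by (auto dest: inj_onD)
      ultimately show "snd (transp_tab P) (i, j) < snd (transp_tab P) (Suc i, j)"
        using d by (simp add: transp_tab_def memC)
    }
  qed
  then show "tableau (transp_tab (ptab (row_word ?D M)))" by (simp add: transp_tab_def P_def)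
qed

text \<open>This is \<open>right_arm_position\<close> for the transposed filling. Distinct entries
  turn the weak increase along rows into the strict increase that the transposed columns
  require.\<close>

lemma left_arm_position:
  fixes M :: "nat \<times> nat \<Rightarrow> 'a::linorder"
  assumes skew: "is_skew lam mu" and M: "M \<in> ssyt (skew_diagram lam mu) UNIV" and inj: "inj_on M (skew_diagram lam mu)"
    and i: "(i, 1) \<in> skew_diagram lam mu" "arm_start (conj_partition lam) (conj_partition mu) \<le> i"
  defines "P \<equiv> ptab (row_word (skew_diagram lam mu) M)"
  shows "(conj_partition (fst P) 1 - (conj_partition lam 1 - i), 1) \<in> diagram (fst P)"
    and "snd P (conj_partition (fst P) 1 - (conj_partition lam 1 - i), 1) = M (i, 1)"
proof -
  let ?D = "skew_diagram lam mu" and ?D' = "skew_diagram (conj_partition lam) (conj_partition mu)"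
  note cs = conj_skew[OF skew]
  have fin': "finite ?D'" using cs(1) by simp
  define M' where "M' = (\<lambda>b\<in>?D'. M (prod.swap b))"
  have "M' \<in> ssyt ?D' UNIV"
    unfolding ssyt_def fillings_def
  proof (intro CollectI conjI allI impI)
    show "M' \<in> ?D' \<rightarrow>\<^sub>E UNIV" by (simp add: M'_def)
    fix i j j' assume *: "(i, j) \<in> ?D' \<and> (i, j') \<in> ?D' \<and> j < j'"
    then have "M (j, i) < M (j', i)" using M cs(2) by (auto simp: ssyt_def)
    then show "M' (i, j) \<le> M' (i, j')" using * by (simp add: M'_def)
  next
    fix i i' j assume *: "(i, j) \<in> ?D' \<and> (i', j) \<in> ?D' \<and> i < i'"
    then have "M (j, i) \<le> M (j, i')" "M (j, i) \<noteq> M (j, i')" using M inj cs(2) by (auto simp: ssyt_def dest: inj_onD)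
    then show "M' (i, j) < M' (i', j)" using * by (simp add: M'_def)
  qed
  moreover have "(1, i) \<in> ?D'" using i(1) cs(2) by blast
  ultimately have *: "(1, fst (ptab (row_word ?D' M')) 1 - (conj_partition lam 1 - i)) \<in> diagram (fst (ptab (row_word ?D' M')))"
    "snd (ptab (row_word ?D' M')) (1, fst (ptab (row_word ?D' M')) 1 - (conj_partition lam 1 - i)) = M' (1, i)"
    using right_arm_position[OF cs(1) _ _ i(2)] by blast+
  have "row_word ?D' M' = row_word ?D' (\<lambda>b. M (prod.swap b))" by (rule row_word_cong[OF fin']) (simp add: M'_def)
  then have PP: "ptab (row_word ?D' M') = transp_tab P" unfolding P_def using ptab_transpose[OF skew M inj] by simp
  have par: "is_partition (fst P)" by (simp add: P_def)
  show d: "(conj_partition (fst P) 1 - (conj_partition lam 1 - i), 1) \<in> diagram (fst P)"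
    using *(1) unfolding PP transp_tab_def fst_conv mem_diagram_conj[OF par] .
  show "snd P (conj_partition (fst P) 1 - (conj_partition lam 1 - i), 1) = M (i, 1)"
    using *(2) d \<open>(1, i) \<in> ?D'\<close> unfolding PP by (simp add: transp_tab_def mem_diagram_conj[OF par] M'_def)
qed

section \<open>Rearrangement of the variables\<close>

locale skew_shape =
  fixes lam mu :: "nat \<Rightarrow> nat"
  assumes skew: "is_skew lam mu"
begin

abbreviation "D \<equiv> skew_diagram lam mu"

lemma fin: "finite D"
  using skew by simp

lemma mem_D: "(i, j) \<in> D \<longleftrightarrow> 1 \<le> i \<and> mu i < j \<and> j \<le> lam i"
  by (auto simp: skew_diagram_def mem_diagram)

lemma mem_D_conj: "(i, j) \<in> D \<longleftrightarrow> 1 \<le> j \<and> conj_partition mu j < i \<and> i \<le> conj_partition lam j"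
  unfolding conj_skew(2)[OF skew, of j i, symmetric] by (auto simp: skew_diagram_def mem_diagram)

lemma rect_shape_eq: "rect_shape D L = fst (ptab (labw (row_word D L)))"
  using ptab_labw[of "row_word D L"] by (simp add: rect_shape_def rect_ptab tab_val_def)

lemma partition_rect_shape: "is_partition (rect_shape D L)"
  by (simp add: rect_shape_def rect_ptab)

lemma rect_phi_T: "rect D (phi_T D L) = ptab (labw (row_word D L))"
  by (simp add: rect_ptab row_word_phi_T[OF fin])

lemma
  assumes "b \<in> D"
  shows rho_in: "rho D L b \<in> diagram (rect_shape D L)"
    and rho_value: "rect_tableau D (phi_T D L) (rho D L b) = phi_T D L b"
    and rho_eqI: "b' \<in> diagram (rect_shape D L) \<Longrightarrow> rect_tableau D (phi_T D L) b' = phi_T D L b \<Longrightarrow> rho D L b = b'"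
proof -
  let ?P = "ptab (labw (row_word D L))"
  have eq: "knuth_equiv (tword ?P) (row_word D (phi_T D L))"
    using knuth_equiv_ptab[of "labw (row_word D L)"] by (simp add: row_word_phi_T[OF fin])
  have finP: "finite (diagram (fst ?P))" by simp
  have "distinct (row_word D (phi_T D L))" using phi_T_inj[OF fin] by (simp add: distinct_row_word fin)
  then have inj: "inj_on (snd ?P) (diagram (fst ?P))"
    using knuth_equiv_distinct[OF eq] distinct_row_word[OF finP] by blast
  have "snd ?P ` diagram (fst ?P) = phi_T D L ` D"
    using knuth_equiv_set[OF eq] by (simp add: set_row_word fin)
  then have "phi_T D L b \<in> snd ?P ` diagram (fst ?P)" using assms by simp
  then obtain b0 where b0: "phi_T D L b = snd ?P b0" "b0 \<in> diagram (fst ?P)" by (rule imageE)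
  have ex1: "\<exists>!b'. b' \<in> diagram (fst ?P) \<and> snd ?P b' = phi_T D L b"
    by (rule ex1I[of _ b0]) (use b0 inj in \<open>auto dest: inj_onD\<close>)
  have rho: "rho D L b = (THE b'. b' \<in> diagram (fst ?P) \<and> snd ?P b' = phi_T D L b)"
    by (simp add: rho_def rect_shape_eq rect_tableau_def rect_phi_T)
  show "rho D L b \<in> diagram (rect_shape D L)" "rect_tableau D (phi_T D L) (rho D L b) = phi_T D L b"
    using theI'[OF ex1] by (simp_all add: rho rect_shape_eq rect_tableau_def rect_phi_T)
  show "rho D L b = b'" if "b' \<in> diagram (rect_shape D L)" "rect_tableau D (phi_T D L) b' = phi_T D L b"
    unfolding rho using ex1 that
    by (intro the1_equality) (simp_all add: rect_shape_eq rect_tableau_def rect_phi_T)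
qed

lemma bij_rho: "bij_betw (rho D L) D (diagram (rect_shape D L))"
proof -
  have inj: "inj_on (rho D L) D"
  proof (rule inj_onI)
    fix x y assume xy: "x \<in> D" "y \<in> D" "rho D L x = rho D L y"
    then have "phi_T D L x = phi_T D L y" using rho_value by metis
    then show "x = y" using phi_T_inj[OF fin] xy by (meson inj_onD)
  qed
  have "card (diagram (rect_shape D L)) = card D"
    unfolding rect_shape_eq card_ptab by (simp add: length_row_word fin)
  moreover have "rho D L ` D \<subseteq> diagram (rect_shape D L)" using rho_in by blast
  ultimately have "rho D L ` D = diagram (rect_shape D L)"
    using card_image[OF inj] by (intro card_subset_eq) (simp_all add: partition_rect_shape)
  then show ?thesis using inj by (simp add: bij_betw_def)
qed

lemma rho_surj:
  assumes "b' \<in> diagram (rect_shape D L)"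
  obtains b where "b \<in> D" "b' = rho D L b"
proof -
  have "b' \<in> rho D L ` D" using assms bij_rho[of L] by (simp add: bij_betw_def)
  then show ?thesis using that by (rule imageE)
qed

text \<open>\<open>rho\<close> is defined by labels, and rectification commutes with forgetting
  their subscripts by \<open>ptab_labw\<close>.\<close>

lemma rect_tableau_rho:
  assumes "b \<in> D" shows "rect_tableau D L (rho D L b) = L b"
proof -
  have "rect_tableau D L (rho D L b) = lab_val (rect_tableau D (phi_T D L) (rho D L b))"
    using rho_in[OF assms, of L] ptab_labw[of "row_word D L"]
    by (simp add: rect_tableau_def rect_ptab row_word_phi_T[OF fin] tab_val_def rect_shape_eq)
  then show ?thesis using assms by (simp add: rho_value lab_val_phi_T)
qed

lemma rearranged_rho:
  assumes "b \<in> D" shows "rearranged D v L (rho D L b) = v b"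
  using assms bij_rho[of L] rho_in[OF assms, of L] by (simp add: rearranged_def bij_betw_def)

lemma rect_SSYT:
  assumes "L \<in> SSYT D" shows "rect_tableau D L \<in> SSYT (diagram (rect_shape D L))"
proof -
  have "tableau (rect D L)" by (simp add: rect_ptab)
  then have "rect_tableau D L \<in> ssyt (diagram (rect_shape D L)) UNIV"
    by (simp add: tableau_def rect_tableau_def rect_shape_def)
  moreover have "1 \<le> rect_tableau D L b'" if "b' \<in> diagram (rect_shape D L)" for b'
  proof -
    from that obtain b where b: "b \<in> D" "b' = rho D L b" by (rule rho_surj)
    then have "1 \<le> L b" using assms unfolding SSYT_ssyt by blast
    then show ?thesis unfolding b(2) rect_tableau_rho[OF b(1)] .
  qed
  ultimately show ?thesis unfolding SSYT_ssyt by blast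
qed

lemma rho_right_arm:
  assumes "L \<in> SSYT D" "(1, j) \<in> right_arm lam mu"
  shows "rho D L (1, j) = (1, rect_shape D L 1 - (lam 1 - j))"
proof -
  have j: "(1, j) \<in> D" "arm_start lam mu \<le> j" using assms(2) by (auto simp: right_arm_def)
  note * = right_arm_position[OF skew ssyt_phi_T[OF fin assms(1)] j]
  show ?thesis using * by (intro rho_eqI[OF j(1)]) (simp_all add: rect_shape_eq rect_tableau_def rect_phi_T row_word_phi_T[OF fin])
qed

lemma rho_left_arm:
  assumes "L \<in> SSYT D" "(i, 1) \<in> left_arm lam mu"
  shows "rho D L (i, 1) = (conj_partition (rect_shape D L) 1 - (conj_partition lam 1 - i), 1)"
proof -
  have i: "(i, 1) \<in> D" "arm_start (conj_partition lam) (conj_partition mu) \<le> i" using assms(2) by (auto simp: left_arm_def)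
  note * = left_arm_position[OF skew ssyt_phi_T[OF fin assms(1)] phi_T_inj[OF fin] i]
  show ?thesis using * by (intro rho_eqI[OF i(1)]) (simp_all add: rect_shape_eq rect_tableau_def rect_phi_T row_word_phi_T[OF fin])
qed

lemma body_subset: "body lam mu \<subseteq> D"
  by (auto simp: body_def)

text \<open>The positions of the arms in the rectification depend on its shape only, hence two
  rearrangements of the same shape differ by a permutation of the variables of the body.\<close>

lemma rearranged_permutes:
  assumes L: "L \<in> SSYT D" "L' \<in> SSYT D" "rect_shape D L = rect_shape D L'" and v: "inj_on v D"
  obtains \<tau> where "\<tau> permutes (v ` body lam mu)"
    "\<And>b'. b' \<in> diagram (rect_shape D L) \<Longrightarrow> rearranged D v L' b' = \<tau> (rearranged D v L b')"
proof -
  let ?B = "body lam mu" and ?S = "diagram (rect_shape D L)"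
  \<comment> \<open>\<open>p b\<close> is the box that \<open>L'\<close> moves to the place where
    \<open>L\<close> moves \<open>b\<close>; on the arms it is the identity.\<close>
  define p where "p = inv_into D (rho D L') \<circ> rho D L"
  have bij': "bij_betw (rho D L') D ?S" using bij_rho[of L'] L(3) by simp
  have bijp: "bij_betw p D D"
    unfolding p_def by (rule bij_betw_trans[OF bij_rho bij_betw_inv_into[OF bij']])
  have fix': "p b = b" if "b \<in> D" "b \<notin> ?B" for b
  proof -
    have "rho D L b = rho D L' b"
    proof (cases "b \<in> right_arm lam mu")
      case True
      then obtain j where "b = (1, j)" by (auto simp: right_arm_def)
      then show ?thesis using True rho_right_arm L by simp
    next
      case False
      then have "b \<in> left_arm lam mu" using that by (simp add: body_def)
      then obtain i where "b = (i, 1)" "(i, 1) \<in> left_arm lam mu" by (auto simp: left_arm_def)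
      then show ?thesis using rho_left_arm L by simp
    qed
    then show ?thesis using that(1) bij' by (simp add: p_def bij_betw_def)
  qed
  have "bij_betw p ?B ?B"
  proof -
    have "bij_betw p (D - ?B) (D - ?B)"
      by (rule bij_betw_cong[THEN iffD2, OF _ bij_betw_id]) (simp add: fix')
    then have "p ` (D - ?B) = D - ?B" by (simp add: bij_betw_def)
    moreover have "inj_on p D" "p ` D = D" using bijp by (simp_all add: bij_betw_def)
    moreover have B: "?B = D - (D - ?B)" using body_subset by blast
    ultimately have "p ` ?B = ?B" by (metis Diff_subset inj_on_image_set_diff subset_refl)
    then show ?thesis using \<open>inj_on p D\<close> body_subset inj_on_subset by (auto simp: bij_betw_def)
  qed
  \<comment> \<open>The permutation \<open>p\<close> of boxes, transported to the variables along
    the injective \<open>v\<close>.\<close>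
  define \<tau> where "\<tau> x = (if x \<in> v ` ?B then v (p (inv_into D v x)) else x)" for x
  have tv: "\<tau> (v b) = v (p b)" if "b \<in> D" for b
  proof (cases "b \<in> ?B")
    case True
    then show ?thesis using that v by (simp add: \<tau>_def)
  next
    case False
    then have "v b \<notin> v ` ?B" using inj_on_image_mem_iff[OF v that body_subset] by simp
    then show ?thesis using fix'[OF that False] by (simp add: \<tau>_def)
  qed
  have "\<tau> permutes (v ` ?B)"
  proof (rule bij_imp_permutes)
    have injB: "inj_on v ?B" using v body_subset by (rule inj_on_subset)
    have "bij_betw (v \<circ> p) ?B (v ` ?B)"
      by (rule bij_betw_trans[OF \<open>bij_betw p ?B ?B\<close>]) (simp add: bij_betw_def injB)
    then have "bij_betw (\<tau> \<circ> v) ?B (v ` ?B)"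
      by (rule bij_betw_cong[THEN iffD1, rotated]) (use tv body_subset in auto)
    moreover have "bij_betw v ?B (v ` ?B)" using injB by (simp add: bij_betw_def)
    ultimately show "bij_betw \<tau> (v ` ?B) (v ` ?B)" using bij_betw_comp_iff by blast
    show "\<tau> x = x" if "x \<notin> v ` ?B" for x using that by (simp add: \<tau>_def)
  qed
  moreover have "rearranged D v L' b' = \<tau> (rearranged D v L b')" if "b' \<in> ?S" for b'
  proof -
    from that obtain b where b: "b \<in> D" "b' = rho D L b" by (rule rho_surj)
    have pb: "p b \<in> D" using bijp b(1) by (auto simp: bij_betw_def)
    have "rho D L' (p b) = b'" using that bij' b(2) unfolding p_def by (simp add: bij_betw_def f_inv_into_f)
    then have "rearranged D v L' b' = v (p b)" using rearranged_rho[OF pb] by metis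
    also have "\<dots> = \<tau> (v b)" using tv[OF b(1)] by simp
    also have "v b = rearranged D v L b'" using rearranged_rho[OF b(1), of v L] b(2) by simp
    finally show ?thesis .
  qed
  ultimately show ?thesis using that by blast
qed

lemma finite_rect_fibre:
  "finite {L \<in> SSYT D. rect D L = T}"
proof (rule finite_subset)
  show "{L \<in> SSYT D. rect D L = T} \<subseteq> D \<rightarrow>\<^sub>E set (tword T)"
  proof
    fix L assume L: "L \<in> {L \<in> SSYT D. rect D L = T}"
    then have "knuth_equiv (tword T) (row_word D L)" using knuth_equiv_ptab rect_ptab by (metis (mono_tags, lifting) mem_Collect_eq)
    then have "L ` D = set (tword T)" using knuth_equiv_set set_row_word[OF fin] by metis
    moreover have "L \<in> D \<rightarrow>\<^sub>E {1..}" using L by (simp add: ssyt_def fillings_def)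
    ultimately show "L \<in> D \<rightarrow>\<^sub>E set (tword T)" by (auto simp: PiE_def)
  qed
  show "finite (D \<rightarrow>\<^sub>E set (tword T))" using fin by (intro finite_PiE) auto
qed

section \<open>Fibres of rectification and Littlewood--Richardson coefficients\<close>

lemma card_fibre:
  assumes "is_partition nu" "T \<in> SSYT (diagram nu)"
  shows "int (card {L \<in> SSYT D. rect D L = (nu, T)}) = lr_coeff mu nu lam"
proof -
  have lm: "is_partition lam" "is_partition mu" using skew by (auto simp: is_skew_def)
  have t: "tableau (nu, T)" using assms by (simp add: tableau_def SSYT_ssyt')
  have "1 \<le> x" if "x \<in> set (tword (nu, T))" for x
    using that assms by (auto simp: set_row_word SSYT_ssyt')
  then have "card {L \<in> SSYT D. rect D L = (nu, T)} = card (lr_pairs (lam, superstd lam) mu nu)"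
    using card_rect_fibre[OF skew t _ tableau_superstd[OF lm(1)]] by simp
  then show ?thesis using lm assms(1) by (simp add: lr_coeff_eq lrc_def)
qed

text \<open>The coefficient is the size of every fibre over a tableau of shape \<open>nu\<close>, so
  it is positive exactly if some fibre over this shape is inhabited.\<close>

lemma G_set_eq: "G_set lam mu = rect_shape D ` SSYT D"
proof (intro equalityI subsetI)
  fix nu assume "nu \<in> G_set lam mu"
  then have nu: "is_partition nu" "lr_coeff mu nu lam > 0" by (auto simp: G_set_def)
  then have "card {L \<in> SSYT D. rect D L = (nu, superstd nu)} > 0"
    using card_fibre[OF nu(1) superstd_SSYT] by simp
  then obtain L where "L \<in> SSYT D" "rect D L = (nu, superstd nu)" by (auto simp: card_gt_0_iff)
  then show "nu \<in> rect_shape D ` SSYT D" by (intro image_eqI[of _ _ L]) (simp_all add: rect_shape_def)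
next
  fix nu assume "nu \<in> rect_shape D ` SSYT D"
  then obtain L where L: "L \<in> SSYT D" "nu = rect_shape D L" by blast
  have nu: "is_partition nu" using L(2) partition_rect_shape by simp
  have "L \<in> {L' \<in> SSYT D. rect D L' = (nu, rect_tableau D L)}" using L by (simp add: rect_shape_def rect_tableau_def)
  then have "card {L' \<in> SSYT D. rect D L' = (nu, rect_tableau D L)} > 0"
    using finite_rect_fibre card_gt_0_iff by blast
  then show "nu \<in> G_set lam mu"
    using card_fibre[OF nu, of "rect_tableau D L"] rect_SSYT[OF L(1)] L(2) nu by (simp add: G_set_def)
qed

lemma finite_G_set: "finite (G_set lam mu)"
proof (rule finite_subset)
  show "G_set lam mu \<subseteq> {l. is_partition l \<and> card (diagram l) = card D}"
    unfolding G_set_eq by (auto simp: partition_rect_shape rect_shape_eq card_ptab length_row_word fin)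
qed (rule finite_partitions)

end

section \<open>Summability\<close>

definition schur_term :: "(nat \<times> nat) set \<Rightarrow> (nat \<times> nat \<Rightarrow> complex) \<Rightarrow> (nat \<times> nat \<Rightarrow> nat) \<Rightarrow> complex" where
  "schur_term D s M = (\<Prod>b\<in>D. of_nat (M b) powr (- s b))"

lemma schur_zeta_term: "schur_zeta D s = infsum (schur_term D s) (SSYT D)"
  by (simp add: schur_zeta_def schur_term_def[abs_def])

text \<open>Any finite set of fillings lies in a cube, on which the sum of products factors into
  partial sums of a convergent series.\<close>

lemma summable_on_prod_powr:
  fixes a :: real
  assumes "finite D" "a < -1"
  shows "(\<lambda>M. \<Prod>b\<in>D. real (M b) powr a) summable_on (D \<rightarrow>\<^sub>E {1::nat..})"
proof (rule nonneg_bdd_above_summable_on)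
  let ?f = "\<lambda>M :: _ \<Rightarrow> nat. \<Prod>b\<in>D. real (M b) powr a"
  show "0 \<le> ?f M" for M by (intro prod_nonneg) simp
  have sm: "summable (\<lambda>n. real n powr a)" using assms(2) by (simp add: summable_real_powr_iff)
  show "bdd_above (sum ?f ` {F. F \<subseteq> D \<rightarrow>\<^sub>E {1::nat..} \<and> finite F})"
  proof (rule bdd_aboveI2)
    fix F assume "F \<in> {F. F \<subseteq> D \<rightarrow>\<^sub>E {1::nat..} \<and> finite F}"
    then have F: "F \<subseteq> D \<rightarrow>\<^sub>E {1::nat..}" "finite F" by auto
    define n where "n = Suc (\<Sum>M\<in>F. \<Sum>b\<in>D. M b)"
    have less: "M b < n" if "M \<in> F" "b \<in> D" for M b
    proof -
      have "M b \<le> (\<Sum>b\<in>D. M b)" using that assms(1) by (intro member_le_sum) auto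
      also have "\<dots> \<le> (\<Sum>M\<in>F. \<Sum>b\<in>D. M b)" using that F(2) by (intro member_le_sum) auto
      finally show ?thesis by (simp add: n_def)
    qed
    have "F \<subseteq> D \<rightarrow>\<^sub>E {..<n}"
    proof
      fix M assume M: "M \<in> F"
      then have "M \<in> extensional D" using F(1) by (auto simp: PiE_def)
      then show "M \<in> D \<rightarrow>\<^sub>E {..<n}" using less[OF M] by (simp add: PiE_iff)
    qed
    \<comment> \<open>Passing to the cube only adds nonnegative terms, including those of fillings
      with entry 0.\<close>
    then have "sum ?f F \<le> sum ?f (D \<rightarrow>\<^sub>E {..<n})"
      using assms(1) by (intro sum_mono2 finite_PiE) (auto intro: prod_nonneg)
    also have "\<dots> = (\<Prod>b\<in>D. \<Sum>k<n. real k powr a)"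
      using assms(1) by (subst prod_sum_PiE) auto
    also have "\<dots> \<le> (\<Prod>b\<in>D. \<Sum>k. real k powr a)"
      by (intro prod_mono conjI sum_nonneg sum_le_suminf[OF sm]) auto
    finally show "sum ?f F \<le> (\<Prod>b\<in>D. \<Sum>k. real k powr a)" .
  qed
qed

lemma norm_schur_term:
  assumes "M \<in> SSYT D"
  shows "norm (schur_term D s M) = exp (- (\<Sum>b\<in>D. Re (s b) * ln (real (M b))))"
proof (cases "finite D")
  case True
  have "norm (of_nat (M b) powr (- s b)) = exp (- (Re (s b) * ln (real (M b))))" if "b \<in> D" for b
  proof -
    have "1 \<le> M b" using assms that unfolding SSYT_ssyt by blast
    then show ?thesis by (simp add: norm_powr_real_powr powr_def)
  qed
  then have "norm (schur_term D s M) = (\<Prod>b\<in>D. exp (- (Re (s b) * ln (real (M b)))))"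
    by (simp add: schur_term_def prod_norm[symmetric])
  then show ?thesis using True by (simp add: exp_sum sum_negf[symmetric])
qed (simp add: schur_term_def)

text \<open>If the exponent at \<open>b\<close> only has real part at least 1, part of the surplus at \<open>e b\<close> is
  transferred to \<open>b\<close>; then the sum is dominated by a product of convergent zeta series.\<close>

lemma summable_schur_term:
  assumes fin: "finite D" and ge: "\<And>b. b \<in> D \<Longrightarrow> Re (s b) \<ge> 1"
    and e: "\<And>b. b \<in> D \<Longrightarrow> e b \<in> D \<and> Re (s (e b)) > 1"
    and le: "\<And>b M. b \<in> D \<Longrightarrow> M \<in> SSYT D \<Longrightarrow> M b \<le> M (e b)"
  shows "(\<lambda>M. norm (schur_term D s M)) summable_on SSYT D"
proof (cases "D = {}")
  case True
  have "SSYT D \<subseteq> {\<lambda>_. undefined}" using True by (auto simp: ssyt_def fillings_def)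
  then have "finite (SSYT D)" by (rule finite_subset) simp
  then show ?thesis by simp
next
  case False
  define Gd where "Gd = {b\<in>D. Re (s b) > 1}"
  obtain b0 where "b0 \<in> D" using False by blast
  then have "e b0 \<in> Gd" using e by (simp add: Gd_def)
  then have "Gd \<noteq> {}" by blast
  moreover have "finite Gd" using fin by (simp add: Gd_def)
  ultimately have finG: "finite Gd" "Gd \<noteq> {}" by simp_all
  define \<delta> where "\<delta> = Min ((\<lambda>b. Re (s b) - 1) ` Gd)"
  have "\<delta> \<in> (\<lambda>b. Re (s b) - 1) ` Gd" unfolding \<delta>_def using finG by (intro Min_in) auto
  then have pos: "\<delta> > 0" by (auto simp: Gd_def)
  have d: "1 + \<delta> \<le> Re (s b)" if "b \<in> Gd" for b
  proof -
    have "\<delta> \<le> Re (s b) - 1" unfolding \<delta>_def using that finG by (intro Min_le) auto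
    then show ?thesis by simp
  qed
  define c where "c = card D"
  have c: "c > 0" using False fin by (simp add: c_def card_gt_0_iff)
  \<comment> \<open>\<delta> is the least surplus over 1 among the good boxes \<open>Gd\<close>.
    Every box draws at most \<epsilon> times the total logarithm of the good boxes, so all
    \<open>c\<close> boxes together draw at most \<delta> times this total.\<close>
  define \<epsilon> where "\<epsilon> = \<delta> / real c"
  have eps: "\<epsilon> > 0" using pos c by (simp add: \<epsilon>_def)
  let ?g = "\<lambda>M. \<Prod>b\<in>D. real (M b) powr (- (1 + \<epsilon>))"
  have sub: "SSYT D \<subseteq> D \<rightarrow>\<^sub>E {1..}" by (auto simp: ssyt_def fillings_def)
  have "?g summable_on (D \<rightarrow>\<^sub>E {1..})" by (rule summable_on_prod_powr[OF fin]) (use eps in simp)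
  then have sg: "?g summable_on SSYT D" by (rule summable_on_subset[OF _ sub])
  show ?thesis
  proof (rule summable_on_comparison_test[OF sg])
    fix M assume M: "M \<in> SSYT D"
    define l where "l b = ln (real (M b))" for b
    have one: "1 \<le> M b" if "b \<in> D" for b using M that unfolding SSYT_ssyt by blast
    have l0: "0 \<le> l b" if "b \<in> D" for b using one[OF that] by (simp add: l_def)
    have "l b \<le> (\<Sum>g\<in>Gd. l g)" if "b \<in> D" for b
    proof -
      have "l b \<le> l (e b)" using le[OF that M] one[OF that] by (simp add: l_def)
      also have "\<dots> \<le> (\<Sum>g\<in>Gd. l g)"
        using e[OF that] finG l0 by (intro member_le_sum) (auto simp: Gd_def)
      finally show ?thesis .
    qed
    then have "(\<Sum>b\<in>D. \<epsilon> * l b) \<le> (\<Sum>b\<in>D. \<epsilon> * (\<Sum>g\<in>Gd. l g))"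
      using eps by (intro sum_mono mult_left_mono) auto
    also have "\<dots> = \<delta> * (\<Sum>g\<in>Gd. l g)" using c by (simp add: \<epsilon>_def c_def[symmetric])
    finally have *: "(\<Sum>b\<in>D. \<epsilon> * l b) \<le> (\<Sum>g\<in>Gd. \<delta> * l g)" by (simp add: sum_distrib_left)
    have "(\<Sum>b\<in>D. (1 + \<epsilon>) * l b) = (\<Sum>b\<in>D. l b) + (\<Sum>b\<in>D. \<epsilon> * l b)"
      by (simp add: distrib_right sum.distrib)
    also have "\<dots> \<le> (\<Sum>b\<in>D. l b) + (\<Sum>b\<in>D. if b \<in> Gd then \<delta> * l b else 0)"
    proof -
      have "D \<inter> {b. b \<in> Gd} = Gd" by (auto simp: Gd_def)
      then have "(\<Sum>b\<in>D. if b \<in> Gd then \<delta> * l b else 0) = (\<Sum>g\<in>Gd. \<delta> * l g)"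
        using fin by (simp add: sum.If_cases)
      then show ?thesis using * by simp
    qed
    also have "\<dots> = (\<Sum>b\<in>D. l b + (if b \<in> Gd then \<delta> * l b else 0))" by (simp add: sum.distrib)
    also have "\<dots> \<le> (\<Sum>b\<in>D. Re (s b) * l b)"
    proof (rule sum_mono)
      fix b assume b: "b \<in> D"
      show "l b + (if b \<in> Gd then \<delta> * l b else 0) \<le> Re (s b) * l b"
      proof (cases "b \<in> Gd")
        case True
        then show ?thesis using mult_right_mono[OF d[OF True] l0[OF b]] by (simp add: distrib_right)
      next
        case False
        then show ?thesis using mult_right_mono[OF ge[OF b] l0[OF b]] by simp
      qed
    qed
    finally have "norm (schur_term D s M) \<le> exp (- (\<Sum>b\<in>D. (1 + \<epsilon>) * l b))"
      unfolding norm_schur_term[OF M] l_def by simp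
    also have "\<dots> = ?g M"
    proof -
      have "real (M b) powr (- (1 + \<epsilon>)) = exp (- ((1 + \<epsilon>) * l b))" if "b \<in> D" for b
        using one[OF that] by (simp add: powr_def l_def algebra_simps)
      then show ?thesis using fin by (simp add: exp_sum sum_negf[symmetric])
    qed
    finally show "norm (schur_term D s M) \<le> ?g M" .
  qed simp
qed

lemma sum_infsum_swap:
  fixes f :: "'i \<Rightarrow> 'a \<Rightarrow> 'b::{topological_comm_monoid_add, t2_space}"
  assumes "finite I" "\<And>i. i \<in> I \<Longrightarrow> f i summable_on A"
  shows "(\<Sum>i\<in>I. infsum (f i) A) = infsum (\<lambda>x. \<Sum>i\<in>I. f i x) A"
    and "(\<lambda>x. \<Sum>i\<in>I. f i x) summable_on A"
proof -
  have "((\<lambda>x. \<Sum>i\<in>I. f i x) has_sum (\<Sum>i\<in>I. infsum (f i) A)) A"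
    using assms by (induction I rule: finite_induct) (auto intro!: has_sum_add has_sum_infsum)
  then show "(\<Sum>i\<in>I. infsum (f i) A) = infsum (\<lambda>x. \<Sum>i\<in>I. f i x) A" "(\<lambda>x. \<Sum>i\<in>I. f i x) summable_on A"
    by (auto simp: infsumI has_sum_imp_summable)
qed

text \<open>Numbering the elements of every fibre cuts \<open>A\<close> into \<open>c\<close>
  disjoint sections \<open>S k\<close> of \<open>g\<close>, each of which \<open>g\<close> maps
  bijectively onto \<open>B\<close>.\<close>

lemma infsum_fibres:
  fixes f :: "'b \<Rightarrow> complex"
  assumes "\<And>x. x \<in> A \<Longrightarrow> g x \<in> B" "\<And>y. y \<in> B \<Longrightarrow> finite {x\<in>A. g x = y}"
    "\<And>y. y \<in> B \<Longrightarrow> card {x\<in>A. g x = y} = c" "(\<lambda>x. f (g x)) summable_on A"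
  shows "infsum (\<lambda>x. f (g x)) A = of_nat c * infsum f B"
proof -
  have "\<exists>h. bij_betw h {..<c} {x\<in>A. g x = y}" if "y \<in> B" for y
    using ex_bij_betw_nat_finite[OF assms(2)[OF that]] assms(3)[OF that] by (auto simp: atLeast0LessThan)
  then obtain h where h: "\<And>y. y \<in> B \<Longrightarrow> bij_betw (h y) {..<c} {x\<in>A. g x = y}" by metis
  define S where "S k = (\<lambda>y. h y k) ` B" for k
  have gh: "g (h y k) = y" "h y k \<in> A" if "y \<in> B" "k < c" for y k
    using h[OF that(1)] that(2) by (auto simp: bij_betw_def)
  have SA: "S k \<subseteq> A" if "k < c" for k using gh that by (auto simp: S_def)
  have A: "A = (\<Union>k\<in>{..<c}. S k)"
  proof
    show "A \<subseteq> (\<Union>k\<in>{..<c}. S k)"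
    proof
      fix x assume x: "x \<in> A"
      then have "x \<in> h (g x) ` {..<c}" using h[OF assms(1)[OF x]] by (auto simp: bij_betw_def)
      then show "x \<in> (\<Union>k\<in>{..<c}. S k)" using assms(1)[OF x] by (auto simp: S_def)
    qed
  qed (use SA in auto)
  have disj: "S k \<inter> S k' = {}" if "k < c" "k' < c" "k \<noteq> k'" for k k'
  proof (rule ccontr)
    assume "S k \<inter> S k' \<noteq> {}"
    then obtain y y' where y: "y \<in> B" "y' \<in> B" "h y k = h y' k'" by (auto simp: S_def)
    then have "y = y'" using gh(1)[OF y(1) that(1)] gh(1)[OF y(2) that(2)] by simp
    then show False using y h[OF y(1)] that by (auto simp: bij_betw_def inj_on_def)
  qed
  have "infsum (\<lambda>x. f (g x)) (S k) = infsum f B" if "k < c" for k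
  proof -
    have "bij_betw (\<lambda>y. h y k) B (S k)"
      unfolding S_def bij_betw_def using gh(1) that by (auto intro!: inj_onI) metis
    then have "infsum (\<lambda>x. f (g x)) (S k) = infsum (\<lambda>y. f (g (h y k))) B"
      by (rule infsum_reindex_bij_betw[symmetric])
    also have "\<dots> = infsum f B" by (rule infsum_cong) (simp add: gh(1) that)
    finally show ?thesis .
  qed
  then have "(\<Sum>k<c. infsum (\<lambda>x. f (g x)) (S k)) = of_nat c * infsum f B" by simp
  moreover have "(\<Sum>k<c. infsum (\<lambda>x. f (g x)) (S k)) = infsum (\<lambda>x. f (g x)) (\<Union>k<c. S k)"
  proof (rule sum_infsum)
    show "(\<lambda>x. f (g x)) summable_on S k" if "k \<in> {..<c}" for k
      using that SA by (intro summable_on_subset_banach[OF assms(4)]) simp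
  qed (use disj in auto)
  ultimately show ?thesis using A by simp
qed

section \<open>The symmetrised identity\<close>

(* 'x is the type of variables, v the tableau of pairwise distinct variables, and val assigns
   complex values to the variables; sigma permutes the variables, not their values. *)
theorem theorem1p2:
  fixes lam mu :: "nat \<Rightarrow> nat"
    and v :: "nat \<times> nat \<Rightarrow> 'x"
    and val :: "'x \<Rightarrow> complex"
    and u :: "(nat \<Rightarrow> nat) \<Rightarrow> nat \<times> nat \<Rightarrow> 'x"
  assumes skew: "is_skew lam mu"
    and variables: "v \<in> fillings (skew_diagram lam mu) UNIV" "inj_on v (skew_diagram lam mu)"
    and right: "\<And>j. (1, j) \<in> skew_diagram lam mu \<Longrightarrow>
        arm_start lam mu \<le> j \<Longrightarrow> j \<le> lam 1 - 1 \<Longrightarrow> Re (val (v (1, j))) \<ge> 1"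
    and left: "\<And>i. (i, 1) \<in> skew_diagram lam mu \<Longrightarrow>
        arm_start (conj_partition lam) (conj_partition mu) \<le> i \<Longrightarrow>
        i \<le> conj_partition lam 1 - 1 \<Longrightarrow> Re (val (v (i, 1))) \<ge> 1"
    and other: "\<And>i j. (i, j) \<in> skew_diagram lam mu \<Longrightarrow>
        \<not> (i = 1 \<and> arm_start lam mu \<le> j \<and> j \<le> lam 1 - 1) \<Longrightarrow>
        \<not> (j = 1 \<and> arm_start (conj_partition lam) (conj_partition mu) \<le> i \<and>
             i \<le> conj_partition lam 1 - 1) \<Longrightarrow>
        Re (val (v (i, j))) > 1"
    and family: "\<And>nu. nu \<in> G_set lam mu \<Longrightarrow> u nu \<in> U_set (skew_diagram lam mu) nu v"
  shows "(\<Sum>\<sigma> | \<sigma> permutes (v ` body lam mu).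
            schur_zeta (skew_diagram lam mu) (val \<circ> \<sigma> \<circ> v)) =
         (\<Sum>\<sigma> | \<sigma> permutes (v ` body lam mu).
            \<Sum>nu\<in>G_set lam mu.
              of_int (lr_coeff mu nu lam) * schur_zeta (diagram nu) (val \<circ> \<sigma> \<circ> u nu))"
proof -
  interpret skew_shape lam mu by standard (rule skew)
  let ?B = "body lam mu" and ?G = "G_set lam mu"
  let ?a = "arm_start lam mu" and ?a' = "arm_start (conj_partition lam) (conj_partition mu)"
  define Q where "Q = {\<sigma>. \<sigma> permutes (v ` ?B)}"
  define tm where "tm \<sigma> = schur_term D (val \<circ> \<sigma> \<circ> v)" for \<sigma>
  define S where "S nu = {L \<in> SSYT D. rect_shape D L = nu}" for nu
  define h where "h nu \<sigma> = schur_term (diagram nu) (val \<circ> \<sigma> \<circ> u nu)" for nu \<sigma>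
  have "finite ?B" using body_subset fin by (rule finite_subset)
  then have finP: "finite Q" by (simp add: Q_def finite_permutations)
  have inB: "v b \<in> v ` ?B \<longleftrightarrow> b \<in> ?B" if "b \<in> D" for b
    by (rule inj_on_image_mem_iff[OF variables(2) that body_subset])
  \<comment> \<open>Strict bounds throughout the body make its variables interchangeable as far as
    convergence is concerned.\<close>
  have gtB: "Re (val (v b)) > 1" if "b \<in> ?B" for b
  proof -
    obtain i j where b: "b = (i, j)" by fastforce
    have "(i, j) \<in> D" "(i, j) \<notin> right_arm lam mu" "(i, j) \<notin> left_arm lam mu"
      using that b by (auto simp: body_def)
    then show ?thesis unfolding b by (intro other) (auto simp: right_arm_def left_arm_def)
  qed
  \<comment> \<open>If the real part at \<open>b\<close> is not greater than 1, then
    \<open>b\<close> lies in an arm before its last box. That last box serves as \<open>e\<close>: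
    its variable is fixed by \<sigma> and has real part greater than 1, and its entry is at least
    that of \<open>b\<close>.\<close>
  have bound: "Re (val (\<sigma> (v b))) \<ge> 1 \<and> (\<exists>e\<in>D. Re (val (\<sigma> (v e))) > 1 \<and> (\<forall>M\<in>SSYT D. M b \<le> M e))"
    if \<sigma>: "\<sigma> \<in> Q" and b: "b \<in> D" for \<sigma> b
  proof -
    have fixed: "\<sigma> (v c) = v c" if "c \<in> D" "c \<notin> ?B" for c
      using \<sigma> inB[OF that(1)] that(2) by (auto simp: Q_def permutes_def)
    obtain i j where ij: "b = (i, j)" by fastforce
    show ?thesis
    proof (cases "Re (val (\<sigma> (v b))) > 1")
      case True
      then show ?thesis using b by (auto intro!: bexI[of _ b])
    next
      case False
      have "b \<notin> ?B"
      proof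
        assume "b \<in> ?B"
        then have "\<sigma> (v b) \<in> v ` ?B" using \<sigma> permutes_in_image[of \<sigma> "v ` ?B" "v b"] by (simp add: Q_def)
        then show False using gtB False by auto
      qed
      then have sb: "\<sigma> (v b) = v b" by (rule fixed[OF b])
      then consider (right) "i = 1" "?a \<le> j" "j \<le> lam 1 - 1" | (left) "j = 1" "?a' \<le> i" "i \<le> conj_partition lam 1 - 1"
        using other[of i j] b False ij by auto
      then show ?thesis
      proof cases
        case right': right
        have j: "mu 1 < j" "1 < lam 1" "j < lam 1" using b right' ij by (auto simp: mem_D)
        let ?e = "(1, lam 1)"
        have e: "?e \<in> D" using j by (simp add: mem_D)
        have "?e \<in> right_arm lam mu" using e right'(2) j by (auto simp: right_arm_def)
        then have "\<sigma> (v ?e) = v ?e" using fixed[OF e] by (simp add: body_def)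
        moreover have "Re (val (v ?e)) > 1" using j by (intro other[OF e]) auto
        moreover have "M b \<le> M ?e" if "M \<in> SSYT D" for M
          using that b e j(3) right'(1) ij by (auto simp: ssyt_def)
        moreover have "Re (val (v b)) \<ge> 1" using right b right' ij by simp
        ultimately show ?thesis using sb by (intro conjI bexI[OF _ e]) simp_all
      next
        case left': left
        have i: "conj_partition mu 1 < i" "1 < conj_partition lam 1" "i < conj_partition lam 1"
          using b left' ij mem_D_conj[of i 1] by auto
        let ?e = "(conj_partition lam 1, 1)"
        have e: "?e \<in> D" using i by (simp add: mem_D_conj)
        have "?e \<in> left_arm lam mu" using e left'(2) i by (auto simp: left_arm_def)
        then have "\<sigma> (v ?e) = v ?e" using fixed[OF e] by (simp add: body_def)
        moreover have "Re (val (v ?e)) > 1" using i by (intro other[OF e]) auto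
        moreover have "M b \<le> M ?e" if "M \<in> SSYT D" for M
          using that b e i(3) left'(1) ij by (auto simp: ssyt_def less_imp_le)
        moreover have "Re (val (v b)) \<ge> 1" using left b left' ij by simp
        ultimately show ?thesis using sb by (intro conjI bexI[OF _ e]) simp_all
      qed
    qed
  qed
  have abs_tm: "(\<lambda>L. norm (tm \<sigma> L)) summable_on SSYT D" if \<sigma>: "\<sigma> \<in> Q" for \<sigma>
  proof -
    have "\<forall>b\<in>D. \<exists>e. e \<in> D \<and> Re (val (\<sigma> (v e))) > 1 \<and> (\<forall>M\<in>SSYT D. M b \<le> M e)"
      using bound[OF \<sigma>] by blast
    from bchoice[OF this] obtain e
      where e: "\<And>b. b \<in> D \<Longrightarrow> e b \<in> D \<and> Re (val (\<sigma> (v (e b)))) > 1 \<and> (\<forall>M\<in>SSYT D. M b \<le> M (e b))"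
      by blast
    show ?thesis unfolding tm_def
      by (rule summable_schur_term[OF fin, of _ e]) (use e bound[OF \<sigma>] in auto)
  qed
  have sum_tm: "tm \<sigma> summable_on SSYT D" if "\<sigma> \<in> Q" for \<sigma>
    by (rule abs_summable_summable[OF abs_tm[OF that]])
  \<comment> \<open>Entries and variables are carried along together by \<open>rho\<close>, so the
    summand of \<open>L\<close> is a summand on the rectified shape with the arrangement belonging
    to \<open>L\<close>.\<close>
  have tm_rect: "tm \<sigma> L = schur_term (diagram (rect_shape D L)) (val \<circ> \<sigma> \<circ> rearranged D v L) (rect_tableau D L)" for \<sigma> L
  proof -
    have "tm \<sigma> L = (\<Prod>b\<in>D. of_nat (rect_tableau D L (rho D L b)) powr (- val (\<sigma> (rearranged D v L (rho D L b)))))"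
      unfolding tm_def schur_term_def by (rule prod.cong) (simp_all add: rect_tableau_rho rearranged_rho)
    also have "\<dots> = (\<Prod>b'\<in>diagram (rect_shape D L). of_nat (rect_tableau D L b') powr (- val (\<sigma> (rearranged D v L b'))))"
      by (rule prod.reindex_bij_betw[OF bij_rho])
    finally show ?thesis by (simp add: schur_term_def)
  qed
  \<comment> \<open>Replacing the arrangement of \<open>L\<close> by the chosen \<open>u nu\<close>
    costs a permutation \<tau> that depends on \<open>L\<close> but not on \<sigma>, so it is
    absorbed by summing over all \<sigma>.\<close>
  have h_tm: "\<exists>\<tau>. \<tau> permutes (v ` ?B) \<and> (\<forall>\<sigma>. h nu \<sigma> (rect_tableau D L) = tm (\<sigma> \<circ> \<tau>) L)"
    if nu: "nu \<in> ?G" and L: "L \<in> S nu" for nu L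
  proof -
    obtain L0 where L0: "u nu = rearranged D v L0" "L0 \<in> SSYT D" "rect_shape D L0 = nu"
      using family[OF nu] by (auto simp: U_set_def)
    have L': "L \<in> SSYT D" "rect_shape D L = nu" using L by (auto simp: S_def)
    then have "rect_shape D L = rect_shape D L0" using L0 by simp
    from rearranged_permutes[OF L'(1) L0(2) this variables(2)] obtain \<tau>
      where \<tau>: "\<tau> permutes (v ` ?B)" "\<And>b'. b' \<in> diagram nu \<Longrightarrow> u nu b' = \<tau> (rearranged D v L b')"
      unfolding L0(1) L'(2) by blast
    have "h nu \<sigma> (rect_tableau D L) = tm (\<sigma> \<circ> \<tau>) L" for \<sigma>
      unfolding h_def tm_rect L'(2) schur_term_def by (rule prod.cong) (simp_all add: \<tau>(2))
    then show ?thesis using \<tau>(1) by blast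
  qed
  have sum_h: "(\<Sum>\<sigma>\<in>Q. h nu \<sigma> (rect_tableau D L)) = (\<Sum>\<sigma>\<in>Q. tm \<sigma> L)" if nu: "nu \<in> ?G" and L: "L \<in> S nu" for nu L
  proof -
    obtain \<tau> where \<tau>: "\<tau> permutes (v ` ?B)" "\<And>\<sigma>. h nu \<sigma> (rect_tableau D L) = tm (\<sigma> \<circ> \<tau>) L"
      using h_tm[OF nu L] by blast
    show ?thesis unfolding \<tau>(2) Q_def by (rule sum_permutations_compose_right[OF \<tau>(1), symmetric])
  qed
  \<comment> \<open>Since \<tau> varies with \<open>L\<close>, no single \<open>tm\<close> dominates
    the terms; the sum of the norms over all permutations does.\<close>
  have summable_h: "(\<lambda>L. h nu \<sigma> (rect_tableau D L)) summable_on S nu" if nu: "nu \<in> ?G" and \<sigma>: "\<sigma> \<in> Q" for nu \<sigma>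
  proof (rule abs_summable_summable, rule summable_on_comparison_test)
    have "(\<lambda>L. \<Sum>\<sigma>\<in>Q. norm (tm \<sigma> L)) summable_on SSYT D"
      by (rule sum_infsum_swap(2)[OF finP abs_tm])
    then show "(\<lambda>L. \<Sum>\<sigma>\<in>Q. norm (tm \<sigma> L)) summable_on S nu"
      by (rule summable_on_subset_banach) (auto simp: S_def)
    fix L assume "L \<in> S nu"
    then obtain \<tau> where \<tau>: "\<tau> permutes (v ` ?B)" "h nu \<sigma> (rect_tableau D L) = tm (\<sigma> \<circ> \<tau>) L"
      using h_tm[OF nu] by blast
    have "\<sigma> \<circ> \<tau> \<in> Q" using \<sigma> \<tau>(1) by (simp add: Q_def permutes_compose)
    then show "norm (h nu \<sigma> (rect_tableau D L)) \<le> (\<Sum>\<sigma>\<in>Q. norm (tm \<sigma> L))"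
      unfolding \<tau>(2) by (rule member_le_sum[of _ _ "\<lambda>\<sigma>. norm (tm \<sigma> L)", OF _ _ finP]) simp
  qed simp
  have fibres: "infsum (\<lambda>L. h nu \<sigma> (rect_tableau D L)) (S nu) =
      of_int (lr_coeff mu nu lam) * schur_zeta (diagram nu) (val \<circ> \<sigma> \<circ> u nu)"
    if nu: "nu \<in> ?G" and \<sigma>: "\<sigma> \<in> Q" for nu \<sigma>
  proof -
    have par: "is_partition nu" and pos: "lr_coeff mu nu lam > 0" using nu by (auto simp: G_set_def)
    define c where "c = nat (lr_coeff mu nu lam)"
    have fib: "{L \<in> S nu. rect_tableau D L = T} = {L \<in> SSYT D. rect D L = (nu, T)}" for T
      by (auto simp: S_def rect_shape_def rect_tableau_def prod_eq_iff)
    have "infsum (\<lambda>L. h nu \<sigma> (rect_tableau D L)) (S nu) = of_nat c * infsum (h nu \<sigma>) (SSYT (diagram nu))"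
    proof (rule infsum_fibres[where f = "h nu \<sigma>" and g = "rect_tableau D"])
      show "(\<lambda>L. h nu \<sigma> (rect_tableau D L)) summable_on S nu" by (rule summable_h[OF nu \<sigma>])
      show "rect_tableau D L \<in> SSYT (diagram nu)" if "L \<in> S nu" for L
        using rect_SSYT[of L] that unfolding S_def by blast
      show "finite {L \<in> S nu. rect_tableau D L = T}" for T unfolding fib by (rule finite_rect_fibre)
      show "card {L \<in> S nu. rect_tableau D L = T} = c" if "T \<in> SSYT (diagram nu)" for T
        unfolding fib using card_fibre[OF par that] by (simp add: c_def)
    qed
    moreover have "(of_nat c :: complex) = of_int (lr_coeff mu nu lam)" using pos by (simp add: c_def)
    ultimately show ?thesis by (simp add: schur_zeta_term h_def)
  qed
  have sum_sum_tm: "(\<lambda>L. \<Sum>\<sigma>\<in>Q. tm \<sigma> L) summable_on SSYT D"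
    by (rule sum_infsum_swap(2)[OF finP sum_tm])
  \<comment> \<open>The splitting by shape is applied to the symmetrised summand, because the
    replacement of arrangements is valid only after summing over \<sigma>.\<close>
  have "SSYT D = (\<Union>nu\<in>?G. S nu)" unfolding G_set_eq S_def by blast
  then have "infsum (\<lambda>L. \<Sum>\<sigma>\<in>Q. tm \<sigma> L) (SSYT D) = infsum (\<lambda>L. \<Sum>\<sigma>\<in>Q. tm \<sigma> L) (\<Union>nu\<in>?G. S nu)" by simp
  also have "\<dots> = (\<Sum>nu\<in>?G. infsum (\<lambda>L. \<Sum>\<sigma>\<in>Q. tm \<sigma> L) (S nu))"
  proof (rule sum_infsum[OF finite_G_set, symmetric])
    show "(\<lambda>L. \<Sum>\<sigma>\<in>Q. tm \<sigma> L) summable_on S nu" for nu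
      by (rule summable_on_subset_banach[OF sum_sum_tm]) (auto simp: S_def)
  qed (auto simp: S_def)
  also have "\<dots> = (\<Sum>nu\<in>?G. infsum (\<lambda>L. \<Sum>\<sigma>\<in>Q. h nu \<sigma> (rect_tableau D L)) (S nu))"
    by (rule sum.cong[OF refl], rule infsum_cong, rule sum_h[symmetric])
  also have "\<dots> = (\<Sum>nu\<in>?G. \<Sum>\<sigma>\<in>Q. infsum (\<lambda>L. h nu \<sigma> (rect_tableau D L)) (S nu))"
    by (rule sum.cong[OF refl], rule sum_infsum_swap(1)[OF finP, symmetric], rule summable_h)
  also have "\<dots> = (\<Sum>nu\<in>?G. \<Sum>\<sigma>\<in>Q. of_int (lr_coeff mu nu lam) * schur_zeta (diagram nu) (val \<circ> \<sigma> \<circ> u nu))"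
    by (rule sum.cong[OF refl], rule sum.cong[OF refl], rule fibres)
  also have "\<dots> = (\<Sum>\<sigma>\<in>Q. \<Sum>nu\<in>?G. of_int (lr_coeff mu nu lam) * schur_zeta (diagram nu) (val \<circ> \<sigma> \<circ> u nu))"
    by (rule sum.swap)
  finally have "infsum (\<lambda>L. \<Sum>\<sigma>\<in>Q. tm \<sigma> L) (SSYT D) =
      (\<Sum>\<sigma>\<in>Q. \<Sum>nu\<in>?G. of_int (lr_coeff mu nu lam) * schur_zeta (diagram nu) (val \<circ> \<sigma> \<circ> u nu))" .
  moreover have "(\<Sum>\<sigma>\<in>Q. schur_zeta D (val \<circ> \<sigma> \<circ> v)) = infsum (\<lambda>L. \<Sum>\<sigma>\<in>Q. tm \<sigma> L) (SSYT D)"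
    unfolding schur_zeta_term using sum_infsum_swap(1)[OF finP sum_tm] by (simp add: tm_def)
  ultimately show ?thesis unfolding Q_def by simp
qed

end
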